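(* Let $X$ be a compact metric space, let $P_t$, $t\ge 0$, be a Markov semigroup on $C(X)$ with generator $L$, let $V\in C(X)$, and let $\mu,\pi\in M(X)$. Suppose $\mu\ll\pi$ and suppose $\psi=d\mu/d\pi$ satisfies $\log\psi\in L^1(\mu)$. Then the following hold. (1) If $\pi$ is a ground measure for $V$ and $\psi$ is a ground state for $V$ relative to $\mu$, then $\mu$ is an equilibrium measure for $V$. (2) If $\pi$ is a ground measure for $V$ and $\mu$ is an equilibrium measure for $V$, then $\psi$ is a ground state for $V$ relative to $\mu$. (3) If $\mu$ is an equilibrium measure for $V$ and $\psi$ is a ground state for $V$ relative to $\mu$, then $\pi$ is a ground measure for $V$.
   Context: $C(X)$ is the space of real continuous functions on the compact metric space $X$ with the sup norm $\|\cdot\|$; $M(X)$ is the space of Borel probability measures on $X$ with the topology of weak convergence; $\mu(f)=\int_X f\,d\mu$; $L^1(\mu)$ is the space of $\mu$-integrable Borel functions. A Markov semigroup on $C(X)$ is a semigroup $P_t$, $t\ge0$, of bounded operators on $C(X)$ with $P_tf\ge0$ for $f\ge0$, $\|P_tf-f\|\to0$ as $t\to0+$ for all $f\in C(X)$, and $P_t1=1$. Its generator is $Lf=\lim_{t\to0+}\frac1t(P_tf-f)$ (limit in $C(X)$), defined on the dense domain $\mathcal D\subset C(X)$ where the limit exists. $\mathcal D^+$ is the set of strictly positive functions in $\mathcal D$. For $V\in C(X)$, the Schrodinger semigroup $P_t^V$, $t\ge0$, on $C(X)$ is the strongly continuous positive semigroup generated by $L+V$; equivalently $u(t)=P_t^Vf$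 is the unique solution of $u(t)=P_tf+\int_0^tP_{t-s}Vu(s)\,ds$, $t\ge0$, for $f\in C(X)$. By positivity $P_t^Vf(x)=\int_X p^V(t,x,dy)f(y)$ for a family of bounded positive measures $p^V(t,x,\cdot)$, so $0\le P_t^Vf(x)\le+\infty$ is defined for every nonnegative Borel $f$. The principal eigenvalue is $\lambda_V=\lim_{t\to\infty}\frac1t\log\|P_t^V\|$; it is given by the Donsker-Varadhan formula $\lambda_V=\sup_{\mu\in M(X)}\left(\int_XV\,d\mu-I(\mu)\right)$, where $I(\mu)=-\inf_{u\in\mathcal D^+}\int_X\frac{Lu}{u}\,d\mu$. An equilibrium measure for $V$ is a $\mu\in M(X)$ with $\lambda_V=\mu(V)-I(\mu)$. A ground measure for $V$ is a $\pi\in M(X)$ with $\int_Xe^{-\lambda_Vt}P_t^Vf\,d\pi=\int_Xf\,d\pi$ for all $t\ge0$, $f\in C(X)$. A ground state for $V$ relative to $\mu\in M(X)$ is a nonnegative Borel function $\psi$ on $X$ with $\psi>0$ $\mu$-a.e. and, for every $t\ge0$, $e^{-\lambda_Vt}P_t^V\psi=\psi$ $\mu$-a.e.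
   Formalization: Part (3) is proved under the extra assumption that ψ>0 everywhere on X; without it (3) is false: X={1,2}, L=0, V=(0,-1), μ=δ_1, π=(δ_1+δ_2)/2, ψ=(2,0) meets all hypotheses, yet π is not a ground measure. *)

theory Defs
  imports "HOL-Probability.Probability"
begin

text \<open>
  The compact metric space \<open>X\<close> is the carrier \<open>UNIV\<close> of a type of class \<^class>\<open>metric_space\<close>
  (compactness of \<open>UNIV\<close> is a hypothesis where it is needed), so that \<open>C(X)\<close> is the Banach space
  of bounded continuous functions with the sup norm. Semigroups are indexed by \<open>real\<close>; only their
  values at times \<open>t \<ge> 0\<close> matter.
\<close>

type_synonym 'a operator = "('a \<Rightarrow>\<^sub>C real) \<Rightarrow>\<^sub>L ('a \<Rightarrow>\<^sub>C real)"

definition borel_prob_measures :: "'a::metric_space measure set" where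
  "borel_prob_measures = {\<mu>. sets \<mu> = sets borel \<and> prob_space \<mu>}"

definition positive_semigroup :: "(real \<Rightarrow> 'a::metric_space operator) \<Rightarrow> bool" where
  "positive_semigroup P \<longleftrightarrow>
     P 0 = id_blinfun \<and>
     (\<forall>s\<ge>0. \<forall>t\<ge>0. P (s + t) = P s o\<^sub>L P t) \<and>
     (\<forall>t\<ge>0. \<forall>f. (\<forall>x. 0 \<le> apply_bcontfun f x) \<longrightarrow> (\<forall>x. 0 \<le> apply_bcontfun (P t f) x)) \<and>
     (\<forall>f. ((\<lambda>t. norm (P t f - f)) \<longlongrightarrow> 0) (at_right 0))"

definition markov_semigroup :: "(real \<Rightarrow> 'a::metric_space operator) \<Rightarrow> bool" where
  "markov_semigroup P \<longleftrightarrow>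
     positive_semigroup P \<and> (\<forall>t\<ge>0. P t (const_bcontfun 1) = const_bcontfun 1)"

definition generator_domain :: "(real \<Rightarrow> 'a::metric_space operator) \<Rightarrow> ('a \<Rightarrow>\<^sub>C real) set" where
  "generator_domain P = {f. \<exists>g. ((\<lambda>t. (1 / t) *\<^sub>R (P t f - f)) \<longlongrightarrow> g) (at_right 0)}"

definition generator :: "(real \<Rightarrow> 'a::metric_space operator) \<Rightarrow> ('a \<Rightarrow>\<^sub>C real) \<Rightarrow> ('a \<Rightarrow>\<^sub>C real)" where
  "generator P f = Lim (at_right 0) (\<lambda>t. (1 / t) *\<^sub>R (P t f - f))"

definition positive_domain :: "(real \<Rightarrow> 'a::metric_space operator) \<Rightarrow> ('a \<Rightarrow>\<^sub>C real) set" where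
  "positive_domain P = {u \<in> generator_domain P. \<forall>x. 0 < apply_bcontfun u x}"

text \<open>
  \<open>Q\<close> is the strongly continuous positive semigroup generated by \<open>L + V\<close>, where \<open>L\<close> is the
  generator of \<open>P\<close>. Multiplication by \<open>V\<close> is bounded, so \<open>L + V\<close> has the same domain as \<open>L\<close>.
\<close>

definition schrodinger_semigroup ::
  "(real \<Rightarrow> 'a::metric_space operator) \<Rightarrow> ('a \<Rightarrow>\<^sub>C real) \<Rightarrow> (real \<Rightarrow> 'a operator) \<Rightarrow> bool" where
  "schrodinger_semigroup P V Q \<longleftrightarrow>
     positive_semigroup Q \<and>
     generator_domain Q = generator_domain P \<and>
     (\<forall>f\<in>generator_domain P. \<forall>x.
        apply_bcontfun (generator Q f) x =
          apply_bcontfun (generator P f) x + apply_bcontfun V x * apply_bcontfun f x)"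

text \<open>
  The measure \<open>p(t,x,\<cdot>)\<close> with \<open>Q\<^sub>t f(x) = \<integral> f(y) p(t,x,dy)\<close> for continuous \<open>f\<close>. On a compact metric
  space and for a positive \<open>Q t\<close> it exists and is unique by the Riesz representation theorem.
\<close>

definition semigroup_kernel :: "(real \<Rightarrow> 'a::metric_space operator) \<Rightarrow> real \<Rightarrow> 'a \<Rightarrow> 'a measure" where
  "semigroup_kernel Q t x =
     (THE M. sets M = sets borel \<and> finite_measure M \<and>
        (\<forall>f. apply_bcontfun (Q t f) x = (\<integral>y. apply_bcontfun f y \<partial>M)))"

definition extended_semigroup ::
  "(real \<Rightarrow> 'a::metric_space operator) \<Rightarrow> real \<Rightarrow> ('a \<Rightarrow> real) \<Rightarrow> 'a \<Rightarrow> ennreal" where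
  "extended_semigroup Q t f x = (\<integral>\<^sup>+y. ennreal (f y) \<partial>semigroup_kernel Q t x)"

definition principal_eigenvalue :: "(real \<Rightarrow> 'a::metric_space operator) \<Rightarrow> real" where
  "principal_eigenvalue Q = Lim at_top (\<lambda>t. (1 / t) * ln (norm (Q t)))"

definition dv_rate :: "(real \<Rightarrow> 'a::metric_space operator) \<Rightarrow> 'a measure \<Rightarrow> ereal" where
  "dv_rate P \<mu> =
     - (INF u\<in>positive_domain P.
          ereal (\<integral>x. apply_bcontfun (generator P u) x / apply_bcontfun u x \<partial>\<mu>))"

text \<open>In the following, \<open>Q\<close> stands for the Schrodinger semigroup of \<open>P\<close> and \<open>V\<close>.\<close>

definition equilibrium_measure ::
  "(real \<Rightarrow> 'a::metric_space operator) \<Rightarrow> ('a \<Rightarrow>\<^sub>C real) \<Rightarrow> (real \<Rightarrow> 'a operator) \<Rightarrow> 'a measure \<Rightarrow> bool"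
  where
  "equilibrium_measure P V Q \<mu> \<longleftrightarrow>
     \<mu> \<in> borel_prob_measures \<and>
     ereal (principal_eigenvalue Q) = ereal (\<integral>x. apply_bcontfun V x \<partial>\<mu>) - dv_rate P \<mu>"

definition ground_measure :: "(real \<Rightarrow> 'a::metric_space operator) \<Rightarrow> 'a measure \<Rightarrow> bool" where
  "ground_measure Q \<pi> \<longleftrightarrow>
     \<pi> \<in> borel_prob_measures \<and>
     (\<forall>t\<ge>0. \<forall>f.
        (\<integral>x. exp (- principal_eigenvalue Q * t) * apply_bcontfun (Q t f) x \<partial>\<pi>) =
        (\<integral>x. apply_bcontfun f x \<partial>\<pi>))"

text \<open>
  Since \<open>semigroup_kernel Q t x\<close> may charge \<open>\<mu>\<close>-null sets, being a ground state relative to \<open>\<mu>\<close>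
  depends on \<open>\<psi>\<close> as a function and not only on its \<open>\<mu>\<close>-a.e. class.
\<close>

definition ground_state ::
  "(real \<Rightarrow> 'a::metric_space operator) \<Rightarrow> 'a measure \<Rightarrow> ('a \<Rightarrow> real) \<Rightarrow> bool" where
  "ground_state Q \<mu> \<psi> \<longleftrightarrow>
     \<psi> \<in> borel_measurable borel \<and> (\<forall>x. 0 \<le> \<psi> x) \<and>
     (AE x in \<mu>. 0 < \<psi> x) \<and>
     (\<forall>t\<ge>0. AE x in \<mu>.
        ennreal (exp (- principal_eigenvalue Q * t)) * extended_semigroup Q t \<psi> x = ennreal (\<psi> x))"

end

theory Submission
  imports Defs
begin

text \<open>
  Write \<open>\<lambda>\<close> for the principal eigenvalue, \<open>R\<^sub>t = exp (-\<lambda>t) Q\<^sub>t\<close>, and \<open>k\<^sub>t(x,\<cdot>)\<close> for the kernel of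
  \<open>R\<^sub>t\<close>. Three conditions have to be compared: \<open>\<pi>\<close> is invariant under \<open>R\<close>, \<open>R\<^sub>t \<psi> = \<psi>\<close> holds
  \<open>\<mu>\<close>-a.e., and \<open>\<mu>\<close> is an equilibrium measure. The plan is to turn the last one, a variational
  statement about the generator, into a statement about the operators \<open>R\<^sub>t\<close>.

  Since the generator of \<open>R\<close> is \<open>L + V - \<lambda>\<close>, the equation \<open>\<lambda> = \<mu>(V) - I(\<mu>)\<close> says that the infimum
  of \<open>\<integral> (L + V - \<lambda>)u / u d\<mu>\<close> over positive \<open>u\<close> in the domain is \<open>0\<close>. It is never positive:
  the truncated resolvent \<open>u = \<integral>\<^sub>0\<^sup>T exp (-(\<lambda>+e)s) Q\<^sub>s 1 ds\<close> satisfies \<open>(L + V - \<lambda>)u \<le> e u\<close> once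
  \<open>exp (-(\<lambda>+e)T) Q\<^sub>T 1 \<le> 1\<close>, which happens for some \<open>T\<close> because \<open>\<lambda>\<close> is the growth rate of \<open>Q\<close>
  (\<open>near_harmonic_function\<close>). So \<open>\<mu>\<close> is an equilibrium measure iff all these integrals are
  nonnegative (\<open>dissipative\<close>), and, as \<open>\<integral> (L + V - \<lambda>)u / u d\<mu>\<close> is the derivative of
  \<open>\<integral> ln (R\<^sub>t u) d\<mu>\<close>, iff \<open>\<integral> ln (R\<^sub>t u) d\<mu> \<ge> \<integral> ln u d\<mu>\<close> for all \<open>t\<close> and all continuous \<open>u > 0\<close>
  (\<open>log_increasing\<close>). By density this extends to Borel \<open>u\<close> with values in a compact
  subinterval of the positive half line (\<open>log_increasing_borel\<close>).

  With \<open>\<mu> = \<psi> \<pi>\<close>, the three implications hold for each single \<open>t\<close>.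
  If \<open>\<pi>\<close> is invariant and \<open>R\<^sub>t \<psi> = \<psi>\<close>, then the Doob transform \<open>k\<^sub>t(x,dy) \<psi>(y) / \<psi>(x)\<close> is a Markov
  kernel leaving \<open>\<mu>\<close> invariant, and Jensen's inequality for \<open>ln (u / \<psi>)\<close> gives \<open>log_increasing\<close>
  (\<open>log_increasing_if_invariant\<close>).
  If \<open>\<pi>\<close> is invariant and \<open>log_increasing\<close> holds, the choice \<open>u = \<psi>\<close> gives
  \<open>\<integral> ln (R\<^sub>t \<psi> / \<psi>) d\<mu> \<ge> 0\<close>, whereas \<open>\<integral> R\<^sub>t \<psi> / \<psi> d\<mu> \<le> \<integral> R\<^sub>t \<psi> d\<pi> = 1\<close>; by strict concavity
  \<open>R\<^sub>t \<psi> / \<psi> = 1\<close> \<open>\<mu>\<close>-a.e. (\<open>ground_state_if_subinvariant\<close>).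
  If \<open>R\<^sub>t \<psi> = \<psi>\<close> and \<open>log_increasing\<close> holds, then \<open>\<psi>\<close> minimises
  \<open>\<integral> ln (R\<^sub>t u) - ln u d\<mu>\<close>, and the first variation in the directions \<open>\<psi> 1\<^sub>A\<close> is the invariance of
  \<open>\<pi>\<close> (\<open>invariant_if_ground_state\<close>). The hypothesis \<open>ln \<psi> \<in> L\<^sup>1(\<mu>)\<close> is what permits the choice
  \<open>u = \<psi>\<close>, after truncation of \<open>\<psi>\<close> to \<open>[1/n, n]\<close>.

  The kernel is defined by a definite description, so its existence, the Riesz representation
  theorem on a compact metric space, is proved first.
\<close>

section \<open>Riesz representation on a compact metric space\<close>

lemma apply_Bcontfun_compact:
  fixes f :: "'a::metric_space \<Rightarrow> real"
  assumes "compact (UNIV :: 'a set)" "continuous_on UNIV f"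
  shows "apply_bcontfun (Bcontfun f) = f"
proof (rule Bcontfun_inverse)
  show "f \<in> bcontfun"
    using compact_imp_bounded[OF compact_continuous_image[OF assms(2,1)]] assms(2)
    by (simp add: bcontfun_def)
qed

lemma borel_measurable_bcontfun [measurable]: "apply_bcontfun f \<in> borel_measurable borel"
  for f :: "'a::topological_space \<Rightarrow>\<^sub>C 'b::metric_space"
  by (intro borel_measurable_continuous_onI) auto

text \<open>
  Continuous functions decreasing to the indicator of a closed set \<open>F\<close>. As \<open>infdist x {} = 0\<close>, the
  cutoffs of the empty set are constantly \<open>1\<close>, so that case is excluded from the limits below.
\<close>

definition cutoff :: "'a::metric_space set \<Rightarrow> nat \<Rightarrow> 'a \<Rightarrow> real" where
  "cutoff F k x = max 0 (1 - real k * infdist x F)"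

lemma cutoff_bounds: "0 \<le> cutoff F k x" "cutoff F k x \<le> 1"
  by (auto simp: cutoff_def infdist_nonneg)

lemma continuous_cutoff [continuous_intros]: "continuous_on UNIV (cutoff F k)"
  unfolding cutoff_def by (intro continuous_intros)

lemma borel_measurable_cutoff [measurable]: "cutoff F k \<in> borel_measurable borel"
  by (intro borel_measurable_continuous_onI continuous_cutoff)

lemma cutoff_antimono: "j \<le> k \<Longrightarrow> cutoff F k x \<le> cutoff F j x"
  unfolding cutoff_def by (intro max.mono diff_left_mono mult_right_mono) (auto simp: infdist_nonneg)

lemma cutoff_in: "x \<in> F \<Longrightarrow> cutoff F k x = 1"
  by (simp add: cutoff_def)

lemma cutoff_tendsto:
  assumes "closed F" "F \<noteq> {}"
  shows "(\<lambda>k. cutoff F k x) \<longlonglongrightarrow> indicator F x"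
proof (cases "x \<in> F")
  case False
  then have d: "infdist x F > 0"
    using assms infdist_pos_not_in_closed by blast
  then obtain N :: nat where N: "1 / infdist x F < real N" using reals_Archimedean2 by blast
  have "eventually (\<lambda>k. cutoff F k x = 0) sequentially"
    using eventually_ge_at_top[of N]
  proof eventually_elim
    case (elim k)
    have "1 < real N * infdist x F" using N d by (simp add: field_simps)
    also have "\<dots> \<le> real k * infdist x F" using elim d by (intro mult_right_mono) auto
    finally show ?case by (simp add: cutoff_def)
  qed
  then show ?thesis using False by (simp add: tendsto_eventually)
qed (simp add: cutoff_in)

definition cutoff_bc :: "'a::metric_space set \<Rightarrow> nat \<Rightarrow> 'a \<Rightarrow>\<^sub>C real" where
  "cutoff_bc F k = Bcontfun (cutoff F k)"

lemma apply_cutoff_bc [simp]: "apply_bcontfun (cutoff_bc F k) = cutoff F k"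
  unfolding cutoff_bc_def
proof (rule Bcontfun_inverse)
  show "cutoff F k \<in> bcontfun"
    using cutoff_bounds[of F k]
    by (intro bcontfun_normI[where b=1] continuous_cutoff) auto
qed

lemma sets_borel_closed: "sets (borel :: 'a::topological_space measure) = sigma_sets UNIV {F. closed F}"
  by (simp add: borel_eq_closed)

lemma Int_stable_closed: "Int_stable {F :: 'a::topological_space set. closed F}"
  by (auto simp: Int_stable_def)

lemma integral_cutoff_tendsto:
  fixes M :: "'a::metric_space measure"
  assumes "sets M = sets borel" "finite_measure M" "closed F" "F \<noteq> {}"
  shows "(\<lambda>k. \<integral>x. cutoff F k x \<partial>M) \<longlonglongrightarrow> measure M F"
proof -
  interpret finite_measure M by fact
  have [measurable_cong]: "sets M = sets borel" by fact
  have [measurable]: "F \<in> sets borel" "cutoff F k \<in> borel_measurable borel" for k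
    using assms by (auto intro: borel_measurable_continuous_onI continuous_cutoff)
  have "(\<lambda>k. \<integral>x. cutoff F k x \<partial>M) \<longlonglongrightarrow> (\<integral>x. indicator F x \<partial>M)"
  proof (rule integral_dominated_convergence[where w="\<lambda>_. 1"])
    show "AE x in M. (\<lambda>k. cutoff F k x) \<longlonglongrightarrow> indicator F x"
      by (intro AE_I2 cutoff_tendsto assms)
    show "AE x in M. norm (cutoff F k x) \<le> 1" for k
      using cutoff_bounds[of F k] by auto
    show "(\<lambda>x. indicator F x :: real) \<in> borel_measurable M" by measurable
    show "cutoff F k \<in> borel_measurable M" for k by measurable
  qed auto
  then show ?thesis using sets_eq_imp_space_eq[OF assms(1)] by simp
qed

text \<open>
  The integrals of the cutoffs determine the measures of the closed sets, which form a generator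
  that is stable under intersections.
\<close>

lemma finite_borel_measure_eqI:
  fixes M N :: "'a::metric_space measure"
  assumes M: "sets M = sets borel" "finite_measure M"
    and N: "sets N = sets borel" "finite_measure N"
    and eq: "\<And>f :: 'a \<Rightarrow>\<^sub>C real. (\<And>x. 0 \<le> f x) \<Longrightarrow> (\<integral>x. f x \<partial>M) = (\<integral>x. f x \<partial>N)"
  shows "M = N"
proof (rule measure_eqI_generator_eq[OF Int_stable_closed, where \<Omega>=UNIV and A="\<lambda>_. UNIV"])
  interpret M: finite_measure M by fact
  interpret N: finite_measure N by fact
  fix F :: "'a set" assume F: "F \<in> {F. closed F}"
  show "emeasure M F = emeasure N F"
  proof (cases "F = {}")
    case False
    have "measure M F = measure N F"
    proof (rule LIMSEQ_unique)
      show "(\<lambda>k. \<integral>x. cutoff F k x \<partial>M) \<longlonglongrightarrow> measure M F"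
        using F False by (intro integral_cutoff_tendsto M) auto
      show "(\<lambda>k. \<integral>x. cutoff F k x \<partial>M) \<longlonglongrightarrow> measure N F"
        using integral_cutoff_tendsto[OF N, of F] F False eq[of "cutoff_bc F _"] cutoff_bounds(1)[of F] by simp
    qed
    then show ?thesis by (simp add: M.emeasure_eq_measure N.emeasure_eq_measure)
  qed simp
qed (use assms in \<open>auto simp: sets_borel_closed finite_measure.emeasure_finite\<close>)

text \<open>
  The upper integral attached to \<open>\<Lambda>\<close>, defined through covers by countable sums of nonnegative
  continuous functions. In this form countable subadditivity is immediate for all functions
  \<open>h\<close>, and restricted to indicators it is an outer measure.
\<close>

definition upper_ext :: "(('a::metric_space \<Rightarrow>\<^sub>C real) \<Rightarrow> real) \<Rightarrow> ('a \<Rightarrow> ennreal) \<Rightarrow> ennreal" where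
  "upper_ext \<Lambda> h =
     (INF g \<in> {g :: nat \<Rightarrow> 'a \<Rightarrow>\<^sub>C real. (\<forall>n x. 0 \<le> g n x) \<and> (\<forall>x. h x \<le> (\<Sum>n. ennreal (g n x)))}.
        \<Sum>n. ennreal (\<Lambda> (g n)))"

locale positive_functional =
  fixes \<Lambda> :: "('a::metric_space \<Rightarrow>\<^sub>C real) \<Rightarrow> real"
  assumes compact_UNIV: "compact (UNIV :: 'a set)"
    and linear: "linear \<Lambda>"
    and nonneg: "\<And>f. (\<And>x. 0 \<le> apply_bcontfun f x) \<Longrightarrow> 0 \<le> \<Lambda> f"
begin

abbreviation "U \<equiv> upper_ext \<Lambda>"

lemma mono: "(\<And>x. apply_bcontfun f x \<le> apply_bcontfun g x) \<Longrightarrow> \<Lambda> f \<le> \<Lambda> g"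
  using nonneg[of "g - f"] by (simp add: linear_diff[OF linear])

lemma apply_Bcontfun: "continuous_on UNIV f \<Longrightarrow> apply_bcontfun (Bcontfun f) = f" for f :: "'a \<Rightarrow> real"
  by (rule apply_Bcontfun_compact[OF compact_UNIV])

lemma upper_ext_le:
  assumes "\<And>n x. 0 \<le> apply_bcontfun (g n) x" "\<And>x. h x \<le> (\<Sum>n. ennreal (g n x))"
  shows "U h \<le> (\<Sum>n. ennreal (\<Lambda> (g n)))"
  unfolding upper_ext_def using assms by (intro INF_lower) auto

lemma upper_ext_greatest:
  assumes "\<And>g. (\<And>n x. 0 \<le> apply_bcontfun (g n) x) \<Longrightarrow> (\<And>x. h x \<le> (\<Sum>n. ennreal (g n x))) \<Longrightarrow>
    c \<le> (\<Sum>n. ennreal (\<Lambda> (g n)))"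
  shows "c \<le> U h"
  unfolding upper_ext_def using assms by (intro INF_greatest) auto

lemma upper_ext_mono: "(\<And>x. h x \<le> k x) \<Longrightarrow> U h \<le> U k"
  by (rule upper_ext_greatest, rule upper_ext_le) (blast intro: order_trans)+

lemma upper_ext_approx:
  assumes "U h < c"
  obtains g where "\<And>n x. 0 \<le> apply_bcontfun (g n) x" "\<And>x. h x \<le> (\<Sum>n. ennreal (g n x))"
    "(\<Sum>n. ennreal (\<Lambda> (g n))) < c"
  using assms unfolding upper_ext_def INF_less_iff by auto

text \<open>
  Covers of the \<open>h n\<close>, optimal up to \<open>e / 2^(n+1)\<close>, are merged into one cover of the sum.
\<close>

lemma upper_ext_suminf: "U (\<lambda>x. \<Sum>n. h n x) \<le> (\<Sum>n. U (h n))"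
proof (cases "(\<Sum>n. U (h n)) = top")
  case False
  then have fin: "U (h n) < top" for n
    using ennreal_suminf_lessD[of "\<lambda>n. U (h n)" top n] by (simp add: less_top)
  show ?thesis
  proof (rule ennreal_le_epsilon)
    fix e :: real assume e: "0 < e"
    have "\<exists>g. (\<forall>m x. 0 \<le> apply_bcontfun (g m) x) \<and> (\<forall>x. h n x \<le> (\<Sum>m. ennreal (g m x))) \<and>
        (\<Sum>m. ennreal (\<Lambda> (g m))) < U (h n) + ennreal (e * (1/2)^Suc n)" for n
    proof -
      have "U (h n) < U (h n) + ennreal (e * (1/2)^Suc n)"
        using fin[of n] e by (auto simp: ennreal_add_left_cancel_less[of _ 0, simplified])
      from upper_ext_approx[OF this] show ?thesis by metis
    qed
    then obtain g where g: "\<And>n m x. 0 \<le> apply_bcontfun (g n m) x"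
      "\<And>n x. h n x \<le> (\<Sum>m. ennreal (g n m x))"
      "\<And>n. (\<Sum>m. ennreal (\<Lambda> (g n m))) < U (h n) + ennreal (e * (1/2)^Suc n)" by metis
    define G where "G i = g (fst (prod_decode i)) (snd (prod_decode i))" for i
    have "U (\<lambda>x. \<Sum>n. h n x) \<le> (\<Sum>i. ennreal (\<Lambda> (G i)))"
    proof (rule upper_ext_le)
      fix x
      have "(\<Sum>n. h n x) \<le> (\<Sum>n. \<Sum>m. ennreal (g n m x))" by (intro suminf_le g) auto
      also have "\<dots> = (\<Sum>i. ennreal (G i x))"
        unfolding G_def
        by (rule suminf_ennreal_2dimen[where f="\<lambda>p. ennreal (g (fst p) (snd p) x)", symmetric, simplified]) auto
      finally show "(\<Sum>n. h n x) \<le> (\<Sum>i. ennreal (G i x))" .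
    qed (simp add: G_def g)
    also have "\<dots> = (\<Sum>n. \<Sum>m. ennreal (\<Lambda> (g n m)))"
      unfolding G_def
      by (rule suminf_ennreal_2dimen[where f="\<lambda>p. ennreal (\<Lambda> (g (fst p) (snd p)))", simplified]) auto
    also have "\<dots> \<le> (\<Sum>n. U (h n) + ennreal (e * (1/2)^Suc n))"
      by (intro suminf_le less_imp_le g) auto
    also have "\<dots> = (\<Sum>n. U (h n)) + (\<Sum>n. ennreal (e * (1/2)^Suc n))"
      by (intro suminf_add[symmetric]) auto
    also have "(\<Sum>n. ennreal (e * (1/2)^Suc n)) = ennreal e"
      using sums_mult[OF power_half_series, of e] e by (intro suminf_ennreal_eq) (auto simp: ac_simps)
    finally show "U (\<lambda>x. \<Sum>n. h n x) \<le> (\<Sum>n. U (h n)) + ennreal e" .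
  qed
qed simp

lemma upper_ext_zero: "U (\<lambda>_. 0) = 0"
  using upper_ext_le[of "\<lambda>_. 0" "\<lambda>_. 0"] by (simp add: linear_0[OF linear])

lemma upper_ext_add: "U (\<lambda>x. h x + k x) \<le> U h + U k"
proof -
  have "(\<Sum>n. (if n = 0 then h x else if n = Suc 0 then k x else 0)) = h x + k x" for x
    by (subst suminf_finite[of "{0, Suc 0}"]) auto
  moreover have "(\<Sum>n. U (\<lambda>x. (if n = 0 then h x else if n = Suc 0 then k x else 0))) = U h + U k"
    by (subst suminf_finite[of "{0, Suc 0}"]) (auto simp: upper_ext_zero)
  ultimately show ?thesis
    using upper_ext_suminf[of "\<lambda>n x. (if n = 0 then h x else if n = Suc 0 then k x else 0)"] by simp
qed

lemma upper_ext_scale: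
  assumes "0 < c"
  shows "U (\<lambda>x. ennreal c * h x) \<le> ennreal c * U h"
proof -
  have "U (\<lambda>x. ennreal c * h x) / ennreal c \<le> U h"
  proof (rule upper_ext_greatest)
    fix g assume g: "\<And>n x. 0 \<le> apply_bcontfun (g n) x" "\<And>x. h x \<le> (\<Sum>n. ennreal (g n x))"
    have "U (\<lambda>x. ennreal c * h x) \<le> (\<Sum>n. ennreal (\<Lambda> (c *\<^sub>R g n)))"
      using g assms by (intro upper_ext_le) (auto simp: ennreal_mult ennreal_suminf_cmult intro!: mult_left_mono)
    also have "\<dots> = ennreal c * (\<Sum>n. ennreal (\<Lambda> (g n)))"
      using assms by (simp add: linear_scale[OF linear] ennreal_mult' ennreal_suminf_cmult)
    finally show "U (\<lambda>x. ennreal c * h x) / ennreal c \<le> (\<Sum>n. ennreal (\<Lambda> (g n)))"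
      using assms by (auto simp: divide_le_posI_ennreal)
  qed
  then have "ennreal c * (U (\<lambda>x. ennreal c * h x) / ennreal c) \<le> ennreal c * U h"
    by (rule mult_left_mono) simp
  then show ?thesis
    using assms by (simp add: ennreal_times_divide mult.commute[of "ennreal c"] ennreal_mult_divide_eq)
qed

text \<open>
  The extension agrees with \<open>\<Lambda>\<close> on continuous functions because, by Dini's argument, a countable
  cover of \<open>f\<close> by nonnegative continuous functions has a finite part that covers \<open>f\<close> up to \<open>d\<close>.
  Compactness enters at this point.
\<close>

lemma upper_ext_continuous:
  assumes "\<And>x. 0 \<le> apply_bcontfun f x"
  shows "U (\<lambda>x. ennreal (f x)) = ennreal (\<Lambda> f)"
proof (rule antisym)
  have "(\<Sum>n. ennreal ((if n = 0 then f else 0) x)) = ennreal (f x)" for x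
    by (subst suminf_finite[of "{0::nat}"]) auto
  moreover have "(\<Sum>n. ennreal (\<Lambda> (if n = 0 then f else 0))) = ennreal (\<Lambda> f)"
    by (subst suminf_finite[of "{0::nat}"]) (auto simp: linear_0[OF linear])
  ultimately show "U (\<lambda>x. ennreal (f x)) \<le> ennreal (\<Lambda> f)"
    using upper_ext_le[of "\<lambda>n. if n = 0 then f else 0" "\<lambda>x. ennreal (f x)"] assms by (simp split: if_splits)
next
  show "ennreal (\<Lambda> f) \<le> U (\<lambda>x. ennreal (f x))"
  proof (rule upper_ext_greatest)
    fix g :: "nat \<Rightarrow> 'a \<Rightarrow>\<^sub>C real"
    assume g: "\<And>n x. 0 \<le> apply_bcontfun (g n) x" "\<And>x. ennreal (f x) \<le> (\<Sum>n. ennreal (g n x))"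
    define S where "S N = (\<Sum>n<N. g n)" for N
    have S: "apply_bcontfun (S N) x = (\<Sum>n<N. g n x)" for N x
      by (induction N) (auto simp: S_def)
    have incS: "S N x \<le> S M x" if "N \<le> M" for N M x
      unfolding S using that g(1) by (intro sum_mono2) auto
    define one :: "'a \<Rightarrow>\<^sub>C real" where "one = const_bcontfun 1"
    show "ennreal (\<Lambda> f) \<le> (\<Sum>n. ennreal (\<Lambda> (g n)))"
    proof (rule ennreal_le_epsilon)
      fix e :: real assume e: "0 < e"
      define d where "d = e / (\<Lambda> one + 1)"
      have one: "\<Lambda> one \<ge> 0" by (intro nonneg) (simp add: one_def)
      have d: "d > 0" using e one by (simp add: d_def)
      have "\<exists>N. UNIV \<subseteq> {x. f x < S N x + d}"
      proof -
        have "\<exists>N. f x < S N x + d" for x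
        proof (rule ccontr)
          assume "\<not> ?thesis"
          then have le: "S N x \<le> f x - d" for N by (simp add: not_less algebra_simps)
          have "(\<Sum>n. ennreal (g n x)) \<le> ennreal (f x - d)"
          proof (rule suminf_le_const)
            fix N show "(\<Sum>n<N. ennreal (g n x)) \<le> ennreal (f x - d)"
              using le[of N] g(1) by (simp add: S ennreal_leI)
          qed auto
          with g(2)[of x] have "ennreal (f x) \<le> ennreal (f x - d)" by (rule order_trans)
          moreover have "0 \<le> f x - d" using le[of 0] by (simp add: S)
          ultimately show False using d by simp
        qed
        then have "UNIV \<subseteq> (\<Union>N\<in>UNIV. {x. f x < S N x + d})" by auto
        moreover have "open {x. f x < S N x + d}" for N
          by (intro open_Collect_less continuous_intros) auto
        ultimately obtain C where C: "finite C" "UNIV \<subseteq> (\<Union>N\<in>C. {x. f x < S N x + d})"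
          using compactE_image[OF compact_UNIV, of UNIV "\<lambda>N. {x. f x < S N x + d}"] by (metis (no_types, lifting))
        have "UNIV \<subseteq> {x. f x < S (Max C) x + d}"
        proof
          fix x :: 'a
          obtain N where N: "N \<in> C" "f x < S N x + d" using C by auto
          then show "x \<in> {x. f x < S (Max C) x + d}" using incS[of N "Max C" x] C by auto
        qed
        then show ?thesis ..
      qed
      then obtain N where N: "\<And>x. f x < S N x + d" by auto
      have "\<Lambda> f \<le> \<Lambda> (S N + d *\<^sub>R one)"
        using N by (intro mono) (auto simp: one_def intro: less_imp_le)
      also have "\<dots> = (\<Sum>n<N. \<Lambda> (g n)) + d * \<Lambda> one"
        by (simp add: linear_add[OF linear] linear_scale[OF linear] S_def linear_sum[OF linear])
      also have "d * \<Lambda> one \<le> e" using one e by (simp add: d_def field_simps)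
      finally have "ennreal (\<Lambda> f) \<le> ennreal ((\<Sum>n<N. \<Lambda> (g n)) + e)" by (intro ennreal_leI) simp
      also have "\<dots> = (\<Sum>n<N. ennreal (\<Lambda> (g n))) + ennreal e"
        using e nonneg[OF g(1)] by (simp add: sum_nonneg)
      also have "\<dots> \<le> (\<Sum>n. ennreal (\<Lambda> (g n))) + ennreal e"
        by (intro add_right_mono sum_le_suminf) auto
      finally show "ennreal (\<Lambda> f) \<le> (\<Sum>n. ennreal (\<Lambda> (g n))) + ennreal e" .
    qed
  qed
qed

text \<open>
  Multiplying a cover of \<open>h\<close> by \<open>\<phi> j\<close> yields a cover of \<open>\<phi> j * h\<close>. So a continuous partition of
  unity splits the upper integral with no loss; this superadditivity is what Caratheodory's
  condition for closed sets comes from.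
\<close>

lemma upper_ext_split:
  assumes J: "finite J" and cont: "\<And>j. j \<in> J \<Longrightarrow> continuous_on UNIV (\<phi> j)"
    and pos: "\<And>j x. j \<in> J \<Longrightarrow> 0 \<le> \<phi> j x" and le: "\<And>x. (\<Sum>j\<in>J. \<phi> j x) \<le> (1::real)"
  shows "(\<Sum>j\<in>J. U (\<lambda>x. ennreal (\<phi> j x) * h x)) \<le> U h"
proof (rule upper_ext_greatest)
  fix g :: "nat \<Rightarrow> 'a \<Rightarrow>\<^sub>C real"
  assume g: "\<And>n x. 0 \<le> apply_bcontfun (g n) x" "\<And>x. h x \<le> (\<Sum>n. ennreal (g n x))"
  define G where "G j n = Bcontfun (\<lambda>x. \<phi> j x * g n x)" for j n
  have G: "apply_bcontfun (G j n) = (\<lambda>x. \<phi> j x * g n x)" if "j \<in> J" for j n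
    unfolding G_def by (intro apply_Bcontfun continuous_intros cont that) auto
  have "(\<Sum>j\<in>J. U (\<lambda>x. ennreal (\<phi> j x) * h x)) \<le> (\<Sum>j\<in>J. \<Sum>n. ennreal (\<Lambda> (G j n)))"
  proof (intro sum_mono upper_ext_le)
    fix j x assume j: "j \<in> J"
    show "0 \<le> apply_bcontfun (G j n) x" for n using pos g j by (simp add: G)
    show "ennreal (\<phi> j x) * h x \<le> (\<Sum>n. ennreal (G j n x))"
      using pos g j by (simp add: G ennreal_mult mult_left_mono)
  qed
  also have "\<dots> = (\<Sum>n. \<Sum>j\<in>J. ennreal (\<Lambda> (G j n)))" by (rule suminf_sum[symmetric]) auto
  also have "\<dots> \<le> (\<Sum>n. ennreal (\<Lambda> (g n)))"
  proof (intro suminf_le)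
    fix n
    have app: "apply_bcontfun (\<Sum>j\<in>J'. G j n) x = (\<Sum>j\<in>J'. \<phi> j x * g n x)" if "J' \<subseteq> J" for J' x
      using finite_subset[OF that J] that by (induction J' rule: finite_induct) (auto simp: G)
    have "(\<Sum>j\<in>J. ennreal (\<Lambda> (G j n))) = ennreal (\<Lambda> (\<Sum>j\<in>J. G j n))"
      using pos g by (subst sum_ennreal) (auto simp: linear_sum[OF linear] G intro!: nonneg)
    also have "\<dots> \<le> ennreal (\<Lambda> (g n))"
    proof (intro ennreal_leI mono)
      fix x show "apply_bcontfun (\<Sum>j\<in>J. G j n) x \<le> g n x"
        using mult_right_mono[OF le[of x] g(1)[of n x]] by (simp add: app sum_distrib_right)
    qed
    finally show "(\<Sum>j\<in>J. ennreal (\<Lambda> (G j n))) \<le> ennreal (\<Lambda> (g n))" .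
  qed auto
  finally show "(\<Sum>j\<in>J. U (\<lambda>x. ennreal (\<phi> j x) * h x)) \<le> (\<Sum>n. ennreal (\<Lambda> (g n)))" .
qed

definition outer :: "'a set \<Rightarrow> ennreal" where "outer A = U (indicator A)"

lemma outer_empty: "outer {} = 0"
proof -
  have "indicator {} = (\<lambda>x::'a. 0::ennreal)" by (simp add: fun_eq_iff)
  then show ?thesis using upper_ext_zero by (simp add: outer_def)
qed

lemma outer_finite: "outer A < top"
proof -
  have "outer A \<le> U (\<lambda>x. ennreal ((const_bcontfun 1 :: 'a \<Rightarrow>\<^sub>C real) x))"
    unfolding outer_def by (intro upper_ext_mono) (auto simp: indicator_def)
  also have "\<dots> < top" by (subst upper_ext_continuous) auto
  finally show ?thesis .
qed

lemma outer_measure_space_outer: "outer_measure_space (Pow UNIV) outer"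
  unfolding outer_measure_space_def positive_def increasing_def countably_subadditive_def
proof (intro conjI ballI impI allI)
  show "outer {} = 0" by (rule outer_empty)
  show "outer x \<le> outer y" if "x \<subseteq> y" for x y
    using that unfolding outer_def by (intro upper_ext_mono) (auto simp: indicator_def)
  fix A :: "nat \<Rightarrow> 'a set" assume "disjoint_family A"
  then have "outer (\<Union>i. A i) = U (\<lambda>x. \<Sum>i. indicator (A i) x)"
    unfolding outer_def by (simp add: suminf_indicator)
  also have "\<dots> \<le> (\<Sum>i. outer (A i))" unfolding outer_def by (rule upper_ext_suminf)
  finally show "outer (\<Union>i. A i) \<le> (\<Sum>i. outer (A i))" .
qed

lemma tail_suminf_small:
  assumes "\<And>N. (\<Sum>j<N. a j) \<le> B" "B < (top::ennreal)" "0 < e"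
  shows "\<exists>N. (\<Sum>j. a (j + N)) \<le> ennreal e"
proof -
  have fin: "(\<Sum>j. a j) < top"
    using assms(1,2) by (meson le_less_trans suminf_le_const summableI)
  then have "a j < top" for j using ennreal_suminf_lessD by blast
  then obtain b where b: "\<And>j. a j = ennreal (b j)" "\<And>j. 0 \<le> b j"
    by (intro that[of "\<lambda>j. enn2real (a j)"]) auto
  then have sm: "summable b"
    using fin by (intro summable_suminf_not_top) (auto simp: less_top)
  from suminf_exist_split[OF assms(3) this] obtain N where N: "norm (\<Sum>i. b (i + N)) < e" by auto
  have "(\<Sum>j. a (j + N)) = ennreal (\<Sum>i. b (i + N))"
    using sm b by (simp add: suminf_ennreal2 summable_ignore_initial_segment)
  also have "\<dots> \<le> ennreal e" using N by (intro ennreal_leI) auto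
  finally show ?thesis ..
qed

text \<open>
  The cutoffs of \<open>F\<close> split \<open>A\<close> into a part containing \<open>A \<inter> F\<close> and a part supported off \<open>F\<close>. What the
  second part misses of \<open>A - F\<close> is the sum of the differences of consecutive cutoffs, beyond
  some index \<open>N\<close>; by \<open>upper_ext_split\<close> the whole series of their upper integrals is bounded by
  \<open>outer A\<close>, so its tails are small.
\<close>

lemma closed_in_lambda_system:
  assumes F: "closed F"
  shows "F \<in> lambda_system UNIV (Pow UNIV) outer"
proof -
  have "outer (A \<inter> F) + outer (A - F) = outer A" for A
  proof (cases "F = {}")
    case True
    then show ?thesis by (simp add: outer_empty)
  next
    case False
    show ?thesis
    proof (rule antisym)
      have "outer A = U (\<lambda>x. indicator (A \<inter> F) x + indicator (A - F) x)"
        unfolding outer_def by (intro arg_cong[where f=U]) (auto simp: indicator_def)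
      then show "outer A \<le> outer (A \<inter> F) + outer (A - F)"
        unfolding outer_def by (simp add: upper_ext_add)
    next
      let ?a = "\<lambda>j. U (\<lambda>x. ennreal (cutoff F j x - cutoff F (Suc j) x) * indicator A x)"
      have tele: "(\<Sum>j<N. cutoff F j x - cutoff F (Suc j) x) = cutoff F 0 x - cutoff F N x" for N x
        by (rule sum_lessThan_telescope')
      show "outer (A \<inter> F) + outer (A - F) \<le> outer A"
      proof (rule ennreal_le_epsilon)
        fix e :: real assume e: "0 < e"
        have "(\<Sum>j<N. ?a j) \<le> outer A" for N
          unfolding outer_def
        proof (rule upper_ext_split)
          show "0 \<le> cutoff F j x - cutoff F (Suc j) x" for j x
            using cutoff_antimono[of j "Suc j" F x] by simp
          show "(\<Sum>j<N. cutoff F j x - cutoff F (Suc j) x) \<le> 1" for x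
            using cutoff_bounds(2)[of F 0 x] cutoff_bounds(1)[of F N x] unfolding tele by linarith
        qed (intro continuous_intros finite_lessThan)+
        from tail_suminf_small[OF this outer_finite e] obtain N where N: "(\<Sum>j. ?a (j + N)) \<le> ennreal e" ..
        let ?c = "\<lambda>x. ennreal (cutoff F N x) * indicator A x"
        let ?d = "\<lambda>x. ennreal (1 - cutoff F N x) * indicator A x"
        have "outer (A \<inter> F) \<le> U ?c"
          unfolding outer_def by (intro upper_ext_mono) (auto simp: indicator_def cutoff_in)
        moreover have "outer (A - F) \<le> U ?d + ennreal e"
        proof -
          have "outer (A - F) \<le> U (\<lambda>x. ?d x + (\<Sum>j. ennreal (cutoff F (j + N) x - cutoff F (Suc (j + N)) x) * indicator A x))"
            unfolding outer_def
          proof (rule upper_ext_mono)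
            fix x
            show "indicator (A - F) x \<le> ?d x + (\<Sum>j. ennreal (cutoff F (j + N) x - cutoff F (Suc (j + N)) x) * indicator A x)"
            proof (cases "x \<in> A - F")
              case True
              have "(\<lambda>k. cutoff F k x) \<longlonglongrightarrow> 0" using cutoff_tendsto[OF F False, of x] True by simp
              then have lim: "(\<lambda>j. cutoff F (j + N) x) \<longlonglongrightarrow> 0" by (rule LIMSEQ_ignore_initial_segment)
              have "(\<lambda>j. cutoff F (j + N) x - cutoff F (Suc (j + N)) x) sums (cutoff F N x - 0)"
                using telescope_sums'[OF lim] by simp
              then have "(\<Sum>j. ennreal (cutoff F (j + N) x - cutoff F (Suc (j + N)) x)) = ennreal (cutoff F N x)"
                using cutoff_antimono[of _ _ F x] by (intro suminf_ennreal_eq) auto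
              then show ?thesis using True cutoff_bounds[of F N x] by (simp flip: ennreal_plus)
            qed simp
          qed
          also have "\<dots> \<le> U ?d + (\<Sum>j. ?a (j + N))"
            by (rule order_trans[OF upper_ext_add add_left_mono[OF upper_ext_suminf]])
          also have "\<dots> \<le> U ?d + ennreal e" using N by (rule add_left_mono)
          finally show ?thesis .
        qed
        moreover have "U ?c + U ?d \<le> outer A"
        proof -
          let ?w = "\<lambda>b x. if b then cutoff F N x else 1 - cutoff F N x"
          have "continuous_on UNIV (?w b)" for b by (cases b) (simp_all add: continuous_intros)
          moreover have "0 \<le> ?w b x" for b x using cutoff_bounds[of F N x] by simp
          ultimately have "(\<Sum>b\<in>{True, False}. U (\<lambda>x. ennreal (?w b x) * indicator A x)) \<le> outer A"
            unfolding outer_def by (intro upper_ext_split) auto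
          then show ?thesis by simp
        qed
        ultimately show "outer (A \<inter> F) + outer (A - F) \<le> outer A + ennreal e"
        proof -
          assume 1: "outer (A \<inter> F) \<le> U ?c" and 2: "outer (A - F) \<le> U ?d + ennreal e"
            and 3: "U ?c + U ?d \<le> outer A"
          have "outer (A \<inter> F) + outer (A - F) \<le> U ?c + (U ?d + ennreal e)" by (rule add_mono[OF 1 2])
          also have "\<dots> \<le> outer A + ennreal e" using 3 by (simp add: add.assoc[symmetric] add_right_mono)
          finally show ?thesis .
        qed
      qed
    qed
  qed
  then show ?thesis
    by (auto simp: lambda_system_def Int_commute Diff_eq)
qed

definition rep_measure :: "'a measure" where
  "rep_measure = measure_of UNIV (sets borel) outer"

lemma sets_rep_measure [measurable_cong, simp]: "sets rep_measure = sets borel"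
  unfolding rep_measure_def by (metis sets.sets_measure_of_eq space_borel)

lemma emeasure_rep_measure:
  assumes "A \<in> sets borel" shows "emeasure rep_measure A = outer A"
proof -
  let ?L = "lambda_system UNIV (Pow UNIV) outer"
  have ms: "measure_space UNIV ?L outer"
    by (rule sigma_algebra.caratheodory_lemma[OF sigma_algebra_Pow outer_measure_space_outer])
  then have sa: "sigma_algebra UNIV ?L" by (simp add: measure_space_def)
  have sub: "sets borel \<subseteq> ?L"
    unfolding sets_borel_closed
    using closed_in_lambda_system by (intro sigma_algebra.sigma_sets_subset[OF sa]) auto
  have sb: "sigma_algebra UNIV (sets (borel :: 'a measure))"
    by (metis sets.sigma_algebra_axioms space_borel)
  have "measure_space UNIV (sets borel) outer"
    by (rule measure_down[OF ms sb sub])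
  then show ?thesis
    unfolding rep_measure_def using assms
    by (intro emeasure_measure_of_sigma[OF sb]) (auto simp: measure_space_def)
qed

lemma finite_rep_measure: "finite_measure rep_measure"
  using outer_finite[of UNIV]
  by (intro finite_measureI) (simp add: emeasure_rep_measure sets_eq_imp_space_eq[OF sets_rep_measure])

text \<open>
  The function \<open>f\<close> lies below the step function that is \<open>(i+1) d\<close> on the level set
  \<open>i d \<le> f < (i+1) d\<close>, and subadditivity bounds the upper integral of the latter by its integral.
  Only this inequality is needed: applied to \<open>norm f + f\<close> and \<open>norm f - f\<close> it gives equality.
\<close>

lemma le_integral_rep_measure:
  assumes f: "\<And>x. 0 \<le> apply_bcontfun f x"
  shows "\<Lambda> f \<le> (\<integral>x. f x \<partial>rep_measure)"
proof -
  interpret M: finite_measure rep_measure by (rule finite_rep_measure)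
  have int: "integrable rep_measure (apply_bcontfun f)"
    using norm_bounded[of f] by (intro M.integrable_const_bound[where B="norm f"]) auto
  have "ennreal (\<Lambda> f) \<le> (\<integral>\<^sup>+x. ennreal (f x) \<partial>rep_measure)"
  proof (rule ennreal_le_epsilon)
    fix e :: real assume e: "0 < e"
    define m where "m = measure rep_measure UNIV"
    have m: "0 \<le> m" by (simp add: m_def)
    define d where "d = e / (m + 1)"
    have d: "0 < d" using e m by (simp add: d_def)
    define A where "A i = {x. real i * d \<le> f x \<and> f x < real (Suc i) * d}" for i
    have A[measurable]: "A i \<in> sets borel" for i unfolding A_def by measurable
    have part: "(\<Sum>i. ennreal (real (Suc i) * d) * indicator (A i) x) =
        ennreal (real (Suc (nat \<lfloor>f x / d\<rfloor>)) * d)" for x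
    proof -
      let ?i = "nat \<lfloor>f x / d\<rfloor>"
      have iff: "x \<in> A i \<longleftrightarrow> i = ?i" for i
      proof -
        have "x \<in> A i \<longleftrightarrow> \<lfloor>f x / d\<rfloor> = int i"
          using d by (auto simp: A_def floor_eq_iff field_simps)
        also have "\<dots> \<longleftrightarrow> i = ?i" using f[of x] d by auto
        finally show ?thesis .
      qed
      show ?thesis by (subst suminf_finite[of "{?i}"]) (auto simp: iff indicator_def)
    qed
    have "ennreal (\<Lambda> f) = U (\<lambda>x. ennreal (f x))" by (simp add: upper_ext_continuous f)
    also have "\<dots> \<le> U (\<lambda>x. \<Sum>i. ennreal (real (Suc i) * d) * indicator (A i) x)"
    proof (rule upper_ext_mono)
      fix x
      have "f x / d \<le> real (Suc (nat \<lfloor>f x / d\<rfloor>))" using f[of x] d by linarith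
      then show "ennreal (f x) \<le> (\<Sum>i. ennreal (real (Suc i) * d) * indicator (A i) x)"
        unfolding part using d by (intro ennreal_leI) (simp add: field_simps)
    qed
    also have "\<dots> \<le> (\<Sum>i. U (\<lambda>x. ennreal (real (Suc i) * d) * indicator (A i) x))"
      by (rule upper_ext_suminf)
    also have "\<dots> \<le> (\<Sum>i. ennreal (real (Suc i) * d) * outer (A i))"
      unfolding outer_def using d by (intro suminf_le upper_ext_scale) auto
    also have "\<dots> = (\<integral>\<^sup>+x. (\<Sum>i. ennreal (real (Suc i) * d) * indicator (A i) x) \<partial>rep_measure)"
      by (subst nn_integral_suminf) (auto simp: nn_integral_cmult_indicator emeasure_rep_measure)
    also have "\<dots> \<le> (\<integral>\<^sup>+x. ennreal (f x) + ennreal d \<partial>rep_measure)"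
    proof (rule nn_integral_mono)
      fix x
      have "real (nat \<lfloor>f x / d\<rfloor>) \<le> f x / d" using f[of x] d by simp
      then have "real (nat \<lfloor>f x / d\<rfloor>) * d \<le> f x" using d by (simp add: field_simps)
      then show "(\<Sum>i. ennreal (real (Suc i) * d) * indicator (A i) x) \<le> ennreal (f x) + ennreal d"
        unfolding part using d f[of x] by (simp add: algebra_simps flip: ennreal_plus)
    qed
    also have "\<dots> = (\<integral>\<^sup>+x. ennreal (f x) \<partial>rep_measure) + ennreal (d * m)"
      using d m by (subst nn_integral_add) (auto simp: M.emeasure_eq_measure m_def ennreal_mult sets_eq_imp_space_eq[OF sets_rep_measure])
    also have "\<dots> \<le> (\<integral>\<^sup>+x. ennreal (f x) \<partial>rep_measure) + ennreal e"
      using e m by (intro add_left_mono ennreal_leI) (simp add: d_def field_simps)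
    finally show "ennreal (\<Lambda> f) \<le> (\<integral>\<^sup>+x. ennreal (f x) \<partial>rep_measure) + ennreal e" .
  qed
  also have "\<dots> = ennreal (\<integral>x. f x \<partial>rep_measure)"
    using int f by (intro nn_integral_eq_integral) auto
  finally show ?thesis using f by (simp add: integral_nonneg_AE)
qed

theorem riesz_representation: "\<Lambda> f = (\<integral>x. f x \<partial>rep_measure)"
proof -
  interpret M: finite_measure rep_measure by (rule finite_rep_measure)
  have int: "integrable rep_measure (apply_bcontfun g)" for g :: "'a \<Rightarrow>\<^sub>C real"
    using norm_bounded[of g] by (intro M.integrable_const_bound[where B="norm g"]) auto
  define c :: "'a \<Rightarrow>\<^sub>C real" where "c = const_bcontfun (norm f)"
  define one :: "'a \<Rightarrow>\<^sub>C real" where "one = const_bcontfun 1"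
  have c: "c = norm f *\<^sub>R one" by (rule bcontfun_eqI) (simp add: c_def one_def)
  have "ennreal (\<Lambda> one) = outer UNIV"
    unfolding outer_def by (subst upper_ext_continuous[symmetric]) (auto simp: one_def)
  also have "\<dots> = ennreal (measure rep_measure UNIV)"
    by (simp add: M.emeasure_eq_measure[symmetric] emeasure_rep_measure)
  finally have "\<Lambda> one = measure rep_measure UNIV"
    by (subst (asm) ennreal_inj) (auto intro!: nonneg simp: one_def)
  then have one: "\<Lambda> c = (\<integral>x. c x \<partial>rep_measure)"
    by (simp add: c linear_scale[OF linear]) (simp add: one_def sets_eq_imp_space_eq[OF sets_rep_measure])
  have b: "- norm f \<le> f x" "f x \<le> norm f" for x using norm_bounded[of f x] by auto
  have pos: "0 \<le> (c + f) x" "0 \<le> (c - f) x" for x using b[of x] by (simp_all add: c_def)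
  have "\<Lambda> (c + f) \<le> (\<integral>x. (c + f) x \<partial>rep_measure)" "\<Lambda> (c - f) \<le> (\<integral>x. (c - f) x \<partial>rep_measure)"
    by (rule le_integral_rep_measure[OF pos(1)], rule le_integral_rep_measure[OF pos(2)])
  then show ?thesis
    using one by (simp add: linear_add[OF linear] linear_diff[OF linear] int)
qed

theorem ex1_representing_measure:
  "\<exists>!M. sets M = sets borel \<and> finite_measure M \<and> (\<forall>f. \<Lambda> f = (\<integral>x. f x \<partial>M))"
proof (rule ex1I)
  show "sets rep_measure = sets borel \<and> finite_measure rep_measure \<and> (\<forall>f. \<Lambda> f = (\<integral>x. f x \<partial>rep_measure))"
    using finite_rep_measure riesz_representation by simp
  show "M = rep_measure"
    if "sets M = sets borel \<and> finite_measure M \<and> (\<forall>f. \<Lambda> f = (\<integral>x. f x \<partial>M))" for M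
    using that finite_rep_measure riesz_representation by (intro finite_borel_measure_eqI) auto
qed

end

section \<open>Kernels of positive operators and density of continuous functions\<close>

definition represents :: "'a::metric_space operator \<Rightarrow> ('a \<Rightarrow> 'a measure) \<Rightarrow> bool" where
  "represents S k \<longleftrightarrow>
     (\<forall>x. sets (k x) = sets borel \<and> finite_measure (k x) \<and>
        (\<forall>f. apply_bcontfun (S f) x = (\<integral>y. f y \<partial>k x)))"

text \<open>
  This gives the definite description in \<^const>\<open>semigroup_kernel\<close> its meaning.
\<close>

lemma represents_semigroup_kernel:
  fixes Q :: "real \<Rightarrow> 'a::metric_space operator"
  assumes X: "compact (UNIV :: 'a set)"
    and pos: "\<And>f x. (\<And>x. 0 \<le> apply_bcontfun f x) \<Longrightarrow> 0 \<le> apply_bcontfun (Q t f) x"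
  shows "represents (Q t) (semigroup_kernel Q t)"
proof -
  have *: "sets (semigroup_kernel Q t x) = sets borel \<and> finite_measure (semigroup_kernel Q t x) \<and>
        (\<forall>f. apply_bcontfun (Q t f) x = (\<integral>y. apply_bcontfun f y \<partial>semigroup_kernel Q t x))" for x
    unfolding semigroup_kernel_def
  proof (rule theI'[where P="\<lambda>M. sets M = sets borel \<and> finite_measure M \<and>
        (\<forall>f. apply_bcontfun (Q t f) x = (\<integral>y. apply_bcontfun f y \<partial>M))"])
    interpret positive_functional "\<lambda>f. apply_bcontfun (Q t f) x"
    proof (rule positive_functional.intro)
      show "compact (UNIV :: 'a set)" by fact
      show "linear (\<lambda>f. apply_bcontfun (Q t f) x)"
        unfolding linear_iff by (simp add: blinfun.add_right blinfun.scaleR_right)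
      show "0 \<le> apply_bcontfun (Q t f) x" if "\<And>y. 0 \<le> apply_bcontfun f y" for f
        using that by (rule pos)
    qed
    show "\<exists>!M. sets M = sets borel \<and> finite_measure M \<and>
        (\<forall>f. apply_bcontfun (Q t f) x = (\<integral>y. apply_bcontfun f y \<partial>M))"
      by (rule ex1_representing_measure)
  qed
  then show ?thesis unfolding represents_def by blast
qed

lemma represents_scaleR:
  assumes k: "represents S k" and c: "0 \<le> c"
  shows "represents (c *\<^sub>R S) (\<lambda>x. density (k x) (\<lambda>_. ennreal c))"
  unfolding represents_def
proof (intro allI conjI)
  fix x
  have s[measurable_cong]: "sets (k x) = sets borel" and f: "finite_measure (k x)"
    and rep: "\<And>f. apply_bcontfun (S f) x = (\<integral>y. f y \<partial>k x)"
    using k by (auto simp: represents_def)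
  interpret finite_measure "k x" by fact
  show "sets (density (k x) (\<lambda>_. ennreal c)) = sets borel" by (simp add: s)
  show "finite_measure (density (k x) (\<lambda>_. ennreal c))"
    by (intro finite_measureI) (simp add: emeasure_density ennreal_mult_eq_top_iff emeasure_eq_measure)
  show "apply_bcontfun ((c *\<^sub>R S) f) x = (\<integral>y. f y \<partial>density (k x) (\<lambda>_. ennreal c))" for f
    using c by (subst integral_real_density) (auto simp: rep blinfun.scaleR_left)
qed

locale operator_kernel =
  fixes S :: "'a::metric_space operator" and k :: "'a \<Rightarrow> 'a measure"
  assumes represents: "represents S k"
begin

abbreviation app :: "('a \<Rightarrow> ennreal) \<Rightarrow> 'a \<Rightarrow> ennreal" where
  "app f x \<equiv> \<integral>\<^sup>+y. f y \<partial>k x"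

lemma sets_k [simp, measurable_cong]: "sets (k x) = sets borel"
  and finite_k: "finite_measure (k x)"
  and integral_k: "(\<integral>y. apply_bcontfun f y \<partial>k x) = apply_bcontfun (S f) x"
  using represents by (auto simp: represents_def)

lemma space_k [simp]: "space (k x) = UNIV"
  using sets_eq_imp_space_eq[OF sets_k] by simp

lemma app_bcontfun:
  assumes "\<And>x. 0 \<le> apply_bcontfun f x"
  shows "app (\<lambda>y. ennreal (f y)) x = ennreal (apply_bcontfun (S f) x)"
proof -
  interpret finite_measure "k x" by (rule finite_k)
  have "integrable (k x) (apply_bcontfun f)"
    using norm_bounded[of f] by (intro integrable_const_bound[where B="norm f"]) auto
  then show ?thesis using assms by (subst nn_integral_eq_integral) (auto simp: integral_k)
qed

definition mass_bound :: real where
  "mass_bound = norm (blinfun_apply S (const_bcontfun 1)) + 1"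

lemma mass_bound_pos: "0 < mass_bound"
  by (simp add: mass_bound_def add_nonneg_pos)

lemma measure_k: "measure (k x) UNIV = apply_bcontfun (blinfun_apply S (const_bcontfun 1)) x"
  using integral_k[of x "const_bcontfun 1"] by simp

lemma measure_k_le: "measure (k x) UNIV \<le> mass_bound"
  using norm_bounded[of "blinfun_apply S (const_bcontfun 1)" x] by (simp add: measure_k mass_bound_def)

lemma emeasure_k_le: "emeasure (k x) UNIV \<le> ennreal mass_bound"
  using measure_k_le[of x] finite_k[of x] by (simp add: finite_measure.emeasure_eq_measure ennreal_leI)

text \<open>
  The monadic composition of a measure with a kernel is for subprobability kernels, whence the
  rescaling by \<open>mass_bound\<close>, which \<open>push\<close> undoes.
\<close>

definition subkernel :: "'a \<Rightarrow> 'a measure" where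
  "subkernel x = density (k x) (\<lambda>_. ennreal (1 / mass_bound))"

lemma sets_subkernel [simp, measurable_cong]: "sets (subkernel x) = sets borel"
  by (simp add: subkernel_def)

lemma measurable_subkernel [measurable]: "subkernel \<in> borel \<rightarrow>\<^sub>M subprob_algebra borel"
proof (rule measurable_subprob_algebra_generated[OF sets_borel_closed Int_stable_closed])
  have em: "emeasure (subkernel x) A = ennreal (1 / mass_bound * measure (k x) A)"
    if "A \<in> sets borel" for x A
    using that mass_bound_pos finite_k[of x]
    by (simp add: subkernel_def emeasure_density nn_integral_cmult_indicator
        finite_measure.emeasure_eq_measure flip: ennreal_mult)
  show "subprob_space (subkernel a)" for a
  proof (rule subprob_spaceI)
    have "emeasure (subkernel a) UNIV \<le> 1"
      using measure_k_le[of a] mass_bound_pos by (subst em) (auto intro!: ennreal_le_1[THEN iffD2])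
    then show "emeasure (subkernel a) (space (subkernel a)) \<le> 1" by (simp add: subkernel_def)
  qed (simp add: subkernel_def)
  have closed: "(\<lambda>x. measure (k x) F) \<in> borel_measurable borel" if F: "closed F" for F
  proof (cases "F = {}")
    case False
    have m: "(\<lambda>x. apply_bcontfun (blinfun_apply S (cutoff_bc F j)) x) \<in> borel_measurable borel" for j by measurable
    have l: "(\<lambda>j. apply_bcontfun (blinfun_apply S (cutoff_bc F j)) x) \<longlonglongrightarrow> measure (k x) F" for x
      using integral_cutoff_tendsto[OF sets_k finite_k F False, of x]
      by (simp add: integral_k[of _ "cutoff_bc F _", simplified])
    show ?thesis by (rule borel_measurable_LIMSEQ_metric[OF m l])
  qed simp
  show "(\<lambda>a. emeasure (subkernel a) A) \<in> borel_measurable borel" if "A \<in> {F. closed F}" for A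
    using that closed[of A] by (subst em) auto
  show "(\<lambda>a. emeasure (subkernel a) UNIV) \<in> borel_measurable borel"
    using closed[of UNIV] by (subst em) auto
qed auto

lemma app_eq_subkernel:
  assumes [measurable]: "f \<in> borel_measurable borel"
  shows "app f x = ennreal mass_bound * (\<integral>\<^sup>+y. f y \<partial>subkernel x)"
proof -
  have "ennreal mass_bound * ennreal (1 / mass_bound) = 1"
    using mass_bound_pos by (simp flip: ennreal_mult)
  then show ?thesis
    unfolding subkernel_def
    by (subst nn_integral_density) (auto simp: nn_integral_cmult mult.assoc[symmetric])
qed

lemma measurable_app [measurable (raw)]:
  assumes "f \<in> borel_measurable borel"
  shows "app f \<in> borel_measurable borel"
  unfolding app_eq_subkernel[OF assms]
  using measurable_compose[OF measurable_subkernel nn_integral_measurable_subprob_algebra[OF assms]] by simp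

lemma integrable_k:
  fixes f :: "'a \<Rightarrow> real"
  assumes "f \<in> borel_measurable borel" "\<And>y. \<bar>f y\<bar> \<le> B"
  shows "integrable (k x) f"
proof -
  interpret finite_measure "k x" by (rule finite_k)
  show ?thesis by (rule integrable_const_bound[where B=B]) (use assms in auto)
qed

lemma app_eq_integral:
  fixes f :: "'a \<Rightarrow> real"
  assumes "f \<in> borel_measurable borel" "\<And>y. 0 \<le> f y" "\<And>y. f y \<le> B"
  shows "app (\<lambda>y. ennreal (f y)) x = ennreal (\<integral>y. f y \<partial>k x)"
  using assms by (intro nn_integral_eq_integral integrable_k[of f B]) auto

lemma measurable_integral_k:
  fixes f :: "'a \<Rightarrow> real"
  assumes [measurable]: "f \<in> borel_measurable borel" and "\<And>y. 0 \<le> f y" "\<And>y. f y \<le> B"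
  shows "(\<lambda>x. \<integral>y. f y \<partial>k x) \<in> borel_measurable borel"
proof -
  have "(\<lambda>x. \<integral>y. f y \<partial>k x) = (\<lambda>x. enn2real (app (\<lambda>y. ennreal (f y)) x))"
    using assms by (simp add: app_eq_integral[of f B] integral_nonneg_AE)
  then show ?thesis by (simp add: measurable_app)
qed

lemma integral_k_bounds:
  fixes f :: "'a \<Rightarrow> real"
  assumes "f \<in> borel_measurable borel" and a: "0 \<le> a" "\<And>y. a \<le> f y" "\<And>y. f y \<le> b"
  shows "a * apply_bcontfun (blinfun_apply S (const_bcontfun 1)) x \<le> (\<integral>y. f y \<partial>k x)"
    and "(\<integral>y. f y \<partial>k x) \<le> b * mass_bound"
proof -
  interpret finite_measure "k x" by (rule finite_k)
  have i: "integrable (k x) f"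
  proof (rule integrable_k)
    show "\<bar>f y\<bar> \<le> b" for y using a(1) a(2,3)[of y] by simp
  qed (fact assms(1))
  have "(\<integral>y. a \<partial>k x) \<le> (\<integral>y. f y \<partial>k x)" by (rule integral_mono) (use i a in auto)
  then show "a * apply_bcontfun (blinfun_apply S (const_bcontfun 1)) x \<le> (\<integral>y. f y \<partial>k x)"
    by (simp add: measure_k mult.commute)
  have "(\<integral>y. f y \<partial>k x) \<le> (\<integral>y. b \<partial>k x)" by (rule integral_mono) (use i a in auto)
  also have "\<dots> = b * measure (k x) UNIV" by simp
  also have "\<dots> \<le> b * mass_bound"
    using measure_k_le[of x] a(1) a(2,3)[of undefined] by (intro mult_left_mono) auto
  finally show "(\<integral>y. f y \<partial>k x) \<le> b * mass_bound" .
qed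

definition push :: "'a measure \<Rightarrow> 'a measure" where
  "push \<nu> = density (\<nu> \<bind> subkernel) (\<lambda>_. ennreal mass_bound)"

lemma sets_push [simp, measurable_cong]:
  "sets \<nu> = sets borel \<Longrightarrow> sets (push \<nu>) = sets borel"
  unfolding push_def using sets_eq_imp_space_eq[of \<nu> borel] by (simp add: sets_bind[where N=borel])

lemma nn_integral_push:
  assumes \<nu>: "sets \<nu> = sets borel" and [measurable]: "f \<in> borel_measurable borel"
  shows "(\<integral>\<^sup>+y. f y \<partial>push \<nu>) = (\<integral>\<^sup>+x. app f x \<partial>\<nu>)"
proof -
  note [measurable_cong] = \<nu>
  have b: "sets (\<nu> \<bind> subkernel) = sets borel"
    using sets_eq_imp_space_eq[OF \<nu>] by (simp add: sets_bind[where N=borel])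
  note [measurable_cong] = b
  have K: "subkernel \<in> \<nu> \<rightarrow>\<^sub>M subprob_algebra borel" by measurable
  have "(\<integral>\<^sup>+y. f y \<partial>push \<nu>) = ennreal mass_bound * (\<integral>\<^sup>+y. f y \<partial>(\<nu> \<bind> subkernel))"
    unfolding push_def by (subst nn_integral_density) (auto simp: nn_integral_cmult)
  also have "\<dots> = ennreal mass_bound * (\<integral>\<^sup>+x. (\<integral>\<^sup>+y. f y \<partial>subkernel x) \<partial>\<nu>)"
    by (subst nn_integral_bind[OF _ K]) auto
  also have "\<dots> = (\<integral>\<^sup>+x. app f x \<partial>\<nu>)"
    using measurable_compose[OF K nn_integral_measurable_subprob_algebra[of f borel]]
    by (simp add: app_eq_subkernel nn_integral_cmult)
  finally show ?thesis .
qed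

lemma finite_push:
  assumes \<nu>: "sets \<nu> = sets borel" "finite_measure \<nu>"
  shows "finite_measure (push \<nu>)"
proof (rule finite_measureI)
  have sp: "space (push \<nu>) = UNIV" "space \<nu> = UNIV"
    using sets_eq_imp_space_eq[OF sets_push[OF \<nu>(1)]] sets_eq_imp_space_eq[OF \<nu>(1)] by auto
  have "emeasure (push \<nu>) UNIV = (\<integral>\<^sup>+x. app (\<lambda>_. 1) x \<partial>\<nu>)"
    using nn_integral_push[OF \<nu>(1), of "\<lambda>_. 1"] sp by simp
  also have "\<dots> \<le> (\<integral>\<^sup>+x. ennreal mass_bound \<partial>\<nu>)"
    by (intro nn_integral_mono) (simp add: emeasure_k_le)
  also have "\<dots> < top"
    using finite_measure.emeasure_finite[OF \<nu>(2)] by (simp add: ennreal_mult_less_top less_top sp)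
  finally show "emeasure (push \<nu>) (space (push \<nu>)) \<noteq> \<infinity>" by (simp add: sp)
qed

end

text \<open>
  Sets whose indicator can be approximated form a Dynkin system containing the closed sets.
\<close>

lemma bcontfun_dense_L1:
  fixes M :: "'a::metric_space measure" and g :: "'a \<Rightarrow> real"
  assumes M: "sets M = sets borel" "finite_measure M" and g: "integrable M g" and e: "0 < e"
  shows "\<exists>f :: 'a \<Rightarrow>\<^sub>C real. (\<integral>x. \<bar>g x - f x\<bar> \<partial>M) < e"
proof -
  interpret finite_measure M by fact
  note [measurable_cong] = M(1)
  have sp: "space M = UNIV" using sets_eq_imp_space_eq[OF M(1)] by simp
  have intf[simp, intro]: "integrable M (apply_bcontfun f)" for f :: "'a \<Rightarrow>\<^sub>C real"
    using norm_bounded[of f] by (intro integrable_const_bound[where B="norm f"]) auto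
  have ind: "\<exists>f :: 'a \<Rightarrow>\<^sub>C real. (\<integral>x. \<bar>indicator A x - f x\<bar> \<partial>M) < e" if "A \<in> sets borel" "0 < e" for A e
  proof -
    have sub: "{F :: 'a set. closed F} \<subseteq> Pow UNIV" by simp
    show ?thesis
    using Int_stable_closed sub that(1)[unfolded sets_borel_closed] that(2)
  proof (induction arbitrary: e rule: sigma_sets_induct_disjoint)
    case (basic F)
    show ?case
    proof (cases "F = {}")
      case True
      then show ?thesis using basic by (intro exI[of _ 0]) simp
    next
      case False
      have F: "closed F" using basic by simp
      then have [measurable]: "F \<in> sets borel" by simp
      have "(\<lambda>j. \<integral>x. \<bar>indicator F x - cutoff_bc F j x\<bar> \<partial>M) \<longlonglongrightarrow> (\<integral>x. 0 \<partial>M)"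
      proof (rule integral_dominated_convergence[where w="\<lambda>_. 1"])
        show "AE x in M. (\<lambda>j. \<bar>indicator F x - cutoff_bc F j x\<bar>) \<longlonglongrightarrow> 0"
        proof (intro AE_I2 tendsto_rabs_zero)
          fix x show "(\<lambda>j. indicator F x - cutoff_bc F j x) \<longlonglongrightarrow> 0"
            using tendsto_diff[OF tendsto_const cutoff_tendsto[OF F False, of x], of "indicator F x"] by simp
        qed
        show "AE x in M. norm \<bar>indicator F x - cutoff_bc F j x\<bar> \<le> 1" for j
          using cutoff_bounds[of F j] by (intro AE_I2) (auto simp: indicator_def)
      qed auto
      then have "\<forall>\<^sub>F j in sequentially. (\<integral>x. \<bar>indicator F x - cutoff_bc F j x\<bar> \<partial>M) < e"
        using basic by (intro order_tendstoD(2)[where y="\<integral>x. 0 \<partial>M"]) auto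
      then obtain j where "(\<integral>x. \<bar>indicator F x - cutoff_bc F j x\<bar> \<partial>M) < e"
        using eventually_happens'[OF sequentially_bot] by blast
      then show ?thesis by blast
    qed
  next
    case empty
    then show ?case by (intro exI[of _ 0]) simp
  next
    case (compl A)
    then obtain f :: "'a \<Rightarrow>\<^sub>C real" where f: "(\<integral>x. \<bar>indicator A x - f x\<bar> \<partial>M) < e" by auto
    have "(\<lambda>x. \<bar>indicator (UNIV - A) x - (const_bcontfun 1 - f) x\<bar>) = (\<lambda>x. \<bar>indicator A x - f x\<bar>)"
      by (auto simp: indicator_def fun_eq_iff)
    then show ?case using f by (intro exI[of _ "const_bcontfun 1 - f"]) simp
  next
    case (union A)
    have A: "A i \<in> sets borel" for i
      unfolding sets_borel_closed using union.hyps(2) by (rule range_subsetD)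
    note [measurable] = A
    have "(\<lambda>n. measure M (\<Union>i<n. A i)) \<longlonglongrightarrow> measure M (\<Union>i. A i)"
    proof -
      have "(\<lambda>n. measure M (\<Union>i<n. A i)) \<longlonglongrightarrow> measure M (\<Union>n. \<Union>i<n. A i)"
      proof (rule finite_Lim_measure_incseq)
        show "range (\<lambda>n. \<Union>i<n. A i) \<subseteq> sets M"
          unfolding M(1) by (intro image_subsetI sets.finite_UN A) auto
        show "incseq (\<lambda>n. \<Union>i<n. A i)"
          unfolding incseq_def by (intro allI impI UN_mono) auto
      qed
      moreover have "(\<Union>n. \<Union>i<n. A i) = (\<Union>i. A i)" by blast
      ultimately show ?thesis by simp
    qed
    then have "\<forall>\<^sub>F n in sequentially. measure M (\<Union>i. A i) - e / 2 < measure M (\<Union>i<n. A i)"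
      using union.prems by (intro order_tendstoD(1)[where y="measure M (\<Union>i. A i)"]) auto
    then obtain n where n: "measure M (\<Union>i. A i) - e / 2 < measure M (\<Union>i<n. A i)"
      by (auto simp: eventually_sequentially)
    have "\<forall>i. \<exists>f :: 'a \<Rightarrow>\<^sub>C real. (\<integral>x. \<bar>indicator (A i) x - f x\<bar> \<partial>M) < e / (2 * real (Suc n))"
      using union.IH union.prems by (intro allI) simp
    then obtain f :: "nat \<Rightarrow> 'a \<Rightarrow>\<^sub>C real"
      where f: "\<And>i. (\<integral>x. \<bar>indicator (A i) x - f i x\<bar> \<partial>M) < e / (2 * real (Suc n))" by metis
    define h where "h = (\<Sum>i<n. f i)"
    have h: "h x = (\<Sum>i<n. f i x)" for x
      unfolding h_def by (induction n) auto
    have fn: "indicator (\<Union>i<n. A i) x = (\<Sum>i<n. indicator (A i) x :: real)" for x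
      using union.hyps(1) by (intro indicator_UN_disjoint) (auto intro: disjoint_family_on_mono)
    have le: "\<bar>indicator (\<Union>i. A i) x - h x\<bar> \<le>
        (indicator (\<Union>i. A i) x - indicator (\<Union>i<n. A i) x) + (\<Sum>i<n. \<bar>indicator (A i) x - f i x\<bar>)" for x
    proof -
      have "\<bar>indicator (\<Union>i<n. A i) x - h x\<bar> \<le> (\<Sum>i<n. \<bar>indicator (A i) x - f i x\<bar>)"
        unfolding fn h sum_subtractf[symmetric] by (rule sum_abs)
      moreover have "indicator (\<Union>i<n. A i) x \<le> (indicator (\<Union>i. A i) x :: real)"
        by (auto simp: indicator_def)
      ultimately show ?thesis by linarith
    qed
    have ii: "integrable M (\<lambda>x. indicator B x :: real)" if "B \<in> sets borel" for B
      using that by (intro integrable_const_bound[where B=1]) auto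
    have m: "(\<Union>i. A i) \<in> sets borel" "(\<Union>i<n. A i) \<in> sets borel" by auto
    have "(\<integral>x. \<bar>indicator (\<Union>i. A i) x - h x\<bar> \<partial>M) \<le>
        (\<integral>x. (indicator (\<Union>i. A i) x - indicator (\<Union>i<n. A i) x) + (\<Sum>i<n. \<bar>indicator (A i) x - f i x\<bar>) \<partial>M)"
      using ii[OF m(1)] ii[OF m(2)] ii[OF A]
      by (intro integral_mono le Bochner_Integration.integrable_add Bochner_Integration.integrable_sum
          Bochner_Integration.integrable_diff integrable_abs) auto
    also have "\<dots> = measure M (\<Union>i. A i) - measure M (\<Union>i<n. A i) + (\<Sum>i<n. \<integral>x. \<bar>indicator (A i) x - f i x\<bar> \<partial>M)"
      using ii[OF m(1)] ii[OF m(2)] ii[OF A] sp by simp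
    also have "\<dots> < e / 2 + e / 2"
    proof (rule add_less_le_mono)
      have "(\<Sum>i<n. \<integral>x. \<bar>indicator (A i) x - f i x\<bar> \<partial>M) \<le> (\<Sum>i<n. e / (2 * real (Suc n)))"
        using f by (intro sum_mono less_imp_le)
      also have "\<dots> \<le> e / 2" using union.prems by (simp add: field_simps)
      finally show "(\<Sum>i<n. \<integral>x. \<bar>indicator (A i) x - f i x\<bar> \<partial>M) \<le> e / 2" .
    qed (use n in linarith)
    finally show ?case by (intro exI[of _ h]) simp
  qed
  qed
  show ?thesis
    using g e
  proof (induction arbitrary: e rule: integrable_induct)
    case (base A c)
    have A: "A \<in> sets borel" using base M by simp
    obtain f :: "'a \<Rightarrow>\<^sub>C real" where f: "(\<integral>x. \<bar>indicator A x - f x\<bar> \<partial>M) < e / (\<bar>c\<bar> + 1)"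
      using ind[OF A, of "e / (\<bar>c\<bar> + 1)"] base by auto
    have eq: "\<bar>indicator A x *\<^sub>R c - (c *\<^sub>R f) x\<bar> = \<bar>c\<bar> * \<bar>indicator A x - f x\<bar>" for x
      by (simp add: abs_mult[symmetric] algebra_simps)
    have "(\<integral>x. \<bar>indicator A x *\<^sub>R c - (c *\<^sub>R f) x\<bar> \<partial>M) = \<bar>c\<bar> * (\<integral>x. \<bar>indicator A x - f x\<bar> \<partial>M)"
      unfolding eq by simp
    also have "\<dots> \<le> \<bar>c\<bar> * (e / (\<bar>c\<bar> + 1))" using f by (intro mult_left_mono) auto
    also have "\<dots> < e" using base.prems by (simp add: field_simps)
    finally show ?case by blast
  next
    case (add u v)
    obtain f g :: "'a \<Rightarrow>\<^sub>C real" where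
      f: "(\<integral>x. \<bar>u x - f x\<bar> \<partial>M) < e / 2" and g: "(\<integral>x. \<bar>v x - g x\<bar> \<partial>M) < e / 2"
      using add.IH[of "e / 2"] add.prems by auto
    have "(\<integral>x. \<bar>(u x + v x) - (f + g) x\<bar> \<partial>M) \<le> (\<integral>x. \<bar>u x - f x\<bar> + \<bar>v x - g x\<bar> \<partial>M)"
      using add.hyps by (intro integral_mono) auto
    also have "\<dots> < e" using f g add.hyps by simp
    finally show ?case by blast
  next
    case (lim u s)
    have [measurable]: "u \<in> borel_measurable M" "\<And>i. s i \<in> borel_measurable M" using lim.hyps by auto
    have "(\<lambda>i. \<integral>x. \<bar>u x - s i x\<bar> \<partial>M) \<longlonglongrightarrow> (\<integral>x. 0 \<partial>M)"
    proof (rule integral_dominated_convergence[where w="\<lambda>x. 3 * \<bar>u x\<bar>"])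
      show "AE x in M. (\<lambda>i. \<bar>u x - s i x\<bar>) \<longlonglongrightarrow> 0"
      proof (intro AE_I2 tendsto_rabs_zero)
        fix x assume "x \<in> space M"
        from tendsto_diff[OF tendsto_const lim.hyps(2)[OF this], of "u x"]
        show "(\<lambda>i. u x - s i x) \<longlonglongrightarrow> 0" by simp
      qed
      show "AE x in M. norm \<bar>u x - s i x\<bar> \<le> 3 * \<bar>u x\<bar>" for i
      proof (rule AE_I2)
        fix x assume "x \<in> space M"
        from lim.hyps(3)[OF this, of i] show "norm \<bar>u x - s i x\<bar> \<le> 3 * \<bar>u x\<bar>" by simp
      qed
    qed (use lim.hyps in auto)
    then have "\<forall>\<^sub>F i in sequentially. (\<integral>x. \<bar>u x - s i x\<bar> \<partial>M) < e / 2"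
      using lim.prems by (intro order_tendstoD(2)[where y="\<integral>x. 0 \<partial>M"]) auto
    then obtain i where i: "(\<integral>x. \<bar>u x - s i x\<bar> \<partial>M) < e / 2" by (auto simp: eventually_sequentially)
    obtain f :: "'a \<Rightarrow>\<^sub>C real" where f: "(\<integral>x. \<bar>s i x - f x\<bar> \<partial>M) < e / 2"
      using lim.IH[of "e / 2" i] lim.prems by auto
    have "(\<integral>x. \<bar>u x - f x\<bar> \<partial>M) \<le> (\<integral>x. \<bar>u x - s i x\<bar> + \<bar>s i x - f x\<bar> \<partial>M)"
      using lim.hyps by (intro integral_mono) auto
    also have "\<dots> < e" using i f lim.hyps by simp
    finally show ?case by blast
  qed
qed

text \<open>
  The approximation takes place in \<open>L\<^sup>1\<close> of the supremum of the two measures, which dominates both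
  and has at most their total mass; truncating the approximant to \<open>[a, b]\<close> does not increase the
  error.
\<close>

lemma bounded_dense_two_measures:
  fixes M N :: "'a::metric_space measure" and g :: "'a \<Rightarrow> real"
  assumes M: "sets M = sets borel" "finite_measure M" and N: "sets N = sets borel" "finite_measure N"
    and g[measurable]: "g \<in> borel_measurable borel" and ab: "\<And>x. a \<le> g x" "\<And>x. g x \<le> b" and e: "0 < e"
  shows "\<exists>f :: 'a \<Rightarrow>\<^sub>C real. (\<forall>x. a \<le> f x \<and> f x \<le> b) \<and>
     (\<integral>\<^sup>+x. ennreal \<bar>g x - f x\<bar> \<partial>M) < ennreal e \<and> (\<integral>\<^sup>+x. ennreal \<bar>g x - f x\<bar> \<partial>N) < ennreal e"
proof -
  define L where "L = sup_measure' M N"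
  have MN: "sets N = sets M" using M N by simp
  have L: "sets L = sets borel" using M(1) MN by (simp add: L_def)
  note [measurable_cong] = L M(1) N(1)
  have sp: "space L = UNIV" "space M = UNIV" "space N = UNIV"
    using sets_eq_imp_space_eq[OF L] sets_eq_imp_space_eq[OF M(1)] sets_eq_imp_space_eq[OF N(1)] by auto
  have le: "M \<le> L" "N \<le> L"
    using MN L M(1) le_emeasure_sup_measure'1[OF MN] le_emeasure_sup_measure'2[OF MN]
    by (auto simp: le_measure L_def)
  have fin: "finite_measure L"
  proof (rule finite_measureI)
    have "emeasure L UNIV \<le> emeasure M UNIV + emeasure N UNIV"
      unfolding L_def using M(1) MN
      by (subst emeasure_sup_measure') (auto intro!: SUP_least add_mono emeasure_mono)
    also have "\<dots> < top"
      using finite_measure.emeasure_finite[OF M(2)] finite_measure.emeasure_finite[OF N(2)]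
      by (simp add: less_top sp)
    finally show "emeasure L (space L) \<noteq> \<infinity>" by (simp add: sp)
  qed
  interpret finite_measure L by fact
  have intf: "integrable L (apply_bcontfun f)" for f :: "'a \<Rightarrow>\<^sub>C real"
    using norm_bounded[of f] by (intro integrable_const_bound[where B="norm f"]) auto
  have intg: "integrable L g"
  proof (intro integrable_const_bound[where B="\<bar>a\<bar> + \<bar>b\<bar>"] AE_I2)
    show "norm (g x) \<le> \<bar>a\<bar> + \<bar>b\<bar>" for x using ab[of x] by simp
  qed measurable
  obtain f :: "'a \<Rightarrow>\<^sub>C real" where f: "(\<integral>x. \<bar>g x - f x\<bar> \<partial>L) < e"
    using bcontfun_dense_L1[OF L fin intg e] by blast
  have abl: "a \<le> b" using ab[of undefined] by simp
  define h where "h = Bcontfun (\<lambda>x. max a (min b (f x)))"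
  have h: "apply_bcontfun h = (\<lambda>x. max a (min b (f x)))"
    unfolding h_def
    by (intro Bcontfun_inverse bcontfun_normI[where b="\<bar>a\<bar> + \<bar>b\<bar>"] continuous_intros) auto
  have "(\<integral>\<^sup>+x. ennreal \<bar>g x - h x\<bar> \<partial>L) \<le> (\<integral>\<^sup>+x. ennreal \<bar>g x - f x\<bar> \<partial>L)"
  proof (intro nn_integral_mono ennreal_leI)
    show "\<bar>g x - h x\<bar> \<le> \<bar>g x - f x\<bar>" for x
      using ab[of x] unfolding h by linarith
  qed
  also have "\<dots> = ennreal (\<integral>x. \<bar>g x - f x\<bar> \<partial>L)"
    using intf intg by (intro nn_integral_eq_integral) auto
  also have "\<dots> < ennreal e" using f e by (simp add: ennreal_less_iff)
  finally have lt: "(\<integral>\<^sup>+x. ennreal \<bar>g x - h x\<bar> \<partial>L) < ennreal e" .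
  show ?thesis
  proof (intro exI[of _ h] conjI allI)
    show "a \<le> h x" "h x \<le> b" for x using abl by (auto simp: h)
    show "(\<integral>\<^sup>+x. ennreal \<bar>g x - h x\<bar> \<partial>M) < ennreal e"
      using nn_integral_mono_measure[OF _ le(1), of "\<lambda>x. ennreal \<bar>g x - h x\<bar>"] lt L M(1) by simp
    show "(\<integral>\<^sup>+x. ennreal \<bar>g x - h x\<bar> \<partial>N) < ennreal e"
      using nn_integral_mono_measure[OF _ le(2), of "\<lambda>x. ennreal \<bar>g x - h x\<bar>"] lt L N(1) by simp
  qed
qed

section \<open>Positive semigroups, their generators and their growth rate\<close>

instance bcontfun :: (metric_space, banach) banach ..

lemma integral_average_tendsto:
  fixes \<phi> :: "real \<Rightarrow> 'b::banach"
  assumes cont: "continuous_on {0..} \<phi>" and T: "0 \<le> T"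
  shows "((\<lambda>h. (1 / h) *\<^sub>R integral {T..T + h} \<phi>) \<longlongrightarrow> \<phi> T) (at_right 0)"
proof -
  define G where "G u = integral {T..u} \<phi>" for u
  have "continuous_on {T..T + 1} \<phi>" by (rule continuous_on_subset[OF cont]) (use T in auto)
  from integral_has_vector_derivative[OF this, of T]
  have "(G has_vector_derivative \<phi> T) (at T within {T..T + 1})" unfolding G_def by simp
  then have "((\<lambda>y. (1 / norm (y - T)) *\<^sub>R (G y - (G T + (y - T) *\<^sub>R \<phi> T))) \<longlongrightarrow> 0) (at_right T)"
    unfolding has_vector_derivative_def has_derivative_within by (simp add: at_within_Icc_at_right)
  then have "((\<lambda>h. (1 / norm h) *\<^sub>R (G (h + T) - (G T + h *\<^sub>R \<phi> T))) \<longlongrightarrow> 0) (at_right 0)"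
    by (subst (asm) filterlim_at_right_to_0) simp
  then have "((\<lambda>h. (1 / h) *\<^sub>R integral {T..T + h} \<phi> - \<phi> T) \<longlongrightarrow> 0) (at_right 0)"
  proof (rule Lim_transform_eventually)
    show "\<forall>\<^sub>F h in at_right 0. (1 / norm h) *\<^sub>R (G (h + T) - (G T + h *\<^sub>R \<phi> T)) =
        (1 / h) *\<^sub>R integral {T..T + h} \<phi> - \<phi> T"
      using eventually_at_right_less[of 0]
      by eventually_elim (simp add: G_def algebra_simps)
  qed
  then show ?thesis by (simp add: LIM_zero_iff)
qed

locale pos_semigroup =
  fixes R :: "real \<Rightarrow> 'a::metric_space operator"
  assumes pos_semigroup: "positive_semigroup R"
begin

abbreviation one :: "'a \<Rightarrow>\<^sub>C real" where "one \<equiv> const_bcontfun 1"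

lemma R_0 [simp]: "blinfun_apply (R 0) f = f"
  using pos_semigroup by (simp add: positive_semigroup_def)

lemma R_add: "0 \<le> s \<Longrightarrow> 0 \<le> t \<Longrightarrow> R (s + t) f = R s (R t f)"
  using pos_semigroup by (simp add: positive_semigroup_def)

lemma R_nonneg: "0 \<le> t \<Longrightarrow> (\<And>x. 0 \<le> apply_bcontfun f x) \<Longrightarrow> 0 \<le> apply_bcontfun (R t f) x"
  using pos_semigroup unfolding positive_semigroup_def by blast

lemma R_tendsto: "((\<lambda>t. R t f) \<longlongrightarrow> f) (at_right 0)"
proof -
  have "((\<lambda>t. norm (R t f - f)) \<longlongrightarrow> 0) (at_right 0)"
    using pos_semigroup unfolding positive_semigroup_def by blast
  then show ?thesis by (rule LIM_zero_cancel[OF tendsto_norm_zero_cancel])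
qed

lemma R_mono:
  assumes "0 \<le> t" "\<And>x. apply_bcontfun f x \<le> apply_bcontfun g x"
  shows "apply_bcontfun (R t f) x \<le> apply_bcontfun (R t g) x"
  using R_nonneg[OF assms(1), of "g - f" x] assms(2) by (simp add: blinfun.diff_right)

lemma R_scaled_one_le:
  assumes "0 \<le> t" "\<And>x. c \<le> apply_bcontfun f x"
  shows "c * apply_bcontfun (R t one) x \<le> apply_bcontfun (R t f) x"
  using R_mono[OF assms(1), of "c *\<^sub>R one" f x] assms(2) by (simp add: blinfun.scaleR_right)

lemma R_le_scaled_one:
  assumes "0 \<le> t" "\<And>x. apply_bcontfun f x \<le> c"
  shows "apply_bcontfun (R t f) x \<le> c * apply_bcontfun (R t one) x"
  using R_mono[OF assms(1), of f "c *\<^sub>R one" x] assms(2) by (simp add: blinfun.scaleR_right)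

lemma R_one_nonneg: "0 \<le> t \<Longrightarrow> 0 \<le> apply_bcontfun (R t one) x"
  by (rule R_nonneg) auto

text \<open>
  A positive operator attains its norm at the constant function \<open>1\<close>.
\<close>

lemma norm_R_le:
  assumes t: "0 \<le> t" and C: "\<And>x. apply_bcontfun (R t one) x \<le> C"
  shows "norm (R t) \<le> C"
proof (rule norm_blinfun_bound)
  show "0 \<le> C" using R_one_nonneg[OF t, of undefined] C[of undefined] by linarith
  fix f :: "'a \<Rightarrow>\<^sub>C real"
  have b: "- norm f \<le> apply_bcontfun f x" "apply_bcontfun f x \<le> norm f" for x
    using norm_bounded[of f x] by auto
  show "norm (R t f) \<le> C * norm f"
  proof (rule norm_bound)
    fix x
    have "- norm f * apply_bcontfun (R t one) x \<le> R t f x" by (rule R_scaled_one_le[OF t b(1)])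
    moreover have "R t f x \<le> norm f * apply_bcontfun (R t one) x" by (rule R_le_scaled_one[OF t b(2)])
    moreover have "norm f * apply_bcontfun (R t one) x \<le> norm f * C" by (intro mult_left_mono C) auto
    ultimately show "norm (R t f x) \<le> C * norm f" by (simp add: abs_le_iff algebra_simps)
  qed
qed

lemma R_one_le_norm: "apply_bcontfun (R t one) x \<le> norm (R t)"
proof -
  have "norm (R t one) \<le> norm (R t) * norm one" by (rule norm_blinfun)
  also have "\<dots> \<le> norm (R t) * 1" by (intro mult_left_mono norm_bound) auto
  finally show ?thesis using norm_bounded[of "R t one" x] by simp
qed

text \<open>
  Strong continuity at \<open>0\<close> keeps \<open>R\<^sub>t 1\<close> between \<open>1/2\<close> and \<open>2\<close> for \<open>t \<le> \<delta>\<close>, and the semigroup law iterates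
  these bounds. The lower bound keeps logarithms of \<open>R\<^sub>t u\<close> under control and shows that the
  growth rate is finite.
\<close>

lemma R_one_bounds_steps:
  obtains \<delta> where "0 < \<delta>"
    "\<And>n t x. 0 \<le> t \<Longrightarrow> t \<le> real n * \<delta> \<Longrightarrow> (1/2)^n \<le> apply_bcontfun (R t one) x"
    "\<And>n t x. 0 \<le> t \<Longrightarrow> t \<le> real n * \<delta> \<Longrightarrow> apply_bcontfun (R t one) x \<le> 2^n"
proof -
  have "\<forall>\<^sub>F t in at_right 0. dist (R t one) one < 1/2"
    by (rule tendstoD[OF R_tendsto]) simp
  then obtain d where d: "0 < d" "\<And>t. 0 < t \<Longrightarrow> t < d \<Longrightarrow> dist (R t one) one < 1/2"
    by (auto simp: eventually_at_right_field)
  define \<delta> where "\<delta> = d / 2"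
  have \<delta>: "0 < \<delta>" using d by (simp add: \<delta>_def)
  have base: "1/2 \<le> apply_bcontfun (R t one) x \<and> apply_bcontfun (R t one) x \<le> 2"
    if "0 \<le> t" "t \<le> \<delta>" for t x
  proof (cases "t = 0")
    case False
    then have "dist (R t one) one < 1/2" using that d \<delta> by (intro d) (auto simp: \<delta>_def)
    then have "dist (apply_bcontfun (R t one) x) (one x) < 1/2"
      by (rule dist_fun_lt_imp_dist_val_lt)
    then have "\<bar>apply_bcontfun (R t one) x - 1\<bar> < 1/2" by (simp add: dist_real_def)
    then show ?thesis by linarith
  qed simp
  have main: "(1/2)^n \<le> apply_bcontfun (R t one) x \<and> apply_bcontfun (R t one) x \<le> 2^n"
    if "0 \<le> t" "t \<le> real n * \<delta>" for n t x
    using that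
  proof (induction n arbitrary: t x)
    case (Suc n)
    show ?case
    proof (cases "t \<le> \<delta>")
      case True
      have "(1/2::real)^Suc n \<le> 1/2" "(2::real) \<le> 2^Suc n"
        using power_le_one[of "1/2::real" n] one_le_power[of "2::real" n] by auto
      then show ?thesis using base[OF Suc.prems(1) True, of x] by linarith
    next
      case False
      define s where "s = t - \<delta>"
      have s: "0 \<le> s" "s \<le> real n * \<delta>" using False Suc.prems by (auto simp: s_def algebra_simps)
      have eq: "R t one = R s (R \<delta> one)" using R_add[OF s(1), of \<delta> one] \<delta> by (simp add: s_def)
      have "(1/2) * apply_bcontfun (R s one) x \<le> apply_bcontfun (R t one) x"
        unfolding eq by (rule R_scaled_one_le[OF s(1)]) (use base[of \<delta>] \<delta> in auto)
      moreover have "apply_bcontfun (R t one) x \<le> 2 * apply_bcontfun (R s one) x"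
        unfolding eq by (rule R_le_scaled_one[OF s(1)]) (use base[of \<delta>] \<delta> in auto)
      ultimately show ?thesis using Suc.IH[OF s, of x] by auto
    qed
  qed simp
  show ?thesis using that[OF \<delta>] main by blast
qed

lemma R_one_bounds:
  obtains c C where "0 < c" "\<And>t x. 0 \<le> t \<Longrightarrow> t \<le> T \<Longrightarrow> c \<le> apply_bcontfun (R t one) x"
    "\<And>t x. 0 \<le> t \<Longrightarrow> t \<le> T \<Longrightarrow> apply_bcontfun (R t one) x \<le> C"
proof -
  obtain \<delta> where \<delta>: "0 < \<delta>"
    "\<And>n t x. 0 \<le> t \<Longrightarrow> t \<le> real n * \<delta> \<Longrightarrow> (1/2)^n \<le> apply_bcontfun (R t one) x"
    "\<And>n t x. 0 \<le> t \<Longrightarrow> t \<le> real n * \<delta> \<Longrightarrow> apply_bcontfun (R t one) x \<le> 2^n"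
    by (rule R_one_bounds_steps) blast
  obtain n :: nat where "T / \<delta> \<le> real n" using real_arch_simple by blast
  then have n: "T \<le> real n * \<delta>" using \<delta>(1) by (simp add: field_simps)
  show ?thesis
  proof (rule that)
    show "(1/2)^n \<le> apply_bcontfun (R t one) x" "apply_bcontfun (R t one) x \<le> 2^n"
      if "0 \<le> t" "t \<le> T" for t x
      using \<delta>(2,3)[OF that(1)] that(2) n by force+
  qed simp
qed

lemma R_pos:
  assumes t: "0 \<le> t" and a: "0 < a" "\<And>x. a \<le> apply_bcontfun f x"
  shows "0 < apply_bcontfun (R t f) x"
proof -
  obtain c C where c: "0 < c" "\<And>s x. 0 \<le> s \<Longrightarrow> s \<le> t \<Longrightarrow> c \<le> apply_bcontfun (R s one) x"
    by (rule R_one_bounds[of t]) blast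
  have "0 < a * apply_bcontfun (R t one) x" using c(1) c(2)[of t x] a t by (intro mult_pos_pos) auto
  also have "\<dots> \<le> apply_bcontfun (R t f) x" by (rule R_scaled_one_le[OF t a(2)])
  finally show ?thesis .
qed

lemma R_continuous: "continuous_on {0..} (\<lambda>t. R t f)"
  unfolding continuous_on_iff
proof (intro ballI allI impI)
  fix s e :: real assume s: "s \<in> {0..}" and e: "0 < e"
  obtain c C where "0 < c" "\<And>t x. 0 \<le> t \<Longrightarrow> t \<le> s + 1 \<Longrightarrow> c \<le> apply_bcontfun (R t one) x"
    and C: "\<And>t x. 0 \<le> t \<Longrightarrow> t \<le> s + 1 \<Longrightarrow> apply_bcontfun (R t one) x \<le> C"
    by (rule R_one_bounds[of "s + 1"]) blast
  have C0: "0 \<le> C" using C[of 0 undefined] s by simp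
  have "\<forall>\<^sub>F t in at_right 0. dist (R t f) f < e / (C + 1)"
    by (rule tendstoD[OF R_tendsto]) (use e C0 in simp)
  then obtain d where d: "0 < d" "\<And>t. 0 < t \<Longrightarrow> t < d \<Longrightarrow> dist (R t f) f < e / (C + 1)"
    by (auto simp: eventually_at_right_field)
  have key: "norm (R v f - R u f) < e" if uv: "0 \<le> u" "u < v" "v \<le> s + 1" "v - u < d" for u v
  proof -
    have "R v f - R u f = R u (R (v - u) f - f)"
      using R_add[of u "v - u" f] uv by (simp add: blinfun.diff_right)
    also have "norm \<dots> \<le> norm (R u) * norm (R (v - u) f - f)" by (rule norm_blinfun)
    also have "\<dots> \<le> C * norm (R (v - u) f - f)"
      using uv C by (intro mult_right_mono norm_R_le) auto
    also have "\<dots> \<le> C * (e / (C + 1))"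
      using d(2)[of "v - u"] uv C0 by (intro mult_left_mono) (auto simp: dist_norm)
    also have "\<dots> < e" using C0 e by (simp add: field_simps)
    finally show ?thesis .
  qed
  show "\<exists>d>0. \<forall>t\<in>{0..}. dist t s < d \<longrightarrow> dist (R t f) (R s f) < e"
  proof (intro exI[of _ "min d 1"] conjI ballI impI)
    fix t assume t: "t \<in> {0..}" "dist t s < min d 1"
    consider "t = s" | "t < s" | "s < t" by linarith
    then show "dist (R t f) (R s f) < e"
    proof cases
      case 2
      then show ?thesis using key[of t s] t s by (simp add: dist_norm norm_minus_commute)
    next
      case 3
      then show ?thesis using key[of s t] t s by (simp add: dist_norm)
    qed (use e in simp)
  qed (use d in auto)
qed

lemma generator_eqI:
  assumes "((\<lambda>t. (1 / t) *\<^sub>R (R t f - f)) \<longlongrightarrow> g) (at_right 0)"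
  shows "f \<in> generator_domain R" "generator R f = g"
proof -
  show "f \<in> generator_domain R" using assms unfolding generator_domain_def by blast
  show "generator R f = g" unfolding generator_def by (rule tendsto_Lim[OF _ assms]) simp
qed

lemma generator_tendsto:
  assumes "f \<in> generator_domain R"
  shows "((\<lambda>t. (1 / t) *\<^sub>R (R t f - f)) \<longlongrightarrow> generator R f) (at_right 0)"
proof -
  obtain g where g: "((\<lambda>t. (1 / t) *\<^sub>R (R t f - f)) \<longlongrightarrow> g) (at_right 0)"
    using assms unfolding generator_domain_def by blast
  from g generator_eqI(2)[OF g] show ?thesis by simp
qed

lemma generator_domain_scaleR:
  assumes "f \<in> generator_domain R" shows "c *\<^sub>R f \<in> generator_domain R"
  using tendsto_scaleR[OF tendsto_const generator_tendsto[OF assms], of c]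
  by (intro generator_eqI) (simp add: blinfun.scaleR_right scaleR_right_diff_distrib mult.commute)

text \<open>
  \<open>R\<^sub>h\<close> shifts the domain of integration from \<open>[0, T]\<close> to \<open>[h, T + h]\<close>, so the difference quotient is
  the difference of the averages of \<open>s \<mapsto> R\<^sub>s f\<close> over \<open>[T, T + h]\<close> and \<open>[0, h]\<close>.
\<close>

lemma generator_integral:
  assumes T: "0 \<le> T"
  shows "integral {0..T} (\<lambda>s. R s f) \<in> generator_domain R"
    and "generator R (integral {0..T} (\<lambda>s. R s f)) = R T f - f"
proof -
  define w where "w = integral {0..T} (\<lambda>s. R s f)"
  have int: "(\<lambda>s. R s f) integrable_on {a..b}" if "0 \<le> a" for a b
    by (rule integrable_continuous_real, rule continuous_on_subset[OF R_continuous]) (use that in auto)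
  have eq: "(1 / h) *\<^sub>R (R h w - w) =
      (1 / h) *\<^sub>R integral {T..T + h} (\<lambda>s. R s f) - (1 / h) *\<^sub>R integral {0..0 + h} (\<lambda>s. R s f)"
    if h: "0 < h" for h
  proof -
    have "R h w = integral {0..T} (blinfun_apply (R h) \<circ> (\<lambda>s. R s f))"
      unfolding w_def by (rule integral_linear[OF int blinfun.bounded_linear_right, symmetric]) simp
    also have "\<dots> = integral {0..T} ((\<lambda>s. R s f) \<circ> (+) h)"
      by (rule integral_cong) (use h R_add in simp)
    also have "\<dots> = integral {h..T + h} (\<lambda>s. R s f)"
      by (simp add: integral_shift_Icc_real)
    finally have 1: "R h w = integral {h..T + h} (\<lambda>s. R s f)" .
    have "integral {0..h} (\<lambda>s. R s f) + integral {h..T + h} (\<lambda>s. R s f) = integral {0..T + h} (\<lambda>s. R s f)"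
      using h T by (intro Henstock_Kurzweil_Integration.integral_combine int) auto
    moreover have "w + integral {T..T + h} (\<lambda>s. R s f) = integral {0..T + h} (\<lambda>s. R s f)"
      unfolding w_def using h T by (intro Henstock_Kurzweil_Integration.integral_combine int) auto
    ultimately have "R h w - w = integral {T..T + h} (\<lambda>s. R s f) - integral {0..0 + h} (\<lambda>s. R s f)"
      unfolding 1 by (simp add: algebra_simps eq_diff_eq)
    then show ?thesis by (simp add: scaleR_right_diff_distrib)
  qed
  have "((\<lambda>h. (1 / h) *\<^sub>R integral {T..T + h} (\<lambda>s. R s f) - (1 / h) *\<^sub>R integral {0..0 + h} (\<lambda>s. R s f))
      \<longlongrightarrow> R T f - R 0 f) (at_right 0)"
    by (intro tendsto_diff integral_average_tendsto R_continuous T) simp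
  then have "((\<lambda>h. (1 / h) *\<^sub>R (R h w - w)) \<longlongrightarrow> R T f - R 0 f) (at_right 0)"
    by (rule Lim_transform_eventually) (use eventually_at_right_less[of 0] eq in \<open>auto elim: eventually_mono\<close>)
  then show "integral {0..T} (\<lambda>s. R s f) \<in> generator_domain R"
    "generator R (integral {0..T} (\<lambda>s. R s f)) = R T f - f"
    unfolding w_def[symmetric] using generator_eqI by auto
qed

lemma generator_domain_dense:
  assumes e: "0 < e" shows "\<exists>w\<in>generator_domain R. norm (w - f) < e"
proof -
  have "((\<lambda>h. (1 / h) *\<^sub>R integral {0..0 + h} (\<lambda>s. R s f)) \<longlongrightarrow> R 0 f) (at_right 0)"
    by (intro integral_average_tendsto R_continuous) simp
  from tendstoD[OF this e]
  have "\<forall>\<^sub>F h in at_right 0. dist ((1 / h) *\<^sub>R integral {0..0 + h} (\<lambda>s. R s f)) (R 0 f) < e" .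
  then obtain d where d: "0 < d"
    "\<And>h. 0 < h \<Longrightarrow> h < d \<Longrightarrow> dist ((1 / h) *\<^sub>R integral {0..0 + h} (\<lambda>s. R s f)) (R 0 f) < e"
    by (auto simp: eventually_at_right_field)
  then have "dist ((1 / (d/2)) *\<^sub>R integral {0..d/2} (\<lambda>s. R s f)) f < e"
    using d(2)[of "d/2"] by simp
  moreover have "(1 / (d/2)) *\<^sub>R integral {0..d/2} (\<lambda>s. R s f) \<in> generator_domain R"
    using d by (intro generator_domain_scaleR generator_integral) auto
  ultimately show ?thesis by (auto simp: dist_norm)
qed

lemma positive_domain_dense:
  assumes e: "0 < e" and a: "0 < a" "\<And>x. a \<le> apply_bcontfun f x"
  shows "\<exists>w\<in>positive_domain R. norm (w - f) < e \<and> (\<forall>x. a / 2 \<le> w x)"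
proof -
  obtain w where w: "w \<in> generator_domain R" "norm (w - f) < min e (a / 2)"
    using generator_domain_dense[of "min e (a / 2)" f] e a by auto
  have "a / 2 \<le> w x" for x
    using norm_bounded[of "w - f" x] w(2) a(2)[of x] by (simp add: abs_le_iff)
  moreover from this have "0 < w x" for x using a(1) by (smt (verit) half_gt_zero)
  ultimately show ?thesis using w by (auto simp: positive_domain_def)
qed

lemma norm_R_pos: "0 \<le> t \<Longrightarrow> 0 < norm (R t)"
  by (rule less_le_trans[OF R_pos[of t 1 one undefined] R_one_le_norm[of t undefined]]) simp_all

text \<open>
  Fekete's lemma for the subadditive function \<open>ln (norm (R\<^sub>t))\<close>, whose linear bounds exclude an
  infinite limit. The principal eigenvalue is defined as a limit, so no property of it is
  available before this limit is known to exist.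
\<close>

lemma growth_bound_exists: "\<exists>L. ((\<lambda>t. (1 / t) * ln (norm (R t))) \<longlongrightarrow> L) at_top"
proof -
  obtain \<delta> where \<delta>: "0 < \<delta>"
    "\<And>n t x. 0 \<le> t \<Longrightarrow> t \<le> real n * \<delta> \<Longrightarrow> (1/2)^n \<le> apply_bcontfun (R t one) x"
    "\<And>n t x. 0 \<le> t \<Longrightarrow> t \<le> real n * \<delta> \<Longrightarrow> apply_bcontfun (R t one) x \<le> 2^n"
    by (rule R_one_bounds_steps) blast
  define a where "a t = ln (norm (R t))" for t
  have sub: "a (s + t) \<le> a s + a t" if "0 \<le> s" "0 \<le> t" for s t
  proof -
    have "norm (R (s + t)) \<le> norm (R s) * norm (R t)"
      using pos_semigroup that norm_blinfun_compose[of "R s" "R t"] by (simp add: positive_semigroup_def)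
    then have "ln (norm (R (s + t))) \<le> ln (norm (R s) * norm (R t))"
      using norm_R_pos that by (intro ln_mono) auto
    then show ?thesis using norm_R_pos[of s] norm_R_pos[of t] that by (simp add: a_def ln_mult)
  qed
  have bd: "\<bar>a t\<bar> \<le> (t / \<delta> + 1) * ln 2" if t: "0 \<le> t" for t
  proof -
    define n where "n = nat \<lceil>t / \<delta>\<rceil>"
    have td: "0 \<le> t / \<delta>" using t \<delta> by simp
    have n: "t / \<delta> \<le> real n" "real n \<le> t / \<delta> + 1" unfolding n_def using td by linarith+
    then have tn: "t \<le> real n * \<delta>" using \<delta>(1) by (simp add: field_simps)
    have "(1/2)^n \<le> norm (R t)" by (rule order_trans[OF \<delta>(2)[OF t tn] R_one_le_norm[of t undefined]])
    then have "ln ((1/2)^n) \<le> a t" unfolding a_def using norm_R_pos[OF t] by (intro ln_mono) auto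
    moreover have "norm (R t) \<le> 2^n" by (intro norm_R_le t \<delta>(3)[OF t tn])
    then have "a t \<le> ln (2^n)" unfolding a_def using norm_R_pos[OF t] by (intro ln_mono) auto
    ultimately have "\<bar>a t\<bar> \<le> real n * ln 2" by (simp add: ln_realpow ln_div abs_le_iff)
    also have "\<dots> \<le> (t / \<delta> + 1) * ln 2" using n by (intro mult_right_mono) auto
    finally show ?thesis .
  qed
  define K where "K = (1 / \<delta> + 1) * ln 2"
  define L where "L = Inf ((\<lambda>t. a t / t) ` {1..})"
  have bb: "bdd_below ((\<lambda>t. a t / t) ` {1..})"
  proof (rule bdd_belowI2[where m="- K"])
    fix t :: real assume t: "t \<in> {1..}"
    have "(t / \<delta> + 1) * ln 2 \<le> (t / \<delta> + t) * ln 2" using t by (intro mult_right_mono) auto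
    also have "\<dots> = K * t" by (simp add: K_def algebra_simps)
    finally have "- (K * t) \<le> a t" using bd[of t] t by auto
    then show "- K \<le> a t / t" using t by (simp add: field_simps)
  qed
  have "((\<lambda>t. a t / t) \<longlongrightarrow> L) at_top"
  proof (rule order_tendstoI)
    fix l assume l: "l < L"
    show "\<forall>\<^sub>F t in at_top. l < a t / t"
      using eventually_ge_at_top[of 1]
    proof eventually_elim
      case (elim t)
      then have "L \<le> a t / t" unfolding L_def by (intro cINF_lower[OF bb]) auto
      then show ?case using l by simp
    qed
  next
    fix u assume "L < u"
    then obtain t0 where t0: "1 \<le> t0" "a t0 / t0 < u"
      unfolding L_def using bb by (subst (asm) cINF_less_iff) auto
    \<comment> \<open>The error made when \<open>t\<close> is replaced by an integer multiple of \<open>t0\<close>.\<close>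
    define M where "M = (t0 / \<delta> + 1) * ln 2 + \<bar>a t0\<bar>"
    have multi: "a (real n * t0 + r) \<le> real n * a t0 + a r" if "0 \<le> r" for n r
    proof (induction n)
      case (Suc n)
      have "a (real (Suc n) * t0 + r) \<le> a t0 + a (real n * t0 + r)"
        using sub[of t0 "real n * t0 + r"] t0 that by (simp add: algebra_simps)
      then show ?case using Suc by (simp add: algebra_simps)
    qed simp
    have upper: "a t \<le> t * (a t0 / t0) + M" if t: "0 \<le> t" for t
    proof -
      define n where "n = nat \<lfloor>t / t0\<rfloor>"
      define r where "r = t - real n * t0"
      have "0 \<le> t / t0" using t t0 by simp
      then have n: "real n \<le> t / t0" "t / t0 < real n + 1" unfolding n_def by linarith+
      then have r: "0 \<le> r" "r \<le> t0" using t0 by (auto simp: r_def field_simps)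
      have "a t \<le> real n * a t0 + a r" using multi[OF r(1), of n] by (simp add: r_def)
      also have "real n * a t0 = t * (a t0 / t0) - (r / t0) * a t0" using t0 by (simp add: r_def field_simps)
      also have "- ((r / t0) * a t0) \<le> \<bar>a t0\<bar>"
      proof -
        have "- ((r / t0) * a t0) \<le> \<bar>r / t0\<bar> * \<bar>a t0\<bar>"
          unfolding abs_mult[symmetric] by (rule abs_ge_minus_self)
        also have "\<dots> \<le> 1 * \<bar>a t0\<bar>" using r t0 by (intro mult_right_mono) auto
        finally show ?thesis by simp
      qed
      moreover have "a r \<le> (t0 / \<delta> + 1) * ln 2"
      proof -
        have "a r \<le> (r / \<delta> + 1) * ln 2" using bd[OF r(1)] by simp
        also have "\<dots> \<le> (t0 / \<delta> + 1) * ln 2" using r \<delta> by (intro mult_right_mono add_right_mono divide_right_mono) auto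
        finally show ?thesis .
      qed
      ultimately show ?thesis unfolding M_def by linarith
    qed
    have "((\<lambda>t. a t0 / t0 + M * inverse t) \<longlongrightarrow> a t0 / t0 + M * 0) at_top"
      by (intro tendsto_intros tendsto_inverse_0_at_top filterlim_ident)
    then have "\<forall>\<^sub>F t in at_top. a t0 / t0 + M * inverse t < u"
      using t0(2) by (intro order_tendstoD(2)) auto
    then show "\<forall>\<^sub>F t in at_top. a t / t < u"
      using eventually_gt_at_top[of 0]
    proof eventually_elim
      case (elim t)
      have "a t / t \<le> (t * (a t0 / t0) + M) / t" using upper[of t] elim by (intro divide_right_mono) auto
      also have "\<dots> = a t0 / t0 + M * inverse t" using elim by (simp add: field_simps)
      finally show ?case using elim by linarith
    qed
  qed
  then show ?thesis unfolding a_def by (auto simp: field_simps)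
qed

lemma norm_R_eventually_le:
  assumes e: "0 < e"
  shows "\<forall>\<^sub>F t in at_top. norm (R t) \<le> exp ((principal_eigenvalue R + e) * t)"
proof -
  obtain L where L: "((\<lambda>t. (1 / t) * ln (norm (R t))) \<longlongrightarrow> L) at_top"
    using growth_bound_exists by blast
  have "principal_eigenvalue R = L"
    unfolding principal_eigenvalue_def by (rule tendsto_Lim[OF _ L]) simp
  then have "\<forall>\<^sub>F t in at_top. (1 / t) * ln (norm (R t)) < principal_eigenvalue R + e"
    using order_tendstoD(2)[OF L, of "L + e"] e by simp
  then show ?thesis using eventually_gt_at_top[of 0]
  proof eventually_elim
    case (elim t)
    then have "ln (norm (R t)) \<le> (principal_eigenvalue R + e) * t" by (simp add: field_simps)
    then show ?case using norm_R_pos[of t] elim by (metis exp_le_cancel_iff exp_ln less_imp_le)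
  qed
qed

end

definition scaled_semigroup :: "real \<Rightarrow> (real \<Rightarrow> 'a::metric_space operator) \<Rightarrow> real \<Rightarrow> 'a operator" where
  "scaled_semigroup \<kappa> R t = exp (\<kappa> * t) *\<^sub>R R t"

lemma scaled_scaled_semigroup: "scaled_semigroup (- \<kappa>) (scaled_semigroup \<kappa> R) = R"
  by (rule ext) (simp add: scaled_semigroup_def flip: exp_add)

lemma positive_semigroup_scaled:
  assumes R: "positive_semigroup R"
  shows "positive_semigroup (scaled_semigroup \<kappa> R)"
proof -
  interpret pos_semigroup R by standard fact
  show ?thesis
    unfolding positive_semigroup_def
  proof (intro conjI allI impI)
    show "scaled_semigroup \<kappa> R 0 = id_blinfun"
      by (rule blinfun_eqI) (simp add: scaled_semigroup_def)
    show "scaled_semigroup \<kappa> R (s + t) = scaled_semigroup \<kappa> R s o\<^sub>L scaled_semigroup \<kappa> R t"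
      if "0 \<le> s" "0 \<le> t" for s t
      by (rule blinfun_eqI)
        (simp add: scaled_semigroup_def R_add[OF that] blinfun.scaleR_left blinfun.scaleR_right distrib_left exp_add)
    show "0 \<le> apply_bcontfun (scaled_semigroup \<kappa> R t f) x" if "0 \<le> t" "\<forall>x. 0 \<le> apply_bcontfun f x" for t f x
      using that R_nonneg[of t f x] by (simp add: scaled_semigroup_def blinfun.scaleR_left)
    fix f
    have "((\<lambda>t. exp (\<kappa> * t) *\<^sub>R R t f - f) \<longlongrightarrow> exp (\<kappa> * 0) *\<^sub>R f - f) (at_right 0)"
      by (intro tendsto_intros R_tendsto)
    then show "((\<lambda>t. norm (scaled_semigroup \<kappa> R t f - f)) \<longlongrightarrow> 0) (at_right 0)"
      by (intro tendsto_norm_zero) (simp add: scaled_semigroup_def blinfun.scaleR_left)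
  qed
qed

text \<open>
  Scaling by \<open>exp (\<kappa>t)\<close> adds \<open>\<kappa>\<close> to the generator; with \<open>\<kappa> = -\<lambda>\<close> the eigenvalue is moved to \<open>0\<close>.
\<close>

lemma generator_scaled_semigroup:
  assumes R: "positive_semigroup R" and f: "f \<in> generator_domain R"
  shows "f \<in> generator_domain (scaled_semigroup \<kappa> R)"
    "generator (scaled_semigroup \<kappa> R) f = generator R f + \<kappa> *\<^sub>R f"
proof -
  interpret pos_semigroup R by standard fact
  interpret S: pos_semigroup "scaled_semigroup \<kappa> R" by standard (rule positive_semigroup_scaled[OF R])
  have "((\<lambda>t. exp (\<kappa> * t)) has_real_derivative \<kappa>) (at 0)"
    by (auto intro!: derivative_eq_intros)
  then have "((\<lambda>t. (exp (\<kappa> * t) - 1) / t) \<longlongrightarrow> \<kappa>) (at_right 0)"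
    unfolding has_field_derivative_iff by (auto intro: filterlim_mono[OF _ order_refl at_within_le_at])
  then have "((\<lambda>t. exp (\<kappa> * t) *\<^sub>R ((1 / t) *\<^sub>R (R t f - f)) + ((exp (\<kappa> * t) - 1) / t) *\<^sub>R f) \<longlongrightarrow>
      exp (\<kappa> * 0) *\<^sub>R generator R f + \<kappa> *\<^sub>R f) (at_right 0)"
    by (intro tendsto_intros generator_tendsto f)
  then have "((\<lambda>t. (1 / t) *\<^sub>R (scaled_semigroup \<kappa> R t f - f)) \<longlongrightarrow> generator R f + \<kappa> *\<^sub>R f) (at_right 0)"
  proof (rule back_subst[where P="\<lambda>h. (h \<longlongrightarrow> _) (at_right 0)", OF _ ext, THEN tendsto_eq_rhs])
    show "exp (\<kappa> * t) *\<^sub>R ((1 / t) *\<^sub>R (R t f - f)) + ((exp (\<kappa> * t) - 1) / t) *\<^sub>R f =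
        (1 / t) *\<^sub>R (scaled_semigroup \<kappa> R t f - f)" for t
      by (simp add: scaled_semigroup_def blinfun.scaleR_left scaleR_right_diff_distrib
          diff_divide_distrib scaleR_left_diff_distrib)
  qed simp
  then show "f \<in> generator_domain (scaled_semigroup \<kappa> R)"
    "generator (scaled_semigroup \<kappa> R) f = generator R f + \<kappa> *\<^sub>R f"
    by (rule S.generator_eqI)+
qed

lemma generator_domain_scaled_semigroup:
  assumes R: "positive_semigroup R"
  shows "generator_domain (scaled_semigroup \<kappa> R) = generator_domain R"
  using generator_scaled_semigroup(1)[OF R]
    generator_scaled_semigroup(1)[OF positive_semigroup_scaled[OF R, of \<kappa>], of _ "- \<kappa>"]
  by (auto simp: scaled_scaled_semigroup)

section \<open>Growth of logarithmic integrals along the semigroup\<close>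

lemma abs_ln_diff_le:
  fixes p q m :: real
  assumes "0 < m" "m \<le> p" "m \<le> q"
  shows "\<bar>ln p - ln q\<bar> \<le> \<bar>p - q\<bar> / m"
proof -
  have *: "ln x - ln y \<le> \<bar>x - y\<bar> / m" if "m \<le> x" "m \<le> y" for x y
  proof -
    have "ln x - ln y \<le> (x - y) / y" using that assms(1) by (intro ln_diff_le) auto
    also have "\<dots> \<le> \<bar>x - y\<bar> / y" using that assms(1) by (intro divide_right_mono) auto
    also have "\<dots> \<le> \<bar>x - y\<bar> / m" using that assms(1) by (intro divide_left_mono) auto
    finally show ?thesis .
  qed
  show ?thesis using *[of p q] *[of q p] assms by (simp add: abs_le_iff abs_minus_commute)
qed

lemma compact_positive_lower_bound:
  fixes u :: "'a::metric_space \<Rightarrow>\<^sub>C real"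
  assumes X: "compact (UNIV :: 'a set)" and u: "\<And>x. 0 < apply_bcontfun u x"
  obtains a where "0 < a" "\<And>x. a \<le> apply_bcontfun u x"
proof -
  obtain x where "\<And>y. apply_bcontfun u x \<le> apply_bcontfun u y"
    using continuous_attains_inf[OF X, of "apply_bcontfun u"] by auto
  then show ?thesis using that[of "apply_bcontfun u x"] u by blast
qed

lemma bounded_linear_eval: "bounded_linear (\<lambda>f :: 'a::metric_space \<Rightarrow>\<^sub>C real. apply_bcontfun f x)"
proof (rule bounded_linear_intro[where K=1])
  show "norm (apply_bcontfun f x) \<le> norm f * 1" for f :: "'a \<Rightarrow>\<^sub>C real"
    using norm_bounded[of f x] by simp
qed simp_all

text \<open>
  For the semigroup with generator \<open>L + V - \<lambda>\<close> this is the inequality \<open>I(\<mu>) \<le> \<mu>(V) - \<lambda>\<close>.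
\<close>

definition dissipative :: "(real \<Rightarrow> 'a::metric_space operator) \<Rightarrow> 'a measure \<Rightarrow> bool" where
  "dissipative R \<mu> \<longleftrightarrow>
     (\<forall>u\<in>positive_domain R. 0 \<le> (\<integral>x. apply_bcontfun (generator R u) x / apply_bcontfun u x \<partial>\<mu>))"

text \<open>
  The lower bound \<open>a\<close> expresses that \<open>u\<close> is bounded away from \<open>0\<close>, so that both logarithms are
  bounded.
\<close>

definition log_increasing :: "'a::metric_space operator \<Rightarrow> 'a measure \<Rightarrow> bool" where
  "log_increasing S \<mu> \<longleftrightarrow>
     (\<forall>u a. 0 < a \<longrightarrow> (\<forall>x. a \<le> apply_bcontfun u x) \<longrightarrow>
        (\<integral>x. ln (apply_bcontfun u x) \<partial>\<mu>) \<le> (\<integral>x. ln (apply_bcontfun (S u) x) \<partial>\<mu>))"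

locale borel_prob = prob_space \<mu> for \<mu> :: "'a::metric_space measure" +
  assumes sets_eq [simp, measurable_cong]: "sets \<mu> = sets borel"
begin

lemma space_eq [simp]: "space \<mu> = UNIV"
  using sets_eq_imp_space_eq[OF sets_eq] by simp

lemma integrable_bounded:
  assumes [measurable]: "f \<in> borel_measurable borel" and "\<And>x. \<bar>f x\<bar> \<le> (B::real)"
  shows "integrable \<mu> f"
  by (rule integrable_const_bound[where B=B]) (use assms in auto)

lemma integrable_ln:
  assumes [measurable]: "f \<in> borel_measurable borel" and "0 < a" "\<And>x. a \<le> f x" "\<And>x. f x \<le> b"
  shows "integrable \<mu> (\<lambda>x. ln (f x) :: real)"
proof (rule integrable_bounded)
  fix x
  have "ln a \<le> ln (f x)" "ln (f x) \<le> ln b"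
    using assms(2) assms(3,4)[of x] by (auto intro!: ln_mono)
  then show "\<bar>ln (f x)\<bar> \<le> \<bar>ln a\<bar> + \<bar>ln b\<bar>" by linarith
qed measurable

lemma integrable_ln_bcontfun:
  fixes f :: "'a \<Rightarrow>\<^sub>C real"
  assumes "0 < a" "\<And>x. a \<le> apply_bcontfun f x"
  shows "integrable \<mu> (\<lambda>x. ln (apply_bcontfun f x))"
proof (rule integrable_ln)
  show "apply_bcontfun f x \<le> norm f" for x using norm_bounded[of f x] by simp
qed (use assms in auto)

lemma integral_le_bound:
  assumes "integrable \<mu> f" "\<And>x. f x \<le> (B::real)"
  shows "(\<integral>x. f x \<partial>\<mu>) \<le> B"
  using integral_mono[of \<mu> f "\<lambda>_. B"] assms by (simp add: prob_space[simplified])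

lemma bounded_linear_weighted_integral:
  fixes u :: "'a \<Rightarrow>\<^sub>C real"
  assumes a: "0 < a" "\<And>x. a \<le> apply_bcontfun u x"
  shows "bounded_linear (\<lambda>g. \<integral>x. apply_bcontfun g x / apply_bcontfun u x \<partial>\<mu>)"
proof -
  have b: "\<bar>apply_bcontfun g x / apply_bcontfun u x\<bar> \<le> norm g * (1 / a)" for g :: "'a \<Rightarrow>\<^sub>C real" and x
  proof -
    have "\<bar>apply_bcontfun g x / apply_bcontfun u x\<bar> = \<bar>apply_bcontfun g x\<bar> / apply_bcontfun u x"
      using a(1) a(2)[of x] by (simp add: abs_divide)
    also have "\<dots> \<le> norm g / a"
      using norm_bounded[of g x] a(1) a(2)[of x] by (intro frac_le) auto
    finally show ?thesis by simp
  qed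
  have int: "integrable \<mu> (\<lambda>x. apply_bcontfun g x / apply_bcontfun u x)" for g :: "'a \<Rightarrow>\<^sub>C real"
    by (rule integrable_bounded[OF _ b]) measurable
  show ?thesis
  proof (rule bounded_linear_intro)
    fix g h :: "'a \<Rightarrow>\<^sub>C real" and r :: real
    have "\<bar>\<integral>x. apply_bcontfun g x / apply_bcontfun u x \<partial>\<mu>\<bar> \<le> (\<integral>x. \<bar>apply_bcontfun g x / apply_bcontfun u x\<bar> \<partial>\<mu>)"
      by (rule integral_abs_bound)
    also have "\<dots> \<le> norm g * (1 / a)"
      by (rule integral_le_bound[OF integrable_abs[OF int] b])
    finally show "norm (\<integral>x. apply_bcontfun g x / apply_bcontfun u x \<partial>\<mu>) \<le> norm g * (1 / a)" by simp
    show "(\<integral>x. apply_bcontfun (g + h) x / apply_bcontfun u x \<partial>\<mu>) =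
        (\<integral>x. apply_bcontfun g x / apply_bcontfun u x \<partial>\<mu>) + (\<integral>x. apply_bcontfun h x / apply_bcontfun u x \<partial>\<mu>)"
      using int[of g] int[of h] by (simp add: add_divide_distrib)
    have "(\<integral>x. apply_bcontfun (r *\<^sub>R g) x / apply_bcontfun u x \<partial>\<mu>) =
        (\<integral>x. r * (apply_bcontfun g x / apply_bcontfun u x) \<partial>\<mu>)" by simp
    then show "(\<integral>x. apply_bcontfun (r *\<^sub>R g) x / apply_bcontfun u x \<partial>\<mu>) =
        r *\<^sub>R (\<integral>x. apply_bcontfun g x / apply_bcontfun u x \<partial>\<mu>)"
      by (simp only: integral_mult_right_zero real_scaleR_def)
  qed
qed

end

locale semigroup_on_prob = pos_semigroup R + borel_prob \<mu>
  for R :: "real \<Rightarrow> 'a::metric_space operator" and \<mu> :: "'a measure" +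
  assumes compact_X: "compact (UNIV :: 'a set)"
begin

lemma R_lower:
  assumes "0 \<le> t" "0 < a" "\<And>x. a \<le> apply_bcontfun u x"
  obtains b where "0 < b" "\<And>x. b \<le> apply_bcontfun (R t u) x"
  by (rule compact_positive_lower_bound[OF compact_X R_pos[OF assms]]) blast

text \<open>
  Because of \<open>ln (R\<^sub>t u) - ln u \<le> (R\<^sub>t u - u) / u\<close>, the hypothesis makes the integral of the
  difference quotient nonnegative before the limit \<open>t \<rightarrow> 0\<close>.
\<close>

lemma dissipative_if_log_increasing:
  assumes H: "\<And>t. 0 \<le> t \<Longrightarrow> log_increasing (R t) \<mu>"
  shows "dissipative R \<mu>"
  unfolding dissipative_def
proof
  fix u assume u: "u \<in> positive_domain R"
  then have dom: "u \<in> generator_domain R" and upos: "\<And>x. 0 < apply_bcontfun u x"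
    by (auto simp: positive_domain_def)
  obtain a where a: "0 < a" "\<And>x. a \<le> apply_bcontfun u x"
    by (rule compact_positive_lower_bound[OF compact_X upos]) blast
  let ?\<Phi> = "\<lambda>g. \<integral>x. apply_bcontfun g x / apply_bcontfun u x \<partial>\<mu>"
  interpret \<Phi>: bounded_linear ?\<Phi> by (rule bounded_linear_weighted_integral[OF a])
  have "((\<lambda>t. ?\<Phi> ((1 / t) *\<^sub>R (R t u - u))) \<longlongrightarrow> ?\<Phi> (generator R u)) (at_right 0)"
    by (rule \<Phi>.tendsto[OF generator_tendsto[OF dom]])
  then show "0 \<le> ?\<Phi> (generator R u)"
  proof (rule tendsto_lowerbound)
    show "\<forall>\<^sub>F t in at_right 0. 0 \<le> ?\<Phi> ((1 / t) *\<^sub>R (R t u - u))"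
      using eventually_at_right_less[of 0]
    proof eventually_elim
      case (elim t)
      obtain b where b: "0 < b" "\<And>x. b \<le> apply_bcontfun (R t u) x"
        by (rule R_lower[of t a u]) (use elim a in auto)
      have i: "integrable \<mu> (\<lambda>x. ln (apply_bcontfun (R t u) x))" "integrable \<mu> (\<lambda>x. ln (apply_bcontfun u x))"
        by (rule integrable_ln_bcontfun[OF b] integrable_ln_bcontfun[OF a])+
      have "0 \<le> (\<integral>x. ln (apply_bcontfun (R t u) x) - ln (apply_bcontfun u x) \<partial>\<mu>)"
        using H[of t] elim a i unfolding log_increasing_def by (auto simp: less_imp_le)
      also have "\<dots> \<le> ?\<Phi> (R t u - u)"
      proof (rule integral_mono)
        show "integrable \<mu> (\<lambda>x. apply_bcontfun (R t u - u) x / apply_bcontfun u x)"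
        proof (rule integrable_bounded)
          fix x
          show "\<bar>apply_bcontfun (R t u - u) x / apply_bcontfun u x\<bar> \<le> norm (R t u - u) / a"
            using norm_bounded[of "R t u - u" x] a(1) a(2)[of x] unfolding abs_divide
            by (intro frac_le) auto
        qed measurable
        show "ln (apply_bcontfun (R t u) x) - ln (apply_bcontfun u x) \<le> apply_bcontfun (R t u - u) x / apply_bcontfun u x" for x
          using ln_diff_le[of "apply_bcontfun (R t u) x" "apply_bcontfun u x"] b(1) b(2)[of x] upos[of x] by simp
      qed (use i in simp)
      finally show ?case unfolding \<Phi>.scaleR using elim by simp
    qed
  qed simp
qed

text \<open>
  The derivative of \<open>\<integral> ln (R\<^sub>s u) d\<mu>\<close> is nonnegative, with an error that is uniform in \<open>s\<close>: since \<open>R\<^sub>s\<close>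
  commutes with the difference quotients at \<open>0\<close>, the quotient at \<open>s\<close> converges at the same rate
  up to the bound on \<open>norm (R\<^sub>s)\<close>. Uniformity allows summation over a partition of the time
  interval in place of an argument with one-sided derivatives.
\<close>

lemma log_integral_step:
  assumes D: "dissipative R \<mu>" and u: "u \<in> positive_domain R" and e: "0 < e"
  shows "\<exists>d>0. \<forall>h s. 0 < h \<longrightarrow> h < d \<longrightarrow> 0 \<le> s \<longrightarrow> s + h \<le> T \<longrightarrow>
    (\<integral>x. ln (apply_bcontfun (R s u) x) \<partial>\<mu>) - e * h \<le> (\<integral>x. ln (apply_bcontfun (R (s + h) u) x) \<partial>\<mu>)"
proof -
  have dom: "u \<in> generator_domain R" and upos: "\<And>x. 0 < apply_bcontfun u x"
    using u by (auto simp: positive_domain_def)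
  obtain a where a: "0 < a" "\<And>x. a \<le> apply_bcontfun u x"
    by (rule compact_positive_lower_bound[OF compact_X upos]) blast
  obtain c0 C where c0: "0 < c0" "\<And>t x. 0 \<le> t \<Longrightarrow> t \<le> T \<Longrightarrow> c0 \<le> apply_bcontfun (R t one) x"
    and C: "\<And>t x. 0 \<le> t \<Longrightarrow> t \<le> T \<Longrightarrow> apply_bcontfun (R t one) x \<le> C"
    by (rule R_one_bounds[of T]) blast
  define c where "c = a * c0"
  have c: "0 < c" using a c0 by (simp add: c_def)
  have low: "c \<le> apply_bcontfun (R t u) x" if "0 \<le> t" "t \<le> T" for t x
  proof -
    have "c \<le> a * apply_bcontfun (R t one) x" unfolding c_def using c0 a that by (intro mult_left_mono) auto
    also have "\<dots> \<le> apply_bcontfun (R t u) x" by (rule R_scaled_one_le[OF that(1) a(2)])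
    finally show ?thesis .
  qed
  define g where "g = generator R u"
  define q where "q h = (1 / h) *\<^sub>R (R h u - u)" for h
  define C' where "C' = \<bar>C\<bar> + 1"
  have C': "0 < C'" by (simp add: C'_def)
  define B where "B = C' * (norm g + 1) / c"
  have B: "0 < B" using C' c by (auto simp: B_def intro!: divide_pos_pos mult_pos_pos add_nonneg_pos)
  \<comment> \<open>Half of the error budget \<open>e\<close> goes to the difference quotient, half to the quadratic term of the logarithm.\<close>
  define \<eta> where "\<eta> = min 1 (e * c / (2 * C'))"
  have \<eta>: "0 < \<eta>" using e c C' by (simp add: \<eta>_def)
  have "(q \<longlongrightarrow> g) (at_right 0)" unfolding q_def g_def by (rule generator_tendsto[OF dom])
  from tendstoD[OF this \<eta>] obtain d0 where d0: "0 < d0" "\<And>h. 0 < h \<Longrightarrow> h < d0 \<Longrightarrow> dist (q h) g < \<eta>"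
    by (auto simp: eventually_at_right_field)
  \<comment> \<open>The bounds make \<open>h B \<le> 1/2\<close>, so that \<open>ln (1 + z) \<ge> z - 2 z\<^sup>2\<close> applies, and \<open>2 (h B)\<^sup>2 \<le> h e / 2\<close>.\<close>
  define d where "d = min d0 (min (1 / (2 * B)) (e / (4 * B\<^sup>2)))"
  have d: "0 < d" using d0 B e by (simp add: d_def)
  have main: "(\<integral>x. ln (apply_bcontfun (R s u) x) \<partial>\<mu>) - e * h \<le> (\<integral>x. ln (apply_bcontfun (R (s + h) u) x) \<partial>\<mu>)"
    if h: "0 < h" "h < d" and s: "0 \<le> s" "s + h \<le> T" for h s
  proof -
    have sT: "s \<le> T" using h s by simp
    have nR: "norm (R s) \<le> C'"
      using norm_R_le[OF s(1), of C] C[OF s(1) sT] by (simp add: C'_def)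
    have hd: "h < d0" "h < 1 / (2 * B)" "h < e / (4 * B\<^sup>2)" using h(2) by (auto simp: d_def)
    have qg: "norm (q h - g) < \<eta>" using d0(2)[OF h(1) hd(1)] by (simp add: dist_norm)
    let ?v = "apply_bcontfun (R s u)" and ?w = "apply_bcontfun (R (s + h) u)"
    define z where "z x = h * apply_bcontfun (R s (q h)) x / ?v x" for x
    have vpos: "0 < ?v x" "c \<le> ?v x" "0 < ?w x" "c \<le> ?w x" for x
      using low[of s x] low[of "s + h" x] c s h sT by auto
    have w: "?w x = ?v x * (1 + z x)" for x
    proof -
      have "R (s + h) u = R s (u + h *\<^sub>R q h)"
        using R_add[of s h u] h s by (simp add: q_def)
      then have "?w x = ?v x + h * apply_bcontfun (R s (q h)) x"
        by (simp add: blinfun.add_right blinfun.scaleR_right)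
      then show ?thesis using vpos[of x] by (simp add: z_def field_simps)
    qed
    have zb: "\<bar>z x\<bar> \<le> h * B" for x
    proof -
      have "\<bar>apply_bcontfun (R s (q h)) x\<bar> \<le> norm (R s (q h))" using norm_bounded[of "R s (q h)" x] by simp
      also have "\<dots> \<le> norm (R s) * norm (q h)" by (rule norm_blinfun)
      also have "\<dots> \<le> C' * (norm g + 1)"
      proof (rule mult_mono[OF nR])
        show "norm (q h) \<le> norm g + 1"
          using qg norm_triangle_ineq2[of "q h" g] by (auto simp: \<eta>_def)
      qed (use C' in auto)
      finally have "\<bar>z x\<bar> \<le> h * (C' * (norm g + 1)) / c"
        unfolding z_def abs_divide abs_mult using h vpos[of x] c
        by (intro frac_le mult_mono) auto
      then show ?thesis by (simp add: B_def)
    qed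
    have hB: "h * B \<le> 1/2" using hd(2) B by (simp add: field_simps)
    have ln1: "z x - 2 * (h * B)\<^sup>2 \<le> ln (?w x) - ln (?v x)" for x
    proof -
      have "\<bar>z x\<bar> \<le> 1/2" using zb[of x] hB by linarith
      then have "\<bar>ln (1 + z x) - z x\<bar> \<le> 2 * (z x)\<^sup>2" by (rule abs_ln_one_plus_x_minus_x_bound)
      moreover have "(z x)\<^sup>2 \<le> (h * B)\<^sup>2" using zb[of x] by (metis abs_ge_zero power2_abs power_mono)
      moreover have "ln (?w x) = ln (?v x) + ln (1 + z x)"
        unfolding w using vpos[of x] \<open>\<bar>z x\<bar> \<le> 1/2\<close> by (intro ln_mult_pos) auto
      ultimately show ?thesis by linarith
    qed
    interpret \<Phi>: bounded_linear "\<lambda>f. \<integral>x. apply_bcontfun f x / ?v x \<partial>\<mu>"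
      by (rule bounded_linear_weighted_integral[OF c vpos(2)])
    have ig: "integrable \<mu> (\<lambda>x. apply_bcontfun f x / ?v x)" for f
    proof (rule integrable_bounded)
      fix x
      show "\<bar>apply_bcontfun f x / ?v x\<bar> \<le> norm f / c"
        using norm_bounded[of f x] c vpos[of x] unfolding abs_divide
        by (intro frac_le) auto
    qed measurable
    have Rsg: "R s u \<in> generator_domain R" "generator R (R s u) = R s g"
    proof -
      have "((\<lambda>t. R s ((1 / t) *\<^sub>R (R t u - u))) \<longlongrightarrow> R s g) (at_right 0)"
        unfolding g_def by (intro blinfun.tendsto tendsto_const generator_tendsto[OF dom])
      then have "((\<lambda>t. (1 / t) *\<^sub>R (R t (R s u) - R s u)) \<longlongrightarrow> R s g) (at_right 0)"
      proof (rule Lim_transform_eventually)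
        show "\<forall>\<^sub>F t in at_right 0. R s ((1 / t) *\<^sub>R (R t u - u)) = (1 / t) *\<^sub>R (R t (R s u) - R s u)"
          using eventually_at_right_less[of 0]
        proof eventually_elim
          case (elim t)
          then have "R t (R s u) = R s (R t u)" using R_add[of t s u] R_add[of s t u] s by (simp add: add.commute)
          then show ?case by (simp add: blinfun.scaleR_right blinfun.diff_right)
        qed
      qed
      then show "R s u \<in> generator_domain R" "generator R (R s u) = R s g" by (rule generator_eqI)+
    qed
    have diss: "0 \<le> (\<integral>x. apply_bcontfun (R s g) x / ?v x \<partial>\<mu>)"
      using D Rsg vpos(1) unfolding dissipative_def positive_domain_def by force
    have zeq: "z x = h * (apply_bcontfun (R s g) x / ?v x) + h * (apply_bcontfun (R s (q h - g)) x / ?v x)" for x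
      by (simp add: z_def blinfun.diff_right add_divide_distrib[symmetric] algebra_simps diff_divide_distrib)
    have err: "- (e / 2) \<le> apply_bcontfun (R s (q h - g)) x / ?v x" for x
    proof -
      have "\<bar>apply_bcontfun (R s (q h - g)) x\<bar> \<le> norm (R s (q h - g))" using norm_bounded[of "R s (q h - g)" x] by simp
      also have "\<dots> \<le> norm (R s) * norm (q h - g)" by (rule norm_blinfun)
      also have "\<dots> \<le> C' * \<eta>" using nR qg C' by (intro mult_mono) auto
      also have "\<dots> \<le> C' * (e * c / (2 * C'))" using C' by (intro mult_left_mono) (auto simp: \<eta>_def)
      also have "\<dots> = e / 2 * c" using C' by simp
      also have "\<dots> \<le> e / 2 * ?v x" using vpos[of x] e by (intro mult_left_mono) auto
      finally show ?thesis using vpos[of x] by (simp add: field_simps abs_le_iff)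
    qed
    have iz: "integrable \<mu> z"
      unfolding zeq[abs_def] using ig by (intro Bochner_Integration.integrable_add integrable_mult_right) auto
    have 1: "- (h * (e / 2)) \<le> (\<integral>x. z x \<partial>\<mu>)"
    proof -
      have "- (h * (e / 2)) = (\<integral>x. h * (- (e / 2)) \<partial>\<mu>)" by (simp add: prob_space[simplified])
      also have "\<dots> \<le> (\<integral>x. h * (apply_bcontfun (R s (q h - g)) x / ?v x) \<partial>\<mu>)"
      proof (rule integral_mono)
        show "integrable \<mu> (\<lambda>x. h * (apply_bcontfun (R s (q h - g)) x / ?v x))"
          by (intro integrable_mult_right ig)
        show "h * (- (e / 2)) \<le> h * (apply_bcontfun (R s (q h - g)) x / ?v x)" for x
          using err[of x] h(1) by (rule mult_left_mono[OF _ less_imp_le])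
      qed simp
      also have "\<dots> \<le> (\<integral>x. z x \<partial>\<mu>)"
      proof -
        have "(\<integral>x. z x \<partial>\<mu>) = (\<integral>x. h * (apply_bcontfun (R s g) x / ?v x) \<partial>\<mu>) +
            (\<integral>x. h * (apply_bcontfun (R s (q h - g)) x / ?v x) \<partial>\<mu>)"
          unfolding zeq by (intro Bochner_Integration.integral_add integrable_mult_right ig)
        moreover have "0 \<le> (\<integral>x. h * (apply_bcontfun (R s g) x / ?v x) \<partial>\<mu>)"
          unfolding integral_mult_right_zero using diss h by (intro mult_nonneg_nonneg) auto
        ultimately show ?thesis by linarith
      qed
      finally show ?thesis .
    qed
    have iv: "integrable \<mu> (\<lambda>x. ln (?v x))" "integrable \<mu> (\<lambda>x. ln (?w x))"
      by (rule integrable_ln_bcontfun[OF c vpos(2)] integrable_ln_bcontfun[OF c vpos(4)])+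
    have "2 * (h * B)\<^sup>2 \<le> h * (e / 2)"
    proof -
      have "h * (4 * B\<^sup>2) \<le> e" using hd(3) B by (simp add: field_simps)
      then have "h * (h * (4 * B\<^sup>2)) \<le> h * e" using h by (intro mult_left_mono) auto
      then show ?thesis by (simp add: power2_eq_square algebra_simps)
    qed
    then have "- (e * h) \<le> (\<integral>x. z x \<partial>\<mu>) - 2 * (h * B)\<^sup>2" using 1 by (simp add: algebra_simps)
    also have "\<dots> = (\<integral>x. z x - 2 * (h * B)\<^sup>2 \<partial>\<mu>)" using iz by (simp add: prob_space[simplified])
    also have "\<dots> \<le> (\<integral>x. ln (?w x) - ln (?v x) \<partial>\<mu>)" using iz iv ln1 by (intro integral_mono) auto
    also have "\<dots> = (\<integral>x. ln (?w x) \<partial>\<mu>) - (\<integral>x. ln (?v x) \<partial>\<mu>)" using iv by simp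
    finally show ?thesis by simp
  qed
  show ?thesis using d main by blast
qed

lemma log_integral_increasing_domain:
  assumes D: "dissipative R \<mu>" and u: "u \<in> positive_domain R" and t: "0 \<le> t"
  shows "(\<integral>x. ln (apply_bcontfun u x) \<partial>\<mu>) \<le> (\<integral>x. ln (apply_bcontfun (R t u) x) \<partial>\<mu>)"
proof (cases "t = 0")
  case False
  then have t: "0 < t" using t by simp
  let ?\<phi> = "\<lambda>s. \<integral>x. ln (apply_bcontfun (R s u) x) \<partial>\<mu>"
  show ?thesis
  proof (rule field_le_epsilon)
    fix e :: real assume e: "0 < e"
    obtain d where d: "0 < d" "\<And>h s. 0 < h \<Longrightarrow> h < d \<Longrightarrow> 0 \<le> s \<Longrightarrow> s + h \<le> t \<Longrightarrow> ?\<phi> s - e / t * h \<le> ?\<phi> (s + h)"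
      using log_integral_step[OF D u, of "e / t" t] e t by auto
    obtain n :: nat where tn: "t / d < real n" using reals_Archimedean2 by blast
    have n0: "0 < real n" using d(1) t by (intro less_trans[OF _ tn] divide_pos_pos)
    have n: "0 < real n" "t / real n < d" using n0 tn d(1) by (simp_all add: field_simps)
    define h where "h = t / real n"
    have h: "0 < h" "h < d" "real n * h = t" using n t by (auto simp: h_def)
    have "?\<phi> 0 - e / t * (real k * h) \<le> ?\<phi> (real k * h)" if "k \<le> n" for k
      using that
    proof (induction k)
      case (Suc k)
      have "real (Suc k) * h \<le> real n * h" using Suc.prems h by (intro mult_right_mono) auto
      then have "?\<phi> (real k * h) - e / t * h \<le> ?\<phi> (real k * h + h)"
        using h by (intro d(2)) (auto simp: algebra_simps)
      then show ?case using Suc by (simp add: algebra_simps)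
    qed simp
    from this[of n] show "(\<integral>x. ln (apply_bcontfun u x) \<partial>\<mu>) \<le> ?\<phi> t + e"
      using h t by simp
  qed
qed simp

text \<open>
  Both sides depend continuously on \<open>u\<close> in the sup norm as long as \<open>u\<close> stays away from \<open>0\<close>, and the
  positive elements of the domain are dense.
\<close>

lemma log_increasing_if_dissipative:
  assumes D: "dissipative R \<mu>" and t: "0 \<le> t"
  shows "log_increasing (R t) \<mu>"
  unfolding log_increasing_def
proof (intro allI impI)
  fix u :: "'a \<Rightarrow>\<^sub>C real" and a :: real assume "0 < a" "\<forall>x. a \<le> apply_bcontfun u x"
  then have a: "0 < a" "\<And>x. a \<le> apply_bcontfun u x" by auto
  obtain c C where c: "0 < c" "\<And>s x. 0 \<le> s \<Longrightarrow> s \<le> t \<Longrightarrow> c \<le> apply_bcontfun (R s one) x"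
    and C: "\<And>s x. 0 \<le> s \<Longrightarrow> s \<le> t \<Longrightarrow> apply_bcontfun (R s one) x \<le> C"
    by (rule R_one_bounds[of t]) blast
  have nR: "norm (R t) \<le> C" by (rule norm_R_le[OF t C[OF t order_refl]])
  have C0: "0 \<le> C" using nR norm_ge_zero order_trans by blast
  define K where "K = 1 / (a / 2) + C / (c * (a / 2))"
  have K: "0 < K" using a c C0 by (auto simp: K_def intro!: add_pos_nonneg)
  show "(\<integral>x. ln (apply_bcontfun u x) \<partial>\<mu>) \<le> (\<integral>x. ln (apply_bcontfun (R t u) x) \<partial>\<mu>)"
  proof (rule field_le_epsilon)
    fix e :: real assume e: "0 < e"
    define \<epsilon> where "\<epsilon> = e / K"
    have \<epsilon>: "0 < \<epsilon>" using e K by (simp add: \<epsilon>_def)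
    obtain w where w: "w \<in> positive_domain R" "norm (w - u) < \<epsilon>" "\<And>x. a / 2 \<le> apply_bcontfun w x"
      using positive_domain_dense[OF \<epsilon> a] by blast
    have a2: "0 < a / 2" "\<And>x. a / 2 \<le> apply_bcontfun u x" using a(1) order_trans[OF _ a(2), of "a / 2"] by auto
    have low: "c * (a / 2) \<le> apply_bcontfun (R t f) x" if "\<And>x. a / 2 \<le> apply_bcontfun f x" for f x
    proof -
      have "c * (a / 2) \<le> a / 2 * apply_bcontfun (R t one) x"
        using c(2)[OF t order_refl, of x] a by (simp add: mult.commute)
      also have "\<dots> \<le> apply_bcontfun (R t f) x" by (rule R_scaled_one_le[OF t that])
      finally show ?thesis .
    qed
    have ca: "0 < c * (a / 2)" using a c by simp
    note i = integrable_ln_bcontfun[OF a2] integrable_ln_bcontfun[OF a2(1) w(3)]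
      integrable_ln_bcontfun[OF ca low[OF a2(2)]] integrable_ln_bcontfun[OF ca low[OF w(3)]]
    have d1: "ln (apply_bcontfun u x) - ln (apply_bcontfun w x) \<le> \<epsilon> / (a / 2)" for x
    proof -
      have "\<bar>ln (apply_bcontfun u x) - ln (apply_bcontfun w x)\<bar> \<le> \<bar>apply_bcontfun u x - apply_bcontfun w x\<bar> / (a / 2)"
        by (rule abs_ln_diff_le[OF a2 w(3)])
      also have "\<dots> \<le> \<epsilon> / (a / 2)"
        using norm_bounded[of "w - u" x] w(2) a2(1) by (intro divide_right_mono) auto
      finally show ?thesis by linarith
    qed
    have d2: "ln (apply_bcontfun (R t w) x) - ln (apply_bcontfun (R t u) x) \<le> C * \<epsilon> / (c * (a / 2))" for x
    proof -
      have "\<bar>ln (apply_bcontfun (R t w) x) - ln (apply_bcontfun (R t u) x)\<bar>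
          \<le> \<bar>apply_bcontfun (R t w) x - apply_bcontfun (R t u) x\<bar> / (c * (a / 2))"
        by (rule abs_ln_diff_le[OF ca low[OF w(3)] low[OF a2(2)]])
      also have "\<dots> \<le> C * \<epsilon> / (c * (a / 2))"
      proof (rule divide_right_mono)
        have "\<bar>apply_bcontfun (R t w) x - apply_bcontfun (R t u) x\<bar> \<le> norm (R t (w - u))"
          using norm_bounded[of "R t (w - u)" x] by (simp add: blinfun.diff_right)
        also have "\<dots> \<le> norm (R t) * norm (w - u)" by (rule norm_blinfun)
        also have "\<dots> \<le> C * \<epsilon>" using nR w(2) C0 by (intro mult_mono) auto
        finally show "\<bar>apply_bcontfun (R t w) x - apply_bcontfun (R t u) x\<bar> \<le> C * \<epsilon>" .
      qed (use ca in simp)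
      finally show ?thesis by linarith
    qed
    have "(\<integral>x. ln (apply_bcontfun u x) \<partial>\<mu>) \<le> (\<integral>x. ln (apply_bcontfun w x) \<partial>\<mu>) + \<epsilon> / (a / 2)"
      using integral_le_bound[OF Bochner_Integration.integrable_diff[OF i(1,2)] d1]
      unfolding Bochner_Integration.integral_diff[OF i(1,2)] by linarith
    also have "(\<integral>x. ln (apply_bcontfun w x) \<partial>\<mu>) \<le> (\<integral>x. ln (apply_bcontfun (R t w) x) \<partial>\<mu>)"
      by (rule log_integral_increasing_domain[OF D w(1) t])
    also have "\<dots> \<le> (\<integral>x. ln (apply_bcontfun (R t u) x) \<partial>\<mu>) + C * \<epsilon> / (c * (a / 2))"
      using integral_le_bound[OF Bochner_Integration.integrable_diff[OF i(4,3)] d2]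
      unfolding Bochner_Integration.integral_diff[OF i(4,3)] by linarith
    also have "(\<integral>x. ln (apply_bcontfun (R t u) x) \<partial>\<mu>) + C * \<epsilon> / (c * (a / 2)) + \<epsilon> / (a / 2)
       = (\<integral>x. ln (apply_bcontfun (R t u) x) \<partial>\<mu>) + \<epsilon> * K"
      by (simp add: K_def distrib_left)
    also have "\<epsilon> * K = e" using K by (simp add: \<epsilon>_def)
    finally show "(\<integral>x. ln (apply_bcontfun u x) \<partial>\<mu>) \<le> (\<integral>x. ln (apply_bcontfun (R t u) x) \<partial>\<mu>) + e" by simp
  qed
qed

end

locale kernel_on_prob = operator_kernel S k + borel_prob \<mu>
  for S :: "'a::metric_space operator" and k :: "'a \<Rightarrow> 'a measure" and \<mu> :: "'a measure"
begin

text \<open>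
  The logarithm is Lipschitz on the range of the functions involved. An approximation of \<open>u\<close> by
  continuous functions in \<open>L\<^sup>1(\<mu>)\<close> handles the left side, one in \<open>L\<^sup>1(push \<mu>)\<close> the right side; a
  simultaneous approximation does both.
\<close>

lemma log_increasing_borel:
  fixes u :: "'a \<Rightarrow> real" and a b c :: real
  assumes H: "log_increasing S \<mu>"
    and c: "0 < c" "\<And>x. c \<le> apply_bcontfun (S (const_bcontfun 1)) x"
    and u[measurable]: "u \<in> borel_measurable borel" and a: "0 < a" "\<And>x. a \<le> u x" "\<And>x. u x \<le> b"
  shows "integrable \<mu> (\<lambda>x. ln (\<integral>y. u y \<partial>k x))"
    and "(\<integral>x. ln (u x) \<partial>\<mu>) \<le> (\<integral>x. ln (\<integral>y. u y \<partial>k x) \<partial>\<mu>)"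
proof -
  have low: "a * c \<le> (\<integral>y. f y \<partial>k x)"
    if "f \<in> borel_measurable borel" "\<And>y. a \<le> f y" "\<And>y. f y \<le> b" for f :: "'a \<Rightarrow> real" and x
    using integral_k_bounds(1)[of f a b x] that a(1) c(2)[of x] mult_left_mono[of c _ a]
    by (meson less_imp_le order_trans)
  have unn: "0 \<le> u y" for y using a(1) a(2)[of y] by simp
  have ac: "0 < a * c" using a c by simp
  have mu: "(\<lambda>x. \<integral>y. u y \<partial>k x) \<in> borel_measurable borel" by (rule measurable_integral_k[OF u unn a(3)])
  show iu: "integrable \<mu> (\<lambda>x. ln (\<integral>y. u y \<partial>k x))"
    by (rule integrable_ln[OF mu ac low[OF u a(2,3)] integral_k_bounds(2)[OF u less_imp_le[OF a(1)] a(2,3)]])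
  show "(\<integral>x. ln (u x) \<partial>\<mu>) \<le> (\<integral>x. ln (\<integral>y. u y \<partial>k x) \<partial>\<mu>)"
  proof (rule field_le_epsilon)
    fix e :: real assume e: "0 < e"
    define K where "K = 1 / a + 1 / (a * c)"
    have K: "0 < K" using a c by (auto simp: K_def intro!: add_pos_pos)
    define \<epsilon> where "\<epsilon> = e / K"
    have \<epsilon>: "0 < \<epsilon>" using e K by (simp add: \<epsilon>_def)
    obtain f :: "'a \<Rightarrow>\<^sub>C real" where f: "\<And>x. a \<le> f x" "\<And>x. f x \<le> b"
      "(\<integral>\<^sup>+x. ennreal \<bar>u x - f x\<bar> \<partial>\<mu>) < ennreal \<epsilon>" "(\<integral>\<^sup>+x. ennreal \<bar>u x - f x\<bar> \<partial>push \<mu>) < ennreal \<epsilon>"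
      using bounded_dense_two_measures[OF sets_eq _ sets_push[OF sets_eq] finite_push[OF sets_eq] u a(2,3) \<epsilon>]
        finite_measure_axioms by blast
    have fm: "apply_bcontfun f \<in> borel_measurable borel" by measurable
    define \<delta> where "\<delta> x = (\<integral>y. \<bar>u y - f y\<bar> \<partial>k x)" for x
    have ub: "\<bar>u y - f y\<bar> \<le> b" for y using a(2,3)[of y] f(1,2)[of y] a(1) by (auto simp: abs_le_iff)
    have du: "(\<lambda>y. \<bar>u y - f y\<bar>) \<in> borel_measurable borel" by measurable
    have \<delta>m: "\<delta> \<in> borel_measurable borel" unfolding \<delta>_def by (rule measurable_integral_k[OF du _ ub]) simp
    have \<delta>app: "app (\<lambda>y. ennreal \<bar>u y - f y\<bar>) x = ennreal (\<delta> x)" for x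
      unfolding \<delta>_def by (rule app_eq_integral[OF du _ ub]) simp
    have \<delta>0: "0 \<le> \<delta> x" for x unfolding \<delta>_def by (simp add: integral_nonneg_AE)
    have n1: "integrable \<mu> (\<lambda>x. \<bar>u x - f x\<bar>)" "(\<integral>x. \<bar>u x - f x\<bar> \<partial>\<mu>) \<le> \<epsilon>"
    proof -
      show i: "integrable \<mu> (\<lambda>x. \<bar>u x - f x\<bar>)" by (rule integrable_bounded[where B=b]) (use ub in auto)
      have "ennreal (\<integral>x. \<bar>u x - f x\<bar> \<partial>\<mu>) < ennreal \<epsilon>"
        using f(3) i by (subst (asm) nn_integral_eq_integral) auto
      then show "(\<integral>x. \<bar>u x - f x\<bar> \<partial>\<mu>) \<le> \<epsilon>" using \<epsilon> by (simp add: ennreal_less_iff)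
    qed
    have n2: "integrable \<mu> \<delta>" "(\<integral>x. \<delta> x \<partial>\<mu>) \<le> \<epsilon>"
    proof -
      have lt: "(\<integral>\<^sup>+x. ennreal (\<delta> x) \<partial>\<mu>) < ennreal \<epsilon>"
        using f(4) by (subst (asm) nn_integral_push) (auto simp: \<delta>app)
      show i: "integrable \<mu> \<delta>"
        using lt \<delta>m \<delta>0 by (intro integrableI_nonneg) (auto intro: less_trans)
      have "ennreal (\<integral>x. \<delta> x \<partial>\<mu>) < ennreal \<epsilon>"
        using lt i \<delta>0 by (subst (asm) nn_integral_eq_integral) auto
      then show "(\<integral>x. \<delta> x \<partial>\<mu>) \<le> \<epsilon>" using \<epsilon> \<delta>0 by (simp add: ennreal_less_iff)
    qed
    have i1: "integrable \<mu> (\<lambda>x. ln (u x))" by (rule integrable_ln[OF u a])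
    have i2: "integrable \<mu> (\<lambda>x. ln (apply_bcontfun f x))" by (rule integrable_ln_bcontfun[OF a(1) f(1)])
    have lowS: "a * c \<le> apply_bcontfun (S f) x" for x
      using low[OF fm f(1,2), of x] by (simp add: integral_k)
    have i3: "integrable \<mu> (\<lambda>x. ln (apply_bcontfun (S f) x))" by (rule integrable_ln_bcontfun[OF ac lowS])
    have d1: "ln (u x) \<le> ln (apply_bcontfun f x) + \<bar>u x - f x\<bar> / a" for x
      using abs_ln_diff_le[OF a(1) a(2)[of x] f(1)[of x]] by linarith
    have d2: "ln (apply_bcontfun (S f) x) \<le> ln (\<integral>y. u y \<partial>k x) + \<delta> x / (a * c)" for x
    proof -
      have "ln (apply_bcontfun (S f) x) - ln (\<integral>y. u y \<partial>k x) \<le> \<bar>apply_bcontfun (S f) x - (\<integral>y. u y \<partial>k x)\<bar> / (a * c)"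
        using abs_ln_diff_le[OF ac lowS[of x] low[OF u a(2,3), of x]] by linarith
      also have "\<dots> \<le> \<delta> x / (a * c)"
      proof (rule divide_right_mono)
        have iu': "integrable (k x) u" "integrable (k x) (apply_bcontfun f)"
        proof -
          show "integrable (k x) u"
          proof (rule integrable_k[OF u])
            show "\<bar>u y\<bar> \<le> b" for y using a(2,3)[of y] a(1) by simp
          qed
          show "integrable (k x) (apply_bcontfun f)"
            by (rule integrable_k[OF fm]) (use norm_bounded[of f] in simp)
        qed
        have "\<bar>apply_bcontfun (S f) x - (\<integral>y. u y \<partial>k x)\<bar> = \<bar>\<integral>y. u y - f y \<partial>k x\<bar>"
          using iu' by (simp add: integral_k abs_minus_commute)
        also have "\<dots> \<le> \<delta> x" unfolding \<delta>_def by (rule integral_abs_bound)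
        finally show "\<bar>apply_bcontfun (S f) x - (\<integral>y. u y \<partial>k x)\<bar> \<le> \<delta> x" .
      qed (use ac in simp)
      finally show ?thesis by linarith
    qed
    have "(\<integral>x. ln (u x) \<partial>\<mu>) \<le> (\<integral>x. ln (apply_bcontfun f x) + \<bar>u x - f x\<bar> / a \<partial>\<mu>)"
      using i1 i2 n1(1) d1 by (intro integral_mono) auto
    also have "\<dots> = (\<integral>x. ln (apply_bcontfun f x) \<partial>\<mu>) + (\<integral>x. \<bar>u x - f x\<bar> \<partial>\<mu>) / a"
      using i2 n1(1) by simp
    also have "\<dots> \<le> (\<integral>x. ln (apply_bcontfun (S f) x) \<partial>\<mu>) + \<epsilon> / a"
      using H n1(2) a(1) f(1) unfolding log_increasing_def by (intro add_mono divide_right_mono) auto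
    also have "(\<integral>x. ln (apply_bcontfun (S f) x) \<partial>\<mu>) \<le> (\<integral>x. ln (\<integral>y. u y \<partial>k x) + \<delta> x / (a * c) \<partial>\<mu>)"
      using i3 iu n2(1) d2 by (intro integral_mono) auto
    also have "\<dots> = (\<integral>x. ln (\<integral>y. u y \<partial>k x) \<partial>\<mu>) + (\<integral>x. \<delta> x \<partial>\<mu>) / (a * c)"
      using iu n2(1) by simp
    also have "\<dots> \<le> (\<integral>x. ln (\<integral>y. u y \<partial>k x) \<partial>\<mu>) + \<epsilon> / (a * c)"
      using n2(2) ac by (intro add_left_mono divide_right_mono) auto
    finally have "(\<integral>x. ln (u x) \<partial>\<mu>) \<le> (\<integral>x. ln (\<integral>y. u y \<partial>k x) \<partial>\<mu>) + \<epsilon> * K"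
      by (simp add: K_def distrib_left)
    also have "\<epsilon> * K = e" using K by (simp add: \<epsilon>_def)
    finally show "(\<integral>x. ln (u x) \<partial>\<mu>) \<le> (\<integral>x. ln (\<integral>y. u y \<partial>k x) \<partial>\<mu>) + e" .
  qed
qed

end

section \<open>The variational characterisation of equilibrium measures\<close>

text \<open>
  The witness is the resolvent integral of the constant \<open>1\<close>, cut at a time \<open>T\<close> at which the semigroup
  \<open>S\<close> with growth rate \<open>-e\<close> maps \<open>1\<close> below \<open>1\<close>: the generator of \<open>S\<close> sends it to \<open>S\<^sub>T 1 - 1 \<le> 0\<close>.
\<close>

lemma near_harmonic_function:
  assumes Q: "positive_semigroup (Q :: real \<Rightarrow> 'a::metric_space operator)" and e: "0 < e"
  defines "R \<equiv> scaled_semigroup (- principal_eigenvalue Q) Q"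
  shows "\<exists>w\<in>positive_domain R. \<forall>x. apply_bcontfun (generator R w) x \<le> e * apply_bcontfun w x"
proof -
  interpret Q: pos_semigroup Q by standard fact
  have R: "positive_semigroup R" unfolding R_def by (rule positive_semigroup_scaled[OF Q])
  define S where "S = scaled_semigroup (- e) R"
  interpret S: pos_semigroup S by standard (simp add: S_def positive_semigroup_scaled[OF R])
  have S: "S t = exp (- (principal_eigenvalue Q + e) * t) *\<^sub>R Q t" for t
    by (simp add: S_def R_def scaled_semigroup_def algebra_simps flip: exp_add)
  have "\<forall>\<^sub>F t in at_top. 0 < t \<and> norm (Q t) \<le> exp ((principal_eigenvalue Q + e) * t)"
    by (intro eventually_conj eventually_gt_at_top Q.norm_R_eventually_le e)
  then obtain T where T: "0 < T" "norm (Q T) \<le> exp ((principal_eigenvalue Q + e) * T)"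
    using eventually_happens'[OF trivial_limit_at_top_linorder] by blast
  have "norm (S T) = exp (- (principal_eigenvalue Q + e) * T) * norm (Q T)" by (simp add: S)
  also have "\<dots> \<le> exp (- (principal_eigenvalue Q + e) * T) * exp ((principal_eigenvalue Q + e) * T)"
    by (intro mult_left_mono T) auto
  also have "\<dots> = 1" by (simp add: algebra_simps flip: exp_add)
  finally have ST: "apply_bcontfun (S T S.one) x \<le> 1" for x
    using S.R_one_le_norm[of T x] by linarith
  define w where "w = integral {0..T} (\<lambda>s. S s S.one)"
  have w: "w \<in> generator_domain S" "generator S w = S T S.one - S.one"
    unfolding w_def using S.generator_integral[of T S.one] T by auto
  have dom: "w \<in> generator_domain R" using w(1) by (simp add: S_def generator_domain_scaled_semigroup[OF R])
  have gen: "generator S w = generator R w - e *\<^sub>R w"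
    unfolding S_def by (simp add: generator_scaled_semigroup(2)[OF R dom])
  obtain c C where c: "0 < c" "\<And>t x. 0 \<le> t \<Longrightarrow> t \<le> T \<Longrightarrow> c \<le> apply_bcontfun (S t S.one) x"
    by (rule S.R_one_bounds[of T]) blast
  have wpos: "0 < apply_bcontfun w x" for x
  proof -
    have int: "(\<lambda>s. S s S.one) integrable_on {0..T}"
      by (rule integrable_continuous_real, rule continuous_on_subset[OF S.R_continuous]) auto
    have "0 < T * c" using T c by simp
    also have "\<dots> = integral {0..T} (\<lambda>s. c)" using T by simp
    also have "\<dots> \<le> integral {0..T} ((\<lambda>f. apply_bcontfun f x) \<circ> (\<lambda>s. S s S.one))"
      using c by (intro integral_le integrable_linear[OF int bounded_linear_eval]) auto
    also have "\<dots> = apply_bcontfun w x"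
      unfolding w_def by (rule integral_linear[OF int bounded_linear_eval])
    finally show ?thesis .
  qed
  have "apply_bcontfun (generator R w) x \<le> e * apply_bcontfun w x" for x
  proof -
    have "generator R w = S T S.one - S.one + e *\<^sub>R w" using gen w(2) by simp
    then show ?thesis using ST[of x] by simp
  qed
  moreover have "w \<in> positive_domain R" using dom wpos by (simp add: positive_domain_def)
  ultimately show ?thesis by blast
qed

text \<open>
  The infimum in the rate function is at most \<open>\<lambda> - \<mu>(V)\<close> by \<open>near_harmonic_function\<close>; thus being an
  equilibrium measure is the opposite inequality alone.
\<close>

lemma equilibrium_measure_iff_dissipative:
  fixes P Q :: "real \<Rightarrow> 'a::metric_space operator"
  assumes X: "compact (UNIV :: 'a set)"
    and Q: "schrodinger_semigroup P V Q" and \<mu>: "\<mu> \<in> borel_prob_measures"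
  shows "equilibrium_measure P V Q \<mu> \<longleftrightarrow>
    dissipative (scaled_semigroup (- principal_eigenvalue Q) Q) \<mu>"
proof -
  define l0 where "l0 = principal_eigenvalue Q"
  define R where "R = scaled_semigroup (- l0) Q"
  interpret borel_prob \<mu>
    using \<mu> unfolding borel_prob_def borel_prob_axioms_def borel_prob_measures_def by simp
  have pQ: "positive_semigroup Q" using Q by (simp add: schrodinger_semigroup_def)
  have domR: "generator_domain R = generator_domain P"
    using Q by (simp add: R_def generator_domain_scaled_semigroup[OF pQ] schrodinger_semigroup_def)
  then have pd: "positive_domain R = positive_domain P" by (simp add: positive_domain_def)
  define J where "J u = (\<integral>x. apply_bcontfun (generator P u) x / apply_bcontfun u x \<partial>\<mu>)" for u
  define v where "v = (\<integral>x. apply_bcontfun V x \<partial>\<mu>)"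
  have intV: "integrable \<mu> (apply_bcontfun V)"
    by (rule integrable_bounded[where B="norm V"]) (use norm_bounded[of V] in auto)
  have intq: "integrable \<mu> (\<lambda>x. apply_bcontfun g x / apply_bcontfun u x)"
    if u: "u \<in> positive_domain P" for g u
  proof -
    obtain a where a: "0 < a" "\<And>x. a \<le> apply_bcontfun u x"
      by (rule compact_positive_lower_bound[OF X, of u]) (use u in \<open>auto simp: positive_domain_def\<close>)
    show ?thesis
    proof (rule integrable_bounded)
      show "\<bar>apply_bcontfun g x / apply_bcontfun u x\<bar> \<le> norm g / a" for x
        using norm_bounded[of g x] a(1) a(2)[of x] unfolding abs_divide by (intro frac_le) auto
    qed measurable
  qed
  have JR: "(\<integral>x. apply_bcontfun (generator R u) x / apply_bcontfun u x \<partial>\<mu>) = J u + v - l0"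
    if u: "u \<in> positive_domain P" for u
  proof -
    have dom: "u \<in> generator_domain Q" "u \<in> generator_domain P" and upos: "\<And>x. 0 < apply_bcontfun u x"
      using u Q by (auto simp: positive_domain_def schrodinger_semigroup_def)
    have "apply_bcontfun (generator R u) x / apply_bcontfun u x =
        apply_bcontfun (generator P u) x / apply_bcontfun u x + apply_bcontfun V x - l0" for x
      using upos[of x] Q dom unfolding R_def generator_scaled_semigroup(2)[OF pQ dom(1)]
      by (simp add: schrodinger_semigroup_def field_simps)
    then show ?thesis
      using intq[OF u, of "generator P u"] intV by (simp add: J_def v_def prob_space[simplified])
  qed
  let ?I = "INF u\<in>positive_domain P. ereal (J u)"
  have eq: "equilibrium_measure P V Q \<mu> \<longleftrightarrow> ereal l0 = ereal v + ?I"
    using \<mu> unfolding equilibrium_measure_def dv_rate_def l0_def J_def v_def by (simp add: minus_ereal_def)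
  have up: "?I \<le> ereal (l0 - v)"
  proof (rule ereal_le_epsilon2)
    fix e :: real assume e: "0 < e"
    obtain w where w: "w \<in> positive_domain R" "\<And>x. apply_bcontfun (generator R w) x \<le> e * apply_bcontfun w x"
      using near_harmonic_function[OF pQ e] unfolding R_def l0_def by blast
    then have w': "w \<in> positive_domain P" and wpos: "\<And>x. 0 < apply_bcontfun w x"
      using pd by (auto simp: positive_domain_def)
    have "(\<integral>x. apply_bcontfun (generator R w) x / apply_bcontfun w x \<partial>\<mu>) \<le> e"
      using w(2) wpos by (intro integral_le_bound intq[OF w']) (simp add: divide_le_eq)
    then have "J w \<le> l0 - v + e" by (simp add: JR[OF w'])
    then have "ereal (J w) \<le> ereal (l0 - v) + ereal e" by simp
    moreover have "?I \<le> ereal (J w)" by (rule INF_lower[OF w'])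
    ultimately show "?I \<le> ereal (l0 - v) + ereal e" by (rule order_trans[rotated])
  qed
  have "ereal l0 = ereal v + ?I \<longleftrightarrow> ereal (l0 - v) \<le> ?I"
  proof
    assume *: "ereal l0 = ereal v + ?I"
    then show "ereal (l0 - v) \<le> ?I" by (cases ?I) auto
  next
    assume "ereal (l0 - v) \<le> ?I"
    with up have "?I = ereal (l0 - v)" by (rule antisym)
    then show "ereal l0 = ereal v + ?I" by simp
  qed
  also have "\<dots> \<longleftrightarrow> (\<forall>u\<in>positive_domain P. l0 - v \<le> J u)" by (simp add: le_INF_iff)
  also have "\<dots> \<longleftrightarrow> dissipative R \<mu>"
    unfolding dissipative_def pd using JR by (intro ball_cong refl) auto
  finally show ?thesis using eq by (simp add: R_def l0_def)
qed

section \<open>Invariance, ground states and logarithmic growth for a single operator\<close>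

lemma push_eq_iff_integral_invariant:
  assumes rep: "operator_kernel S k" and \<pi>: "borel_prob \<pi>"
  shows "(\<forall>f. (\<integral>x. apply_bcontfun (S f) x \<partial>\<pi>) = (\<integral>x. apply_bcontfun f x \<partial>\<pi>)) \<longleftrightarrow>
    operator_kernel.push S k \<pi> = \<pi>"
proof -
  interpret operator_kernel S k by fact
  interpret borel_prob \<pi> by fact
  have sp: "sets (push \<pi>) = sets borel" by simp
  have fin: "finite_measure (push \<pi>)" by (rule finite_push) (simp_all add: finite_measure_axioms)
  have int: "integrable \<pi> (apply_bcontfun f)" for f :: "'a \<Rightarrow>\<^sub>C real"
    by (rule integrable_bounded[where B="norm f"]) (use norm_bounded[of f] in auto)
  have intp: "integrable (push \<pi>) (apply_bcontfun f)" for f :: "'a \<Rightarrow>\<^sub>C real"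
    using norm_bounded[of f] sp
    by (intro finite_measure.integrable_const_bound[OF fin, where B="norm f"])
      (auto simp: measurable_cong_sets[OF sp refl])
  have pos: "(\<integral>y. apply_bcontfun f y \<partial>push \<pi>) = (\<integral>x. apply_bcontfun (S f) x \<partial>\<pi>)"
    if f: "\<And>x. 0 \<le> apply_bcontfun f x" for f :: "'a \<Rightarrow>\<^sub>C real"
  proof -
    have Sf: "0 \<le> apply_bcontfun (S f) x" for x
      unfolding integral_k[symmetric] using f by (simp add: integral_nonneg_AE)
    have "ennreal (\<integral>y. apply_bcontfun f y \<partial>push \<pi>) = (\<integral>\<^sup>+y. ennreal (apply_bcontfun f y) \<partial>push \<pi>)"
      using f intp by (intro nn_integral_eq_integral[symmetric]) auto
    also have "\<dots> = (\<integral>\<^sup>+x. ennreal (apply_bcontfun (S f) x) \<partial>\<pi>)"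
      by (subst nn_integral_push) (auto simp: app_bcontfun f)
    also have "\<dots> = ennreal (\<integral>x. apply_bcontfun (S f) x \<partial>\<pi>)"
      using Sf int by (intro nn_integral_eq_integral) auto
    finally show ?thesis using f Sf by (simp add: integral_nonneg_AE)
  qed
  show ?thesis
  proof
    assume H: "\<forall>f. (\<integral>x. apply_bcontfun (S f) x \<partial>\<pi>) = (\<integral>x. apply_bcontfun f x \<partial>\<pi>)"
    show "push \<pi> = \<pi>"
      by (rule finite_borel_measure_eqI[OF sp fin]) (use pos H finite_measure_axioms in auto)
  next
    assume eq: "push \<pi> = \<pi>"
    have *: "(\<integral>x. apply_bcontfun (S f) x \<partial>\<pi>) = (\<integral>x. apply_bcontfun f x \<partial>\<pi>)"
      if "\<And>x. 0 \<le> apply_bcontfun f x" for f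
      using pos[OF that] eq by simp
    show "\<forall>f. (\<integral>x. apply_bcontfun (S f) x \<partial>\<pi>) = (\<integral>x. apply_bcontfun f x \<partial>\<pi>)"
    proof
      fix f :: "'a \<Rightarrow>\<^sub>C real"
      define c :: "'a \<Rightarrow>\<^sub>C real" where "c = const_bcontfun (norm f)"
      have "0 \<le> apply_bcontfun (f + c) x" for x using norm_bounded[of f x] by (simp add: c_def)
      then have 1: "(\<integral>x. apply_bcontfun (S (f + c)) x \<partial>\<pi>) = (\<integral>x. apply_bcontfun (f + c) x \<partial>\<pi>)" by (rule *)
      have 2: "(\<integral>x. apply_bcontfun (S c) x \<partial>\<pi>) = (\<integral>x. apply_bcontfun c x \<partial>\<pi>)" by (rule *) (simp add: c_def)
      have 3: "(\<integral>x. apply_bcontfun (S (f + c)) x \<partial>\<pi>) = (\<integral>x. apply_bcontfun (S f) x \<partial>\<pi>) + (\<integral>x. apply_bcontfun (S c) x \<partial>\<pi>)"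
        using int[of "S f"] int[of "S c"] by (simp add: blinfun.add_right)
      have 4: "(\<integral>x. apply_bcontfun (f + c) x \<partial>\<pi>) = (\<integral>x. apply_bcontfun f x \<partial>\<pi>) + (\<integral>x. apply_bcontfun c x \<partial>\<pi>)"
        using int[of f] int[of c] by simp
      show "(\<integral>x. apply_bcontfun (S f) x \<partial>\<pi>) = (\<integral>x. apply_bcontfun f x \<partial>\<pi>)" using 1 2 3 4 by linarith
    qed
  qed
qed

text \<open>
  The operator \<open>S\<close> stands for \<open>exp (-\<lambda>t) Q\<^sub>t\<close> at one fixed time. Division by \<open>\<psi>\<close> takes place in the reals,
  so \<open>1 / \<psi> x\<close> is \<open>0\<close> where \<open>\<psi> x = 0\<close>, a \<open>\<mu>\<close>-null set that may have positive \<open>\<pi>\<close>-measure.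
\<close>

locale density_pair = kernel_on_prob S k \<mu> + \<pi>: borel_prob \<pi>
  for S :: "'a::metric_space operator" and k :: "'a \<Rightarrow> 'a measure" and \<mu> \<pi> :: "'a measure" +
  fixes \<psi> :: "'a \<Rightarrow> real" and c0 :: real
  assumes psi_borel [measurable]: "\<psi> \<in> borel_measurable borel"
    and psi_nonneg: "\<And>x. 0 \<le> \<psi> x"
    and mu_eq: "\<mu> = density \<pi> (\<lambda>x. ennreal (\<psi> x))"
    and ln_psi: "integrable \<mu> (\<lambda>x. ln (\<psi> x))"
    and c0: "0 < c0" "\<And>x. c0 \<le> apply_bcontfun (S (const_bcontfun 1)) x"
begin

lemma nn_integral_mu:
  assumes [measurable]: "f \<in> borel_measurable borel"
  shows "(\<integral>\<^sup>+x. f x \<partial>\<mu>) = (\<integral>\<^sup>+x. ennreal (\<psi> x) * f x \<partial>\<pi>)"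
  unfolding mu_eq by (rule nn_integral_density) measurable

lemma AE_mu_iff: "(AE x in \<mu>. P x) \<longleftrightarrow> (AE x in \<pi>. 0 < \<psi> x \<longrightarrow> P x)"
  unfolding mu_eq using psi_nonneg by (subst AE_density) auto

lemma integral_k_pos:
  fixes f :: "'a \<Rightarrow> real"
  assumes "f \<in> borel_measurable borel" "0 < a" "\<And>y. a \<le> f y" "\<And>y. f y \<le> b"
  shows "0 < (\<integral>y. f y \<partial>k x)"
proof -
  have "0 < a * apply_bcontfun (S (const_bcontfun 1)) x"
    using assms(2) c0(1) c0(2)[of x] by (intro mult_pos_pos) auto
  also have "\<dots> \<le> (\<integral>y. f y \<partial>k x)"
    using assms by (intro integral_k_bounds(1)) auto
  finally show ?thesis .
qed

lemma AE_psi_pos: "AE x in \<mu>. 0 < \<psi> x"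
  unfolding AE_mu_iff by simp

lemma nn_integral_psi: "(\<integral>\<^sup>+x. ennreal (\<psi> x) \<partial>\<pi>) = 1"
  using nn_integral_mu[of "\<lambda>_. 1"] emeasure_space_1 by simp

lemma nn_integral_div_psi_le:
  assumes [measurable]: "f \<in> borel_measurable borel"
  shows "(\<integral>\<^sup>+x. f x * ennreal (1 / \<psi> x) \<partial>\<mu>) \<le> (\<integral>\<^sup>+x. f x \<partial>\<pi>)"
proof -
  have "(\<integral>\<^sup>+x. f x * ennreal (1 / \<psi> x) \<partial>\<mu>) = (\<integral>\<^sup>+x. ennreal (\<psi> x) * (f x * ennreal (1 / \<psi> x)) \<partial>\<pi>)"
    by (rule nn_integral_mu) measurable
  also have "\<dots> \<le> (\<integral>\<^sup>+x. f x \<partial>\<pi>)"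
  proof (rule nn_integral_mono)
    fix x
    have "ennreal (\<psi> x) * (f x * ennreal (1 / \<psi> x)) = f x * ennreal (\<psi> x * (1 / \<psi> x))"
      unfolding ennreal_mult'[OF psi_nonneg] by (simp only: mult_ac)
    also have "\<dots> \<le> f x * 1" by (intro mult_left_mono) auto
    finally show "ennreal (\<psi> x) * (f x * ennreal (1 / \<psi> x)) \<le> f x" by simp
  qed
  finally show ?thesis .
qed

lemma nn_integral_div_psi:
  assumes [measurable]: "f \<in> borel_measurable borel" and pos: "\<And>x. 0 < \<psi> x"
  shows "(\<integral>\<^sup>+x. f x * ennreal (1 / \<psi> x) \<partial>\<mu>) = (\<integral>\<^sup>+x. f x \<partial>\<pi>)"
proof -
  have "(\<integral>\<^sup>+x. f x * ennreal (1 / \<psi> x) \<partial>\<mu>) = (\<integral>\<^sup>+x. ennreal (\<psi> x) * (f x * ennreal (1 / \<psi> x)) \<partial>\<pi>)"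
    by (rule nn_integral_mu) measurable
  also have "\<dots> = (\<integral>\<^sup>+x. f x \<partial>\<pi>)"
  proof (rule nn_integral_cong)
    fix x
    have "ennreal (\<psi> x) * (f x * ennreal (1 / \<psi> x)) = f x * ennreal (\<psi> x * (1 / \<psi> x))"
      unfolding ennreal_mult'[OF psi_nonneg] by (simp only: mult_ac)
    then show "ennreal (\<psi> x) * (f x * ennreal (1 / \<psi> x)) = f x" using pos[of x] by simp
  qed
  finally show ?thesis .
qed

text \<open>
  Integrated Jensen inequality for the Doob transform of \<open>k\<close> by \<open>\<psi>\<close>, in the linearised form
  \<open>ln (u y / \<psi> y) \<le> ln c + u y / (\<psi> y c) - 1\<close> with \<open>c = S u x / \<psi> x\<close>. Multiplied by \<open>\<psi> y\<close> it can be integrated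
  against \<open>k x\<close> and then against \<open>\<pi>\<close>. Positive and negative parts are kept on separate sides
  throughout, so that all integrals are of nonnegative functions and invariance of \<open>\<pi>\<close> applies
  to each of them.
\<close>

theorem log_increasing_if_invariant:
  assumes inv: "push \<pi> = \<pi>" and gs: "AE x in \<mu>. app (\<lambda>y. ennreal (\<psi> y)) x = ennreal (\<psi> x)"
  shows "log_increasing S \<mu>"
  unfolding log_increasing_def
proof (intro allI impI)
  fix u :: "'a \<Rightarrow>\<^sub>C real" and a :: real assume "0 < a" "\<forall>x. a \<le> apply_bcontfun u x"
  then have a: "0 < a" "\<And>x. a \<le> apply_bcontfun u x" by auto
  have invf: "(\<integral>\<^sup>+x. app f x \<partial>\<pi>) = (\<integral>\<^sup>+x. f x \<partial>\<pi>)" if "f \<in> borel_measurable borel" for f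
    using nn_integral_push[OF \<pi>.sets_eq that] inv by simp
  let ?E = "app (\<lambda>y. ennreal (\<psi> y))"
  have Em: "?E \<in> borel_measurable borel" by (rule measurable_app) measurable
  \<comment> \<open>The ground state equation holds even \<open>\<pi>\<close>-a.e.: \<open>S \<psi> \<ge> \<psi>\<close> everywhere off a null set, and both have \<open>\<pi>\<close>-integral \<open>1\<close>.\<close>
  have E\<pi>: "AE x in \<pi>. ?E x = ennreal (\<psi> x)"
  proof -
    have le: "AE x in \<pi>. ennreal (\<psi> x) \<le> ?E x"
      using gs[unfolded AE_mu_iff]
    proof eventually_elim
      case (elim x)
      then show ?case using psi_nonneg[of x] by (cases "\<psi> x = 0") auto
    qed
    have "(\<integral>\<^sup>+x. ?E x - ennreal (\<psi> x) \<partial>\<pi>) = (\<integral>\<^sup>+x. ?E x \<partial>\<pi>) - (\<integral>\<^sup>+x. ennreal (\<psi> x) \<partial>\<pi>)"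
      using le nn_integral_psi Em by (intro nn_integral_diff) (auto simp: measurable_cong_sets[OF \<pi>.sets_eq refl])
    also have "\<dots> = 0" by (simp add: invf nn_integral_psi)
    finally have "AE x in \<pi>. ?E x - ennreal (\<psi> x) = 0"
      using Em by (subst (asm) nn_integral_0_iff_AE) (auto simp: measurable_cong_sets[OF \<pi>.sets_eq refl])
    with le show ?thesis
      by eventually_elim (metis diff_eq_0_iff_ennreal antisym ennreal_minus_eq_0)
  qed
  have Sul: "a * c0 \<le> apply_bcontfun (S u) x" for x
  proof -
    have "a * c0 \<le> a * apply_bcontfun (S (const_bcontfun 1)) x" using c0(2) a(1) by (intro mult_left_mono) auto
    also have "\<dots> \<le> (\<integral>y. u y \<partial>k x)"
      using a norm_bounded[of u] by (intro integral_k_bounds(1)[where b="norm u"]) (auto intro: abs_le_D1)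
    finally show ?thesis by (simp add: integral_k)
  qed
  have ac: "0 < a * c0" using a c0 by simp
  have upos: "0 < apply_bcontfun u x" "0 < apply_bcontfun (S u) x" for x
    using a(1) a(2)[of x] ac Sul[of x] by auto
  define F where "F y = ln (apply_bcontfun u y) - ln (\<psi> y)" for y
  define l where "l x = ln (apply_bcontfun (S u) x) - ln (\<psi> x)" for x
  have [measurable]: "F \<in> borel_measurable borel" "l \<in> borel_measurable borel"
    unfolding F_def l_def by measurable
  have iln: "integrable \<mu> (\<lambda>x. ln (apply_bcontfun u x))" "integrable \<mu> (\<lambda>x. ln (apply_bcontfun (S u) x))"
    by (rule integrable_ln_bcontfun[OF a] integrable_ln_bcontfun[OF ac Sul])+
  have iF: "integrable \<mu> F" "integrable \<mu> l"
    unfolding F_def l_def using iln ln_psi by auto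
  define Fp where "Fp y = max 0 (F y)" for y
  define Fm where "Fm y = max 0 (- F y)" for y
  define lp where "lp y = max 0 (l y)" for y
  define lm where "lm y = max 0 (- l y)" for y
  have nn: "0 \<le> Fp y" "0 \<le> Fm y" "0 \<le> lp y" "0 \<le> lm y" for y
    by (auto simp: Fp_def Fm_def lp_def lm_def)
  have [measurable]: "Fp \<in> borel_measurable borel" "Fm \<in> borel_measurable borel"
    "lp \<in> borel_measurable borel" "lm \<in> borel_measurable borel"
    unfolding Fp_def Fm_def lp_def lm_def by measurable
  have i: "integrable \<mu> Fp" "integrable \<mu> Fm" "integrable \<mu> lp" "integrable \<mu> lm"
    unfolding Fp_def Fm_def lp_def lm_def using iF by auto
  let ?Ep = "app (\<lambda>y. ennreal (Fp y * \<psi> y))" and ?Em = "app (\<lambda>y. ennreal (Fm y * \<psi> y))"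
  have key: "?Ep x + ennreal (\<psi> x * (1 + lm x)) \<le> ?Em x + ennreal (\<psi> x * lp x) + ennreal (\<psi> x)"
    if x: "?E x = ennreal (\<psi> x)" for x
  proof (cases "\<psi> x = 0")
    case True
    then have "?E x = 0" using x by simp
    then have "AE y in k x. ennreal (\<psi> y) = 0" by (subst (asm) nn_integral_0_iff_AE) auto
    then have "AE y in k x. \<psi> y = 0"
      by eventually_elim (use psi_nonneg in \<open>auto intro: antisym\<close>)
    then have "?Ep x = 0" by (subst nn_integral_0_iff_AE) auto
    then show ?thesis using True by simp
  next
    case False
    then have px: "0 < \<psi> x" using psi_nonneg[of x] by simp
    define c where "c = apply_bcontfun (S u) x / \<psi> x"
    have c: "0 < c" using px upos by (simp add: c_def)
    have lnc: "ln c = l x" unfolding c_def l_def using px upos(2)[of x] by (simp add: ln_div)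
    have pt: "Fp y * \<psi> y + \<psi> y * (1 + lm x) \<le> Fm y * \<psi> y + \<psi> y * lp x + apply_bcontfun u y / c" for y
    proof (cases "\<psi> y = 0")
      case True
      then show ?thesis using upos(1)[of y] c by simp
    next
      case False
      then have py: "0 < \<psi> y" using psi_nonneg[of y] by simp
      have "ln (apply_bcontfun u y / \<psi> y / c) \<le> apply_bcontfun u y / \<psi> y / c - 1"
        using py c upos by (intro ln_le_minus_one divide_pos_pos) auto
      also have "ln (apply_bcontfun u y / \<psi> y / c) = F y - l x"
        using py c upos(1)[of y] by (simp add: F_def lnc[symmetric] ln_div ln_mult)
      finally have "F y * \<psi> y \<le> (l x + apply_bcontfun u y / \<psi> y / c - 1) * \<psi> y"
        using py by (intro mult_right_mono) auto
      also have "\<dots> = l x * \<psi> y + apply_bcontfun u y / c - \<psi> y"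
        using py c by (simp add: field_simps)
      finally have "F y * \<psi> y \<le> l x * \<psi> y + apply_bcontfun u y / c - \<psi> y" .
      moreover have "F y * \<psi> y = Fp y * \<psi> y - Fm y * \<psi> y"
        by (simp add: Fp_def Fm_def max_def algebra_simps)
      moreover have "l x * \<psi> y = lp x * \<psi> y - lm x * \<psi> y"
        by (simp add: lp_def lm_def max_def algebra_simps)
      ultimately show ?thesis by (simp add: algebra_simps)
    qed
    have "?Ep x + ennreal (\<psi> x) * ennreal (1 + lm x) =
        (\<integral>\<^sup>+y. ennreal (Fp y * \<psi> y) + ennreal (\<psi> y) * ennreal (1 + lm x) \<partial>k x)"
      by (subst nn_integral_add) (auto simp: nn_integral_multc x)
    also have "\<dots> \<le> (\<integral>\<^sup>+y. ennreal (Fm y * \<psi> y) + ennreal (\<psi> y) * ennreal (lp x) + ennreal (apply_bcontfun u y) * ennreal (1 / c) \<partial>k x)"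
    proof (rule nn_integral_mono)
      fix y
      have 1: "ennreal (Fp y * \<psi> y) + ennreal (\<psi> y) * ennreal (1 + lm x) = ennreal (Fp y * \<psi> y + \<psi> y * (1 + lm x))"
        using nn psi_nonneg[of y] by (subst ennreal_mult[symmetric]) (auto simp: ennreal_plus)
      have 2: "ennreal (Fm y * \<psi> y) + ennreal (\<psi> y) * ennreal (lp x) + ennreal (apply_bcontfun u y) * ennreal (1 / c)
          = ennreal (Fm y * \<psi> y + \<psi> y * lp x + apply_bcontfun u y / c)"
        using nn psi_nonneg[of y] c upos(1)[of y]
        by (subst ennreal_mult[symmetric], simp, simp, subst ennreal_mult[symmetric]) (auto simp: ennreal_plus)
      show "ennreal (Fp y * \<psi> y) + ennreal (\<psi> y) * ennreal (1 + lm x) \<le>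
          ennreal (Fm y * \<psi> y) + ennreal (\<psi> y) * ennreal (lp x) + ennreal (apply_bcontfun u y) * ennreal (1 / c)"
        unfolding 1 2 using pt[of y] by (rule ennreal_leI)
    qed
    also have "\<dots> = ?Em x + ?E x * ennreal (lp x) + app (\<lambda>y. ennreal (apply_bcontfun u y)) x * ennreal (1 / c)"
      by (simp add: nn_integral_add nn_integral_multc)
    also have "app (\<lambda>y. ennreal (apply_bcontfun u y)) x * ennreal (1 / c) = ennreal (\<psi> x)"
      using upos(1) upos(2)[of x] c px by (subst app_bcontfun) (auto simp: less_imp_le c_def simp flip: ennreal_mult)
    finally show ?thesis using px nn[of x] by (simp add: x ennreal_mult)
  qed
  have real_nn: "(\<integral>\<^sup>+x. ennreal (\<psi> x * g x) \<partial>\<pi>) = ennreal (\<integral>x. g x \<partial>\<mu>)"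
    if [measurable]: "g \<in> borel_measurable borel" and "integrable \<mu> g" "\<And>x. 0 \<le> g x" for g :: "'a \<Rightarrow> real"
  proof -
    have "(\<integral>\<^sup>+x. ennreal (\<psi> x * g x) \<partial>\<pi>) = (\<integral>\<^sup>+x. ennreal (g x) \<partial>\<mu>)"
      using psi_nonneg that by (subst nn_integral_mu) (auto simp: ennreal_mult)
    also have "\<dots> = ennreal (\<integral>x. g x \<partial>\<mu>)" using that by (intro nn_integral_eq_integral) auto
    finally show ?thesis .
  qed
  have mE: "?Ep \<in> borel_measurable borel" "?Em \<in> borel_measurable borel"
    by (rule measurable_app, measurable)+
  note [measurable] = mE
  have i1: "integrable \<mu> (\<lambda>x. 1 + lm x)" using i by auto
  have IE: "(\<integral>\<^sup>+x. ?Ep x \<partial>\<pi>) = ennreal (\<integral>x. Fp x \<partial>\<mu>)" "(\<integral>\<^sup>+x. ?Em x \<partial>\<pi>) = ennreal (\<integral>x. Fm x \<partial>\<mu>)"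
    using real_nn[of Fp] real_nn[of Fm] i nn by (simp_all add: invf mult.commute)
  have Il: "(\<integral>\<^sup>+x. ennreal (\<psi> x * (1 + lm x)) \<partial>\<pi>) = ennreal (\<integral>x. 1 + lm x \<partial>\<mu>)"
    "(\<integral>\<^sup>+x. ennreal (\<psi> x * lp x) \<partial>\<pi>) = ennreal (\<integral>x. lp x \<partial>\<mu>)"
    by (rule real_nn; use i i1 nn in simp)+
  have "ennreal (\<integral>x. Fp x \<partial>\<mu>) + ennreal (\<integral>x. 1 + lm x \<partial>\<mu>) = (\<integral>\<^sup>+x. ?Ep x + ennreal (\<psi> x * (1 + lm x)) \<partial>\<pi>)"
    unfolding IE(1)[symmetric] Il(1)[symmetric] by (rule nn_integral_add[symmetric]) measurable
  also have "\<dots> \<le> (\<integral>\<^sup>+x. ?Em x + ennreal (\<psi> x * lp x) + ennreal (\<psi> x) \<partial>\<pi>)"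
    using E\<pi> by (intro nn_integral_mono_AE) (auto elim!: eventually_mono intro: key)
  also have "\<dots> = (\<integral>\<^sup>+x. ?Em x + ennreal (\<psi> x * lp x) \<partial>\<pi>) + (\<integral>\<^sup>+x. ennreal (\<psi> x) \<partial>\<pi>)"
    by (rule nn_integral_add) measurable
  also have "(\<integral>\<^sup>+x. ?Em x + ennreal (\<psi> x * lp x) \<partial>\<pi>) = (\<integral>\<^sup>+x. ?Em x \<partial>\<pi>) + (\<integral>\<^sup>+x. ennreal (\<psi> x * lp x) \<partial>\<pi>)"
    by (rule nn_integral_add) measurable
  also note IE(2)
  also note Il(2)
  also note nn_integral_psi
  finally have "ennreal ((\<integral>x. Fp x \<partial>\<mu>) + (\<integral>x. 1 + lm x \<partial>\<mu>)) \<le> ennreal ((\<integral>x. Fm x \<partial>\<mu>) + (\<integral>x. lp x \<partial>\<mu>) + 1)"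
    using nn by (simp add: ennreal_plus integral_nonneg_AE)
  then have "(\<integral>x. Fp x \<partial>\<mu>) + (\<integral>x. 1 + lm x \<partial>\<mu>) \<le> (\<integral>x. Fm x \<partial>\<mu>) + (\<integral>x. lp x \<partial>\<mu>) + 1"
    using nn by (subst (asm) ennreal_le_iff) (auto intro!: add_nonneg_nonneg integral_nonneg_AE)
  moreover have "(\<integral>x. 1 + lm x \<partial>\<mu>) = 1 + (\<integral>x. lm x \<partial>\<mu>)" using i by (simp add: prob_space[simplified])
  moreover have "(\<integral>x. F x \<partial>\<mu>) = (\<integral>x. Fp x \<partial>\<mu>) - (\<integral>x. Fm x \<partial>\<mu>)"
    unfolding Bochner_Integration.integral_diff[OF i(1,2), symmetric]
    by (rule Bochner_Integration.integral_cong) (auto simp: Fp_def Fm_def)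
  moreover have "(\<integral>x. l x \<partial>\<mu>) = (\<integral>x. lp x \<partial>\<mu>) - (\<integral>x. lm x \<partial>\<mu>)"
    unfolding Bochner_Integration.integral_diff[OF i(3,4), symmetric]
    by (rule Bochner_Integration.integral_cong) (auto simp: lp_def lm_def)
  ultimately have "(\<integral>x. F x \<partial>\<mu>) \<le> (\<integral>x. l x \<partial>\<mu>)" by linarith
  then show "(\<integral>x. ln (apply_bcontfun u x) \<partial>\<mu>) \<le> (\<integral>x. ln (apply_bcontfun (S u) x) \<partial>\<mu>)"
    unfolding F_def l_def using iln ln_psi by simp
qed

text \<open>
  Truncations of \<open>\<psi>\<close> to \<open>[1/(n+1), n+1]\<close>, to which \<open>log_increasing_borel\<close> applies; their logarithms are
  dominated by that of \<open>\<psi>\<close> because the truncation interval is symmetric about \<open>1\<close> on the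
  logarithmic scale.
\<close>

definition clamped :: "nat \<Rightarrow> 'a \<Rightarrow> real" where
  "clamped n x = min (max (\<psi> x) (1 / real (Suc n))) (real (Suc n))"

lemma measurable_clamped [measurable]: "clamped n \<in> borel_measurable borel"
  unfolding clamped_def by measurable

lemma clamped_bounds: "1 / real (Suc n) \<le> clamped n x" "clamped n x \<le> real (Suc n)"
  "clamped n x \<le> \<psi> x + 1 / real (Suc n)"
proof -
  have "1 / real (Suc n) \<le> real (Suc n)" by (simp add: divide_le_eq) (simp add: algebra_simps)
  then show "1 / real (Suc n) \<le> clamped n x" by (simp add: clamped_def)
  have "0 \<le> 1 / real (Suc n)" by simp
  then show "clamped n x \<le> real (Suc n)" "clamped n x \<le> \<psi> x + 1 / real (Suc n)"
    using psi_nonneg[of x] unfolding clamped_def by linarith+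
qed

lemma clamped_pos: "0 < clamped n x"
  using clamped_bounds(1)[of n x] by (rule less_le_trans[rotated]) simp

lemma clamped_tendsto: "(\<lambda>n. clamped n x) \<longlonglongrightarrow> \<psi> x"
proof -
  have "(\<lambda>n. max (\<psi> x) (1 / real (Suc n))) \<longlonglongrightarrow> max (\<psi> x) 0"
    using LIMSEQ_inverse_real_of_nat by (intro tendsto_max tendsto_const) (simp add: inverse_eq_divide)
  then have lim: "(\<lambda>n. max (\<psi> x) (1 / real (Suc n))) \<longlonglongrightarrow> \<psi> x" using psi_nonneg[of x] by simp
  obtain N :: nat where N: "\<psi> x + 1 \<le> real N" using real_arch_simple by blast
  show ?thesis
  proof (rule Lim_transform_eventually[OF lim])
    show "\<forall>\<^sub>F n in sequentially. max (\<psi> x) (1 / real (Suc n)) = clamped n x"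
      using eventually_ge_at_top[of N]
    proof eventually_elim
      case (elim n)
      have "1 / real (Suc n) \<le> 1" by simp
      then have "max (\<psi> x) (1 / real (Suc n)) \<le> real (Suc n)" using N elim psi_nonneg[of x] by linarith
      then show ?case by (simp add: clamped_def)
    qed
  qed
qed

lemma abs_ln_clamped_le:
  assumes "0 < \<psi> x" shows "\<bar>ln (clamped n x)\<bar> \<le> \<bar>ln (\<psi> x)\<bar>"
proof -
  have N: "1 \<le> real (Suc n)" "1 / real (Suc n) \<le> 1" by auto
  consider "\<psi> x < 1 / real (Suc n)" "clamped n x = 1 / real (Suc n)"
    | "real (Suc n) < \<psi> x" "clamped n x = real (Suc n)" | "clamped n x = \<psi> x"
    using N unfolding clamped_def by (smt (verit))
  then show ?thesis
  proof cases
    case 1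
    then have "ln (\<psi> x) \<le> ln (clamped n x)" using assms by (intro ln_mono) auto
    moreover have "ln (clamped n x) \<le> 0" using 1 by (simp add: ln_div)
    ultimately show ?thesis by linarith
  next
    case 2
    then have "ln (clamped n x) \<le> ln (\<psi> x)" using clamped_pos by (intro ln_mono) auto
    moreover have "0 \<le> ln (clamped n x)" using 2 by simp
    ultimately show ?thesis by linarith
  qed simp
qed

lemma integrable_ln_clamped: "integrable \<mu> (\<lambda>x. ln (clamped n x))"
  by (rule integrable_ln[OF _ _ clamped_bounds(1,2)]) auto

lemma integral_ln_clamped_tendsto: "(\<lambda>n. \<integral>x. ln (clamped n x) \<partial>\<mu>) \<longlonglongrightarrow> (\<integral>x. ln (\<psi> x) \<partial>\<mu>)"
proof (rule integral_dominated_convergence[where w="\<lambda>x. \<bar>ln (\<psi> x)\<bar>"])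
  show "AE x in \<mu>. (\<lambda>n. ln (clamped n x)) \<longlonglongrightarrow> ln (\<psi> x)"
    using AE_psi_pos by eventually_elim (auto intro!: tendsto_ln clamped_tendsto)
  show "AE x in \<mu>. norm (ln (clamped n x)) \<le> \<bar>ln (\<psi> x)\<bar>" for n
    using AE_psi_pos by eventually_elim (simp add: abs_ln_clamped_le)
qed (use ln_psi in auto)


text \<open>
  Let \<open>r n\<close> be the quotient of \<open>S (clamped n)\<close> by \<open>\<psi>\<close>. Its \<open>\<mu>\<close>-integral exceeds \<open>1\<close> by at most \<open>1/(n+1)\<close>, by
  subinvariance, and the \<open>\<mu>\<close>-integral of its logarithm is at least \<open>- \<epsilon> n\<close> with \<open>\<epsilon> n \<rightarrow> 0\<close>. The
  inequality \<open>(sqrt r - 1)\<^sup>2 \<le> r - 1 - ln r\<close> turns this into convergence to \<open>1\<close> and, unlike the right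
  side, its left side remains continuous at \<open>r = 0\<close>, where Fatou's lemma might lead.
\<close>

theorem ground_state_if_subinvariant:
  assumes sub: "\<And>f. f \<in> borel_measurable borel \<Longrightarrow> (\<integral>\<^sup>+x. app f x \<partial>\<pi>) \<le> (\<integral>\<^sup>+x. f x \<partial>\<pi>)"
    and H: "log_increasing S \<mu>"
  shows "AE x in \<mu>. app (\<lambda>y. ennreal (\<psi> y)) x = ennreal (\<psi> x)"
proof -
  let ?E = "app (\<lambda>y. ennreal (\<psi> y))"
  have Em[measurable]: "?E \<in> borel_measurable borel" by (rule measurable_app) measurable
  define v where "v n x = (\<integral>y. clamped n y \<partial>k x)" for n x
  define r where "r n x = v n x * (1 / \<psi> x)" for n x
  define \<epsilon> where "\<epsilon> n = (\<integral>x. ln (\<psi> x) \<partial>\<mu>) - (\<integral>x. ln (clamped n x) \<partial>\<mu>)" for n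
  have iv: "integrable \<mu> (\<lambda>x. ln (v n x))" and Hv: "(\<integral>x. ln (clamped n x) \<partial>\<mu>) \<le> (\<integral>x. ln (v n x) \<partial>\<mu>)" for n
    unfolding v_def by (rule log_increasing_borel[OF H c0 measurable_clamped _ clamped_bounds(1,2)]; simp)+
  note clamped_nonneg = less_imp_le[OF clamped_pos]
  have v: "app (\<lambda>y. ennreal (clamped n y)) x = ennreal (v n x)" for n x
    unfolding v_def by (rule app_eq_integral[OF measurable_clamped clamped_nonneg clamped_bounds(2)])
  have vm[measurable]: "v n \<in> borel_measurable borel" for n
    unfolding v_def by (rule measurable_integral_k[OF measurable_clamped clamped_nonneg clamped_bounds(2)])
  have vpos: "0 < v n x" for n x
    unfolding v_def by (rule integral_k_pos[OF measurable_clamped _ clamped_bounds(1,2)]) simp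
  note v0 = less_imp_le[OF vpos]
  have rm[measurable]: "r n \<in> borel_measurable borel" for n unfolding r_def by measurable
  have r0: "0 \<le> r n x" for n x unfolding r_def using v0 psi_nonneg by simp
  have rint: "(\<integral>\<^sup>+x. ennreal (r n x) \<partial>\<mu>) \<le> ennreal (1 + 1 / real (Suc n))" for n
  proof -
    have "(\<integral>\<^sup>+x. ennreal (r n x) \<partial>\<mu>) = (\<integral>\<^sup>+x. ennreal (v n x) * ennreal (1 / \<psi> x) \<partial>\<mu>)"
      unfolding r_def ennreal_mult'[OF v0] ..
    also have "\<dots> \<le> (\<integral>\<^sup>+x. ennreal (v n x) \<partial>\<pi>)" by (rule nn_integral_div_psi_le) measurable
    also have "\<dots> = (\<integral>\<^sup>+x. app (\<lambda>y. ennreal (clamped n y)) x \<partial>\<pi>)" by (simp add: v)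
    also have "\<dots> \<le> (\<integral>\<^sup>+x. ennreal (clamped n x) \<partial>\<pi>)" by (rule sub) measurable
    also have "\<dots> \<le> (\<integral>\<^sup>+x. ennreal (\<psi> x) + ennreal (1 / real (Suc n)) \<partial>\<pi>)"
      using clamped_bounds(3)[of n] psi_nonneg by (intro nn_integral_mono) (simp add: ennreal_leI flip: ennreal_plus)
    also have "\<dots> = 1 + ennreal (1 / real (Suc n))"
      using \<pi>.emeasure_space_1 by (subst nn_integral_add) (auto simp: nn_integral_psi)
    also have "\<dots> = ennreal (1 + 1 / real (Suc n))"
      by (subst ennreal_plus) auto
    finally show ?thesis .
  qed
  have ir: "integrable \<mu> (r n)" for n
    using rint[of n] r0 by (intro integrableI_nonneg) (auto intro: le_less_trans)
  have ri: "(\<integral>x. r n x \<partial>\<mu>) \<le> 1 + 1 / real (Suc n)" for n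
  proof -
    have "ennreal (\<integral>x. r n x \<partial>\<mu>) \<le> ennreal (1 + 1 / real (Suc n))"
      using rint[of n] ir[of n] r0 by (subst (asm) nn_integral_eq_integral) auto
    then show ?thesis by (subst (asm) ennreal_le_iff) auto
  qed
  let ?d = "\<lambda>n x. (sqrt (r n x) - 1)\<^sup>2"
  have sq: "(\<integral>\<^sup>+x. ennreal (?d n x) \<partial>\<mu>) \<le> ennreal (1 / real (Suc n) + \<epsilon> n)" for n
  proof -
    let ?h = "\<lambda>x. r n x - 1 - (ln (v n x) - ln (\<psi> x))"
    have ih: "integrable \<mu> ?h" using ir iv ln_psi by auto
    have pt: "AE x in \<mu>. ?d n x \<le> ?h x"
      using AE_psi_pos
    proof eventually_elim
      case (elim x)
      have rp: "0 < r n x" unfolding r_def using elim vpos[of n x] by simp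
      \<comment> \<open>\<open>ln r = 2 ln (sqrt r) \<le> 2 (sqrt r - 1)\<close>, and \<open>r - 1 - 2 (sqrt r - 1) = (sqrt r - 1)\<^sup>2\<close>.\<close>
      have "ln (v n x) - ln (\<psi> x) = ln (r n x)"
        unfolding r_def using elim vpos[of n x] by (simp add: ln_div)
      also have "\<dots> = 2 * ln (sqrt (r n x))" using rp by (simp add: ln_sqrt)
      also have "\<dots> \<le> 2 * (sqrt (r n x) - 1)" using rp by (intro mult_left_mono ln_le_minus_one) auto
      finally show ?case using rp by (simp add: power2_diff)
    qed
    have h0: "AE x in \<mu>. 0 \<le> ?h x" using pt by eventually_elim (rule order_trans[OF zero_le_power2])
    have "(\<integral>\<^sup>+x. ennreal (?d n x) \<partial>\<mu>) \<le> (\<integral>\<^sup>+x. ennreal (?h x) \<partial>\<mu>)"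
      using pt by (intro nn_integral_mono_AE) (auto elim!: eventually_mono intro: ennreal_leI)
    also have "\<dots> = ennreal (\<integral>x. ?h x \<partial>\<mu>)" by (rule nn_integral_eq_integral[OF ih h0])
    also have "(\<integral>x. ?h x \<partial>\<mu>) = (\<integral>x. r n x \<partial>\<mu>) - 1 - ((\<integral>x. ln (v n x) \<partial>\<mu>) - (\<integral>x. ln (\<psi> x) \<partial>\<mu>))"
      using ir[of n] iv[of n] ln_psi by (simp add: prob_space[simplified])
    also have "\<dots> \<le> 1 / real (Suc n) + \<epsilon> n"
      using ri[of n] Hv[of n] unfolding \<epsilon>_def by linarith
    finally show ?thesis by (simp add: ennreal_leI)
  qed
  have e0: "(\<lambda>n. ennreal (1 / real (Suc n) + \<epsilon> n)) \<longlonglongrightarrow> 0"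
  proof -
    have "(\<lambda>n. 1 / real (Suc n) + \<epsilon> n) \<longlonglongrightarrow> 0 + ((\<integral>x. ln (\<psi> x) \<partial>\<mu>) - (\<integral>x. ln (\<psi> x) \<partial>\<mu>))"
      unfolding \<epsilon>_def using LIMSEQ_inverse_real_of_nat
      by (intro tendsto_add tendsto_diff tendsto_const integral_ln_clamped_tendsto) (simp add: inverse_eq_divide)
    then have "(\<lambda>n. ennreal (1 / real (Suc n) + \<epsilon> n)) \<longlonglongrightarrow> ennreal 0" by (intro tendsto_ennrealI) simp
    then show ?thesis by simp
  qed
  have Efin: "AE x in \<mu>. ?E x < top"
  proof -
    have "(\<integral>\<^sup>+x. ?E x \<partial>\<pi>) \<le> 1" using sub[of "\<lambda>y. ennreal (\<psi> y)"] nn_integral_psi by simp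
    then have "(\<integral>\<^sup>+x. ?E x \<partial>\<pi>) \<noteq> \<infinity>" by (auto simp: top_unique)
    then have "AE x in \<pi>. ?E x \<noteq> \<infinity>"
      using Em by (intro nn_integral_noteq_infinite) (auto simp: measurable_cong_sets[OF \<pi>.sets_eq refl])
    then show ?thesis unfolding AE_mu_iff by eventually_elim (simp add: less_top)
  qed
  have lim: "(\<lambda>n. r n x) \<longlonglongrightarrow> enn2real (?E x) * (1 / \<psi> x)" if fin: "?E x < top" for x
  proof -
    have i\<psi>: "integrable (k x) \<psi>" using fin psi_nonneg by (intro integrableI_nonneg) auto
    have "(\<lambda>n. v n x) \<longlonglongrightarrow> (\<integral>y. \<psi> y \<partial>k x)"
      unfolding v_def
    proof (rule integral_dominated_convergence[where w="\<lambda>y. \<psi> y + 1"])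
      show "integrable (k x) (\<lambda>y. \<psi> y + 1)"
        using i\<psi> finite_k[of x] by (auto simp: finite_measure.integrable_const)
      show "AE y in k x. norm (clamped n y) \<le> \<psi> y + 1" for n
      proof (rule AE_I2)
        fix y
        have "1 / real (Suc n) \<le> 1" by simp
        then have "clamped n y \<le> \<psi> y + 1" using clamped_bounds(3)[of n y] by linarith
        then show "norm (clamped n y) \<le> \<psi> y + 1" using clamped_pos[of n y] by simp
      qed
    qed (auto intro: clamped_tendsto)
    also have "(\<integral>y. \<psi> y \<partial>k x) = enn2real (?E x)"
      using psi_nonneg by (intro integral_eq_nn_integral) auto
    finally show ?thesis unfolding r_def by (intro tendsto_mult tendsto_const)
  qed
  let ?r = "\<lambda>x. enn2real (?E x) * (1 / \<psi> x)"
  have "(\<integral>\<^sup>+x. ennreal ((sqrt (?r x) - 1)\<^sup>2) \<partial>\<mu>) = (\<integral>\<^sup>+x. liminf (\<lambda>n. ennreal (?d n x)) \<partial>\<mu>)"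
  proof (rule nn_integral_cong_AE)
    show "AE x in \<mu>. ennreal ((sqrt (?r x) - 1)\<^sup>2) = liminf (\<lambda>n. ennreal (?d n x))"
      using Efin
    proof eventually_elim
      case (elim x)
      have "(\<lambda>n. ennreal (?d n x)) \<longlonglongrightarrow> ennreal ((sqrt (?r x) - 1)\<^sup>2)"
        by (intro tendsto_ennrealI tendsto_intros lim elim)
      then show ?case by (intro lim_imp_Liminf[symmetric]) auto
    qed
  qed
  also have "\<dots> \<le> liminf (\<lambda>n. \<integral>\<^sup>+x. ennreal (?d n x) \<partial>\<mu>)" by (rule nn_integral_liminf) measurable
  also have "\<dots> \<le> liminf (\<lambda>n. ennreal (1 / real (Suc n) + \<epsilon> n))" by (intro Liminf_mono always_eventually allI sq)
  also have "\<dots> = 0" using e0 by (intro lim_imp_Liminf) auto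
  finally have "(\<integral>\<^sup>+x. ennreal ((sqrt (?r x) - 1)\<^sup>2) \<partial>\<mu>) = 0" by simp
  then have "AE x in \<mu>. ennreal ((sqrt (?r x) - 1)\<^sup>2) = 0"
    by (subst (asm) nn_integral_0_iff_AE) auto
  then show ?thesis
    using Efin AE_psi_pos
  proof eventually_elim
    case (elim x)
    then have "?r x = 1" by simp
    then have "enn2real (?E x) = \<psi> x" using elim(3) by (simp add: field_simps)
    then show ?case using elim(2) by (metis ennreal_enn2real)
  qed
qed

text \<open>
  First variation at \<open>u = \<psi> (1 + s 1\<^sub>A)\<close>, \<open>s \<rightarrow> 0+\<close>. With \<open>M = \<psi> (push \<pi>)\<close> it yields \<open>\<mu> A \<le> M A\<close> for every \<open>A\<close>.
  As \<open>\<psi>\<close> is a ground state and positive, both measures have mass \<open>1\<close>, so positive \<open>s\<close> suffices: the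
  inequality for the complement of \<open>A\<close> is the reverse one. Division of \<open>M = \<mu> = \<psi> \<pi>\<close> by \<open>\<psi>\<close> ends
  the argument.
\<close>

theorem invariant_if_ground_state:
  assumes pos: "\<And>x. 0 < \<psi> x" and H: "log_increasing S \<mu>"
    and gs: "AE x in \<mu>. app (\<lambda>y. ennreal (\<psi> y)) x = ennreal (\<psi> x)"
  shows "push \<pi> = \<pi>"
proof -
  let ?E = "app (\<lambda>y. ennreal (\<psi> y))"
  define M where "M = density (push \<pi>) (\<lambda>x. ennreal (\<psi> x))"
  have sp: "sets (push \<pi>) = sets borel" by simp
  note [measurable_cong] = sp
  have sM: "sets M = sets borel" unfolding M_def by simp
  have EM: "emeasure M A = (\<integral>\<^sup>+x. app (\<lambda>y. ennreal (\<psi> y) * indicator A y) x * ennreal (1 / \<psi> x) \<partial>\<mu>)"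
    if [measurable]: "A \<in> sets borel" for A
  proof -
    have "emeasure M A = (\<integral>\<^sup>+y. ennreal (\<psi> y) * indicator A y \<partial>push \<pi>)"
      unfolding M_def by (rule emeasure_density) measurable
    also have "\<dots> = (\<integral>\<^sup>+x. app (\<lambda>y. ennreal (\<psi> y) * indicator A y) x \<partial>\<pi>)"
      by (rule nn_integral_push) auto
    also have "\<dots> = (\<integral>\<^sup>+x. app (\<lambda>y. ennreal (\<psi> y) * indicator A y) x * ennreal (1 / \<psi> x) \<partial>\<mu>)"
      by (rule nn_integral_div_psi[symmetric, OF measurable_app pos]) measurable
    finally show ?thesis .
  qed
  have cancel: "ennreal (\<psi> x) * ennreal (1 / \<psi> x) = 1" for x
    using pos[of x] by (simp flip: ennreal_mult)
  have total: "(\<integral>\<^sup>+x. ?E x * ennreal (1 / \<psi> x) \<partial>\<mu>) = 1"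
  proof -
    have "(\<integral>\<^sup>+x. ?E x * ennreal (1 / \<psi> x) \<partial>\<mu>) = (\<integral>\<^sup>+x. 1 \<partial>\<mu>)"
      using gs by (intro nn_integral_cong_AE) (auto elim!: eventually_mono simp: cancel)
    then show ?thesis using emeasure_space_1 by simp
  qed
  have M1: "emeasure M UNIV = 1" using EM[of UNIV] total by simp
  interpret M: finite_measure M
    by (rule finite_measureI) (simp add: sets_eq_imp_space_eq[OF sM] M1)
  have div1: "(\<integral>\<^sup>+x. ennreal (1 / \<psi> x) \<partial>\<mu>) = 1"
    using nn_integral_div_psi[of "\<lambda>_. 1", OF _ pos] \<pi>.emeasure_space_1 by simp
  have idiv: "integrable \<mu> (\<lambda>x. 1 / \<psi> x)"
    using psi_nonneg div1 by (intro integrableI_nonneg) auto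
  have ineq: "(s - s\<^sup>2) * measure \<mu> A \<le> s * measure M A"
    if A[measurable]: "A \<in> sets borel" and s: "0 < s" "s < 1" for A s
  proof -
    have bound: "ln (1 + s) * measure \<mu> A \<le> s * measure M A + ((\<integral>x. ln (\<psi> x) \<partial>\<mu>) - (\<integral>x. ln (clamped n x) \<partial>\<mu>))
        + (1 + s) * mass_bound * (1 / real (Suc n))" for n
    proof -
      define u where "u x = clamped n x * (1 + s * indicator A x)" for x
      have um[measurable]: "u \<in> borel_measurable borel" unfolding u_def by measurable
      have ind: "1 \<le> 1 + s * indicator A x" "1 + s * indicator A x \<le> 1 + s" for x
        using s by (auto simp: indicator_def)
      have ub: "1 / real (Suc n) \<le> u x" "u x \<le> real (Suc n) * (1 + s)" for x
      proof -
        have "1 / real (Suc n) * 1 \<le> clamped n x * (1 + s * indicator A x)"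
          using clamped_bounds(1)[of n x] ind[of x] clamped_pos[of n x] by (intro mult_mono) (auto intro: less_imp_le)
        then show "1 / real (Suc n) \<le> u x" by (simp add: u_def)
        show "u x \<le> real (Suc n) * (1 + s)"
          unfolding u_def using clamped_bounds(2)[of n x] ind[of x] by (intro mult_mono) auto
      qed
      have upos: "0 < u x" for x using ub(1)[of x] by (rule less_le_trans[rotated]) simp
      define v where "v x = (\<integral>y. u y \<partial>k x)" for x
      have iv: "integrable \<mu> (\<lambda>x. ln (v x))" and Hv: "(\<integral>x. ln (u x) \<partial>\<mu>) \<le> (\<integral>x. ln (v x) \<partial>\<mu>)"
        unfolding v_def by (rule log_increasing_borel[OF H c0 um _ ub]; simp)+
      note u0 = less_imp_le[OF upos]
      have v: "app (\<lambda>y. ennreal (u y)) x = ennreal (v x)" for x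
        unfolding v_def by (rule app_eq_integral[OF um u0 ub(2)])
      have vm[measurable]: "v \<in> borel_measurable borel"
        unfolding v_def by (rule measurable_integral_k[OF um u0 ub(2)])
      have vpos: "0 < v x" for x
        unfolding v_def by (rule integral_k_pos[OF um _ ub]) simp
      define b where "b = (1 + s) * mass_bound * (1 / real (Suc n))"
      have b: "0 \<le> b" using s mass_bound_pos by (simp add: b_def)
      have vle: "(\<integral>\<^sup>+x. ennreal (v x * (1 / \<psi> x)) \<partial>\<mu>) \<le> ennreal (1 + s * measure M A + b)"
      proof -
        have pt: "ennreal (u y) \<le> ennreal (\<psi> y) + ennreal s * (ennreal (\<psi> y) * indicator A y) + ennreal ((1 + s) * (1 / real (Suc n)))" for y
        proof -
          have "u y \<le> (\<psi> y + 1 / real (Suc n)) * (1 + s * indicator A y)"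
            unfolding u_def using clamped_bounds(3)[of n y] ind[of y] by (intro mult_right_mono) auto
          also have "\<dots> = \<psi> y + s * (\<psi> y * indicator A y) + (1 + s * indicator A y) * (1 / real (Suc n))"
            by (simp add: algebra_simps add_divide_distrib)
          also have "\<dots> \<le> \<psi> y + s * (\<psi> y * indicator A y) + (1 + s) * (1 / real (Suc n))"
            using ind[of y] by (intro add_left_mono mult_right_mono) auto
          finally have "ennreal (u y) \<le> ennreal (\<psi> y + s * (\<psi> y * indicator A y) + (1 + s) * (1 / real (Suc n)))"
            by (rule ennreal_leI)
          also have "\<dots> = ennreal (\<psi> y + s * (\<psi> y * indicator A y)) + ennreal ((1 + s) * (1 / real (Suc n)))"
            using psi_nonneg[of y] s by (intro ennreal_plus) auto
          also have "ennreal (\<psi> y + s * (\<psi> y * indicator A y)) = ennreal (\<psi> y) + ennreal s * (ennreal (\<psi> y) * indicator A y)"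
            using psi_nonneg[of y] s by (auto simp: indicator_def ennreal_mult)
          finally show ?thesis .
        qed
        \<comment> \<open>The price of truncating \<open>\<psi>\<close> from below.\<close>
        have one: "app (\<lambda>_. ennreal ((1 + s) * (1 / real (Suc n)))) x \<le> ennreal b" for x
        proof -
          have "app (\<lambda>_. ennreal ((1 + s) * (1 / real (Suc n)))) x = ennreal ((1 + s) * (1 / real (Suc n))) * emeasure (k x) UNIV"
            by simp
          also have "\<dots> \<le> ennreal ((1 + s) * (1 / real (Suc n))) * ennreal mass_bound"
            by (intro mult_left_mono emeasure_k_le) auto
          also have "\<dots> = ennreal b" unfolding b_def using s mass_bound_pos
            by (subst ennreal_mult[symmetric]) (auto simp: mult_ac)
          finally show ?thesis .
        qed
        let ?A = "app (\<lambda>y. ennreal (\<psi> y) * indicator A y)"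
        have vx: "ennreal (v x) \<le> ?E x + ennreal s * ?A x + ennreal b" for x
        proof -
          have "ennreal (v x) \<le> app (\<lambda>y. ennreal (\<psi> y) + ennreal s * (ennreal (\<psi> y) * indicator A y) + ennreal ((1 + s) * (1 / real (Suc n)))) x"
            unfolding v[symmetric] by (intro nn_integral_mono pt)
          also have "\<dots> = ?E x + ennreal s * ?A x + app (\<lambda>_. ennreal ((1 + s) * (1 / real (Suc n)))) x"
            by (subst nn_integral_add, simp, simp, subst nn_integral_add) (simp_all add: nn_integral_cmult)
          also have "\<dots> \<le> ?E x + ennreal s * ?A x + ennreal b" by (intro add_left_mono one)
          finally show ?thesis .
        qed
        have mA[measurable]: "?A \<in> borel_measurable borel" "?E \<in> borel_measurable borel"
          by (rule measurable_app, measurable)+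
        have "(\<integral>\<^sup>+x. ennreal (v x * (1 / \<psi> x)) \<partial>\<mu>) =
            (\<integral>\<^sup>+x. ennreal (v x) * ennreal (1 / \<psi> x) \<partial>\<mu>)"
          using vpos by (intro nn_integral_cong ennreal_mult') (auto intro: less_imp_le)
        also have "\<dots> \<le> (\<integral>\<^sup>+x. (?E x + ennreal s * ?A x + ennreal b) * ennreal (1 / \<psi> x) \<partial>\<mu>)"
          by (intro nn_integral_mono mult_right_mono vx) auto
        also have "\<dots> = (\<integral>\<^sup>+x. ?E x * ennreal (1 / \<psi> x) + ennreal s * (?A x * ennreal (1 / \<psi> x)) + ennreal b * ennreal (1 / \<psi> x) \<partial>\<mu>)"
          by (intro nn_integral_cong) (simp add: distrib_right mult.assoc)
        also have "\<dots> = (\<integral>\<^sup>+x. ?E x * ennreal (1 / \<psi> x) + ennreal s * (?A x * ennreal (1 / \<psi> x)) \<partial>\<mu>) +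
            (\<integral>\<^sup>+x. ennreal b * ennreal (1 / \<psi> x) \<partial>\<mu>)"
          by (rule nn_integral_add) measurable
        also have "(\<integral>\<^sup>+x. ?E x * ennreal (1 / \<psi> x) + ennreal s * (?A x * ennreal (1 / \<psi> x)) \<partial>\<mu>) =
            (\<integral>\<^sup>+x. ?E x * ennreal (1 / \<psi> x) \<partial>\<mu>) + (\<integral>\<^sup>+x. ennreal s * (?A x * ennreal (1 / \<psi> x)) \<partial>\<mu>)"
          by (rule nn_integral_add) measurable
        also note total
        also have "(\<integral>\<^sup>+x. ennreal s * (?A x * ennreal (1 / \<psi> x)) \<partial>\<mu>) = ennreal s * emeasure M A"
          unfolding EM[OF A] by (rule nn_integral_cmult) measurable
        also have "(\<integral>\<^sup>+x. ennreal b * ennreal (1 / \<psi> x) \<partial>\<mu>) = ennreal b"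
          by (subst nn_integral_cmult) (simp_all add: div1)
        also have "1 + ennreal s * emeasure M A + ennreal b = ennreal (1 + s * measure M A + b)"
        proof -
          have "ennreal (1 + s * measure M A + b) = ennreal (1 + s * measure M A) + ennreal b"
            using s b by (intro ennreal_plus) auto
          also have "ennreal (1 + s * measure M A) = ennreal 1 + ennreal (s * measure M A)"
            using s by (intro ennreal_plus) auto
          also have "ennreal (s * measure M A) = ennreal s * emeasure M A"
            using s by (simp add: M.emeasure_eq_measure ennreal_mult)
          finally show ?thesis by simp
        qed
        finally show ?thesis .
      qed
      have ivp: "integrable \<mu> (\<lambda>x. v x * (1 / \<psi> x))"
        using vle vpos psi_nonneg by (intro integrableI_nonneg) (auto intro: le_less_trans simp: less_imp_le)
      have vle': "(\<integral>x. v x * (1 / \<psi> x) \<partial>\<mu>) \<le> 1 + s * measure M A + b"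
      proof -
        have "ennreal (\<integral>x. v x * (1 / \<psi> x) \<partial>\<mu>) \<le> ennreal (1 + s * measure M A + b)"
          using vle vpos psi_nonneg ivp by (subst (asm) nn_integral_eq_integral) (auto simp: less_imp_le)
        then show ?thesis using s b by (subst (asm) ennreal_le_iff) auto
      qed
      have lnv: "ln (v x) \<le> ln (\<psi> x) + v x * (1 / \<psi> x) - 1" for x
      proof -
        have "ln (v x / \<psi> x) \<le> v x / \<psi> x - 1" using vpos pos by (intro ln_le_minus_one) auto
        then show ?thesis using vpos[of x] pos[of x] by (simp add: ln_div)
      qed
      have lnu: "ln (u x) = ln (clamped n x) + ln (1 + s) * indicator A x" for x
        unfolding u_def using clamped_pos[of n x] s by (auto simp: indicator_def ln_mult)
      have "(\<integral>x. ln (clamped n x) \<partial>\<mu>) + ln (1 + s) * measure \<mu> A = (\<integral>x. ln (u x) \<partial>\<mu>)"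
      proof -
        have "integrable \<mu> (\<lambda>x. indicator A x :: real)" by (rule integrable_bounded[where B=1]) auto
        then show ?thesis
          unfolding lnu using integrable_ln_clamped by (subst Bochner_Integration.integral_add) auto
      qed
      also have "\<dots> \<le> (\<integral>x. ln (v x) \<partial>\<mu>)" by (rule Hv)
      also have "\<dots> \<le> (\<integral>x. ln (\<psi> x) + v x * (1 / \<psi> x) - 1 \<partial>\<mu>)"
        using iv ivp ln_psi lnv by (intro integral_mono) auto
      also have "\<dots> = (\<integral>x. ln (\<psi> x) \<partial>\<mu>) + (\<integral>x. v x * (1 / \<psi> x) \<partial>\<mu>) - 1"
        using ivp ln_psi by (simp add: prob_space[simplified])
      finally show ?thesis using vle' unfolding b_def by linarith
    qed
    have "(\<lambda>n. s * measure M A + ((\<integral>x. ln (\<psi> x) \<partial>\<mu>) - (\<integral>x. ln (clamped n x) \<partial>\<mu>))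
        + (1 + s) * mass_bound * (1 / real (Suc n)))
      \<longlonglongrightarrow> s * measure M A + ((\<integral>x. ln (\<psi> x) \<partial>\<mu>) - (\<integral>x. ln (\<psi> x) \<partial>\<mu>)) + (1 + s) * mass_bound * 0"
      using LIMSEQ_inverse_real_of_nat
      by (intro tendsto_add tendsto_diff tendsto_mult tendsto_const integral_ln_clamped_tendsto) (simp add: inverse_eq_divide)
    then have "ln (1 + s) * measure \<mu> A \<le> s * measure M A"
      using bound by (intro LIMSEQ_le_const[of _ "s * measure M A"]) auto
    moreover have "(s - s\<^sup>2) * measure \<mu> A \<le> ln (1 + s) * measure \<mu> A"
      using s by (intro mult_right_mono ln_one_plus_pos_lower_bound) auto
    ultimately show ?thesis by linarith
  qed
  have le: "measure \<mu> A \<le> measure M A" if A: "A \<in> sets borel" for A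
  proof (rule field_le_mult_one_interval)
    fix z :: real assume z: "0 < z" "z < 1"
    have "((1 - z) - (1 - z)\<^sup>2) * measure \<mu> A \<le> (1 - z) * measure M A"
      using z by (intro ineq A) auto
    then have "(1 - z) * (z * measure \<mu> A) \<le> (1 - z) * measure M A"
      by (simp add: power2_eq_square algebra_simps)
    then show "z * measure \<mu> A \<le> measure M A" using z by simp
  qed
  have "M = \<mu>"
  proof (rule measure_eqI)
    show "sets M = sets \<mu>" using sM by simp
    fix A assume "A \<in> sets M"
    then have A: "A \<in> sets borel" using sM by simp
    have "measure M (UNIV - A) = 1 - measure M A"
      using M.finite_measure_compl[of A] A M1 sM by (simp add: sets_eq_imp_space_eq[OF sM] M.emeasure_eq_measure)
    moreover have "measure \<mu> (UNIV - A) = 1 - measure \<mu> A"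
      using prob_compl[of A] A by simp
    ultimately have "measure M A = measure \<mu> A" using le[OF A] le[of "UNIV - A"] A by simp
    then show "emeasure M A = emeasure \<mu> A" by (simp add: M.emeasure_eq_measure emeasure_eq_measure)
  qed
  show ?thesis
  proof (rule measure_eqI)
    show "sets (push \<pi>) = sets \<pi>" by simp
    fix A assume "A \<in> sets (push \<pi>)"
    then have A[measurable]: "A \<in> sets borel" by simp
    have "emeasure (push \<pi>) A = (\<integral>\<^sup>+x. ennreal (\<psi> x) * (indicator A x * ennreal (1 / \<psi> x)) \<partial>push \<pi>)"
    proof -
      have "ennreal (\<psi> x) * (indicator A x * ennreal (1 / \<psi> x)) = indicator A x" for x
        using cancel[of x] by (simp add: indicator_def)
      then show ?thesis by simp
    qed
    also have "\<dots> = (\<integral>\<^sup>+x. indicator A x * ennreal (1 / \<psi> x) \<partial>M)"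
      unfolding M_def by (rule nn_integral_density[symmetric]) measurable
    also have "\<dots> = (\<integral>\<^sup>+x. indicator A x \<partial>\<pi>)"
      unfolding \<open>M = \<mu>\<close> by (rule nn_integral_div_psi[OF _ pos]) measurable
    also have "\<dots> = emeasure \<pi> A" by simp
    finally show "emeasure (push \<pi>) A = emeasure \<pi> A" .
  qed
qed

end

theorem theorem1:
  fixes P Q :: "real \<Rightarrow> 'a::metric_space operator"
    and V :: "'a \<Rightarrow>\<^sub>C real"
    and \<mu> \<pi> :: "'a measure"
    and \<psi> :: "'a \<Rightarrow> real"
  assumes compact_X: "compact (UNIV :: 'a set)"
    and markov: "markov_semigroup P"
    and schrodinger: "schrodinger_semigroup P V Q"
    and mu: "\<mu> \<in> borel_prob_measures"
    and pi: "\<pi> \<in> borel_prob_measures"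
    and ac: "absolutely_continuous \<pi> \<mu>"
    and psi_borel: "\<psi> \<in> borel_measurable borel"
    and psi_nonneg: "\<And>x. 0 \<le> \<psi> x"
    and psi_density: "AE x in \<pi>. ennreal (\<psi> x) = RN_deriv \<pi> \<mu> x"
    and ln_psi: "integrable \<mu> (\<lambda>x. ln (\<psi> x))"
  shows "(ground_measure Q \<pi> \<longrightarrow> ground_state Q \<mu> \<psi> \<longrightarrow> equilibrium_measure P V Q \<mu>) \<and>
         (ground_measure Q \<pi> \<longrightarrow> equilibrium_measure P V Q \<mu> \<longrightarrow> ground_state Q \<mu> \<psi>) \<and>
         ((\<forall>x. 0 < \<psi> x) \<longrightarrow>
            equilibrium_measure P V Q \<mu> \<longrightarrow> ground_state Q \<mu> \<psi> \<longrightarrow> ground_measure Q \<pi>)"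
proof -
  define l0 where "l0 = principal_eigenvalue Q"
  define R where "R = scaled_semigroup (- l0) Q"
  have pQ: "positive_semigroup Q" using schrodinger by (simp add: schrodinger_semigroup_def)
  then have pR: "positive_semigroup R" by (simp add: R_def positive_semigroup_scaled)
  interpret \<mu>: borel_prob \<mu>
    using mu unfolding borel_prob_def borel_prob_axioms_def borel_prob_measures_def by simp
  interpret \<pi>: borel_prob \<pi>
    using pi unfolding borel_prob_def borel_prob_axioms_def borel_prob_measures_def by simp
  interpret R: semigroup_on_prob R \<mu>
    by unfold_locales (use pR compact_X in auto)
  define k where "k t x = density (semigroup_kernel Q t x) (\<lambda>_. ennreal (exp (- l0 * t)))" for t x
  have repQ: "represents (Q t) (semigroup_kernel Q t)" if "0 \<le> t" for t
  proof (rule represents_semigroup_kernel[OF compact_X])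
    interpret Q: pos_semigroup Q by standard fact
    show "0 \<le> apply_bcontfun (Q t f) x" if "\<And>x. 0 \<le> apply_bcontfun f x" for f x
      using \<open>0 \<le> t\<close> that by (rule Q.R_nonneg)
  qed
  have rep: "operator_kernel (R t) (k t)" if "0 \<le> t" for t
  proof
    show "represents (R t) (k t)"
      using represents_scaleR[OF repQ[OF that], of "exp (- l0 * t)"]
      by (simp add: R_def scaled_semigroup_def k_def[abs_def])
  qed
  have mu_eq: "\<mu> = density \<pi> (\<lambda>x. ennreal (\<psi> x))"
  proof -
    have "\<mu> = density \<pi> (RN_deriv \<pi> \<mu>)"
      by (rule \<pi>.density_RN_deriv[symmetric, OF ac]) simp
    also have "\<dots> = density \<pi> (\<lambda>x. ennreal (\<psi> x))"
      using psi_density psi_borel by (intro density_cong) (auto elim!: eventually_mono)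
    finally show ?thesis .
  qed
  have pair: "\<exists>c. density_pair (R t) (k t) \<mu> \<pi> \<psi> c" if t: "0 \<le> t" for t
  proof -
    obtain c C where c: "0 < c" "\<And>s x. 0 \<le> s \<Longrightarrow> s \<le> t \<Longrightarrow> c \<le> apply_bcontfun (R s R.one) x"
      by (rule R.R_one_bounds[of t]) blast
    interpret operator_kernel "R t" "k t" by (rule rep[OF t])
    have "density_pair (R t) (k t) \<mu> \<pi> \<psi> c"
      by unfold_locales (use psi_borel psi_nonneg mu_eq ln_psi c t in auto)
    then show ?thesis ..
  qed
  have eq: "equilibrium_measure P V Q \<mu> \<longleftrightarrow> (\<forall>t\<ge>0. log_increasing (R t) \<mu>)"
    using equilibrium_measure_iff_dissipative[OF compact_X schrodinger mu]
      R.dissipative_if_log_increasing R.log_increasing_if_dissipative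
    unfolding R_def l0_def by blast
  have gm: "ground_measure Q \<pi> \<longleftrightarrow> (\<forall>t\<ge>0. operator_kernel.push (R t) (k t) \<pi> = \<pi>)"
  proof -
    have "exp (- principal_eigenvalue Q * t) * apply_bcontfun (Q t f) x = apply_bcontfun (R t f) x" for t f x
      by (simp add: R_def l0_def scaled_semigroup_def blinfun.scaleR_left)
    then have "ground_measure Q \<pi> \<longleftrightarrow>
        (\<forall>t\<ge>0. \<forall>f. (\<integral>x. apply_bcontfun (R t f) x \<partial>\<pi>) = (\<integral>x. apply_bcontfun f x \<partial>\<pi>))"
      using pi by (simp add: ground_measure_def)
    then show ?thesis
      using push_eq_iff_integral_invariant[OF rep \<pi>.borel_prob_axioms] by simp
  qed
  have gs: "ground_state Q \<mu> \<psi> \<longleftrightarrow>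
      (\<forall>t\<ge>0. AE x in \<mu>. (\<integral>\<^sup>+y. ennreal (\<psi> y) \<partial>k t x) = ennreal (\<psi> x))"
  proof -
    obtain c where "density_pair (R 0) (k 0) \<mu> \<pi> \<psi> c" using pair[of 0] by auto
    then have "AE x in \<mu>. 0 < \<psi> x" by (rule density_pair.AE_psi_pos)
    moreover have "ennreal (exp (- principal_eigenvalue Q * t)) * extended_semigroup Q t \<psi> x =
        (\<integral>\<^sup>+y. ennreal (\<psi> y) \<partial>k t x)" if t: "0 \<le> t" for t x
    proof -
      have [measurable_cong]: "sets (semigroup_kernel Q t x) = sets borel"
        using repQ[OF t] by (simp add: represents_def)
      show ?thesis
        unfolding extended_semigroup_def k_def l0_def using psi_borel
        by (subst nn_integral_density) (auto simp: nn_integral_cmult)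
    qed
    ultimately show ?thesis using psi_borel psi_nonneg by (simp add: ground_state_def)
  qed
  show ?thesis
    unfolding eq gm gs
  proof (intro conjI impI allI)
    fix t :: real assume t: "0 \<le> t"
    obtain c where "density_pair (R t) (k t) \<mu> \<pi> \<psi> c" using pair[OF t] by auto
    then interpret density_pair "R t" "k t" \<mu> \<pi> \<psi> c .
    {
      assume "\<forall>t\<ge>0. operator_kernel.push (R t) (k t) \<pi> = \<pi>"
        and "\<forall>t\<ge>0. AE x in \<mu>. (\<integral>\<^sup>+y. ennreal (\<psi> y) \<partial>k t x) = ennreal (\<psi> x)"
      then show "log_increasing (R t) \<mu>" using t by (intro log_increasing_if_invariant) auto
    next
      assume "\<forall>t\<ge>0. operator_kernel.push (R t) (k t) \<pi> = \<pi>" and H: "\<forall>t\<ge>0. log_increasing (R t) \<mu>"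
      then have inv: "push \<pi> = \<pi>" using t by simp
      show "AE x in \<mu>. (\<integral>\<^sup>+y. ennreal (\<psi> y) \<partial>k t x) = ennreal (\<psi> x)"
      proof (rule ground_state_if_subinvariant)
        show "(\<integral>\<^sup>+x. app f x \<partial>\<pi>) \<le> (\<integral>\<^sup>+x. f x \<partial>\<pi>)" if "f \<in> borel_measurable borel" for f
          using nn_integral_push[OF \<pi>.sets_eq that] unfolding inv by simp
        show "log_increasing (R t) \<mu>" using H t by simp
      qed
    next
      assume "\<forall>x. 0 < \<psi> x" and "\<forall>t\<ge>0. log_increasing (R t) \<mu>"
        and "\<forall>t\<ge>0. AE x in \<mu>. (\<integral>\<^sup>+y. ennreal (\<psi> y) \<partial>k t x) = ennreal (\<psi> x)"
      then show "operator_kernel.push (R t) (k t) \<pi> = \<pi>" using t by (intro invariant_if_ground_state) auto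
    }
  qed
qed

end
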